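(* Let $P_1,P_2$ be non-commutative Poisson algebras over $K$ of the same class (both of Class 1 or both of Class 2), with degree maps $u_i:P_i\to\mathbb Z_{\ge0}\cup\{-\infty\}$ ($i=1,2$) whose induced filtrations are finite and discrete. Assume that the associated graded non-commutative Poisson algebras $gr\,P_1$ and $gr\,P_2$ are both commutative under their Poisson brackets (i.e. their brackets vanish identically). Let $z_1\in P_1\setminus Z(P_1)$, $z_2\in P_2\setminus Z(P_2)$ and $\Theta=z_1\otimes z_2\in P_1\otimes P_2$. (a) If $C(z_1)\subsetneq N(z_1)$ or $C(z_2)\subsetneq N(z_2)$, then $\Theta$ is nilpotent, and $\Theta$ is strictly nilpotent if and only if $z_1$ and $z_2$ are both strictly nilpotent. (b) If $N(z_1)=C(z_1)$ and $N(z_2)=C(z_2)$, then $\Theta\in\Omega_0'(P_1\otimes P_2)$. (c) If $N(z_1)=C(z_1)$ or $N(z_2)=C(z_2)$, then $C(\Theta)=C(z_1)\otimes C(z_2)$.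
   Context: $K$ is an algebraically closed field of characteristic zero; tensor products are over $K$. A non-commutative Poisson algebra over $K$ is a $K$-vector space $P$ with a bilinear product $\cdot$ making it a unital associative (not necessarily commutative) $K$-algebra and a bilinear bracket $\{\cdot,\cdot\}$ making it a Lie algebra, such that $\{x,yz\}=\{x,y\}z+y\{x,z\}$ for all $x,y,z\in P$. It is of Class 1 if $(P,\cdot)$ is commutative, and of Class 2 if $(P,\cdot)$ is non-commutative and $\{a,b\}=ab-ba$ for all $a,b$. $Z(P)$ is the set of elements central for both the product and the bracket; for Class 1 or 2, $Z(P)=\{z\mid \{z,w\}=0\ \forall w\in P\}$. Tensor product: if $P_1,P_2$ are both of Class 1, $P_1\otimes P_2$ carries the bracket $\{a_1\otimes a_2,b_1\otimes b_2\}=\{a_1,b_1\}\otimes a_2b_2+b_1a_1\otimes\{a_2,b_2\}$; if both are of Class 2, the bracket on $P_1\otimes P_2$ is the commutator. This makes $P_1\otimes P_2$ a non-commutative Poisson algebra of the same class. A degree map on $P$ is a map $u:P\to\mathbb Z\cup\{-\infty\}$ such that for all $z,w\in P$: $u(\{z,w\})\le u(zw)=u(z)+u(w)$; $u(z+w)\le\max\{u(z),u(w)\}$; $u(z)=-\infty$ iff $z=0$. Its induced filtration is $P_t=\{a\in P\mid u(a)\le t\}$, $t\in\mathbb Z$; it is finite if every $P_t$ is finite dimensional over $K$ and discrete if $P_t=\{0\}$ for all $t<0$. The associated graded algebra is $gr\,P=\bigoplus_{i}P_i/P_{i-1}$ with $(x+P_{i-1})(y+P_{j-1})=xy+P_{i+j-1}$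 and $\{x+P_{i-1},y+P_{j-1}\}=\{x,y\}+P_{i+j-1}$ for $x\in P_i,y\in P_j$. For an element $z$ of a non-commutative Poisson algebra $P$ put $ad_z(w)=\{z,w\}$ and $Ev(z)=\{\lambda\in K\mid \exists x\in P\setminus\{0\},\ ad_z(x)=\lambda x\}$, $F(z)=\{x\in P\mid \dim_K K[ad_z](x)<\infty\}$, $N(z)=\{x\in P\mid \exists m,\ ad_z^m(x)=0\}$, $C(z)=\{x\in P\mid ad_z(x)=0\}$. For $z_i$ these are formed in $P_i$; for $\Theta$ in $P_1\otimes P_2$. Types: for $z$ with $Ev(z)=\{0\}$, $z\in\Omega_0'(P)$ if $C(z)=F(z)\subsetneq P$; $z\in\Omega_1(P)$ (strictly nilpotent) if $C(z)\subsetneq N(z)=P$; $z\in\Omega_1'(P)$ (weakly nilpotent) if $C(z)\subsetneq N(z)\subsetneq P$. An element is nilpotent if it lies in $\Omega_1(P)\cup\Omega_1'(P)$. *)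

theory Defs
  imports
    "HOL-Algebra.Module"
    "HOL-Algebra.AbelCoset"
    "HOL-Computational_Algebra.Polynomial"
    "HOL-Library.Poly_Mapping"
    "HOL-Library.Extended"
begin

section \<open>Non-commutative Poisson algebras\<close>

text \<open>
  The ground field is a type \<open>'k\<close> of class \<^class>\<open>field\<close>; algebras over it are records
  with an explicit carrier. \<open>scalars\<close> turns \<open>'k\<close> into a ring record, so that the module
  theory of \<open>HOL-Algebra\<close> applies.
\<close>

definition scalars :: "'k::field ring" where
  "scalars = \<lparr>carrier = UNIV, monoid.mult = (*), one = 1, zero = 0, add = (+)\<rparr>"

record ('k, 'a) nc_poisson = "('k, 'a) module" +
  pbracket :: "'a \<Rightarrow> 'a \<Rightarrow> 'a" (\<open>\<lbrace>_,/ _\<rbrace>\<index>\<close>)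

locale nc_poisson_algebra = Module.module scalars P + ring P
  for P :: "('k::field, 'a) nc_poisson" (structure) +
  assumes smult_mult_left:
      "\<lbrakk>x \<in> carrier P; y \<in> carrier P\<rbrakk> \<Longrightarrow> (c \<odot> x) \<otimes> y = c \<odot> (x \<otimes> y)"
    and smult_mult_right:
      "\<lbrakk>x \<in> carrier P; y \<in> carrier P\<rbrakk> \<Longrightarrow> x \<otimes> (c \<odot> y) = c \<odot> (x \<otimes> y)"
    and bracket_closed:
      "\<lbrakk>x \<in> carrier P; y \<in> carrier P\<rbrakk> \<Longrightarrow> \<lbrace>x, y\<rbrace> \<in> carrier P"
    and bracket_add_left:
      "\<lbrakk>x \<in> carrier P; y \<in> carrier P; z \<in> carrier P\<rbrakk> \<Longrightarrow> \<lbrace>x \<oplus> y, z\<rbrace> = \<lbrace>x, z\<rbrace> \<oplus> \<lbrace>y, z\<rbrace>"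
    and bracket_add_right:
      "\<lbrakk>x \<in> carrier P; y \<in> carrier P; z \<in> carrier P\<rbrakk> \<Longrightarrow> \<lbrace>x, y \<oplus> z\<rbrace> = \<lbrace>x, y\<rbrace> \<oplus> \<lbrace>x, z\<rbrace>"
    and bracket_smult_left:
      "\<lbrakk>x \<in> carrier P; y \<in> carrier P\<rbrakk> \<Longrightarrow> \<lbrace>c \<odot> x, y\<rbrace> = c \<odot> \<lbrace>x, y\<rbrace>"
    and bracket_smult_right:
      "\<lbrakk>x \<in> carrier P; y \<in> carrier P\<rbrakk> \<Longrightarrow> \<lbrace>x, c \<odot> y\<rbrace> = c \<odot> \<lbrace>x, y\<rbrace>"
    and bracket_alternating:
      "x \<in> carrier P \<Longrightarrow> \<lbrace>x, x\<rbrace> = \<zero>"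
    and jacobi:
      "\<lbrakk>x \<in> carrier P; y \<in> carrier P; z \<in> carrier P\<rbrakk> \<Longrightarrow>
         \<lbrace>x, \<lbrace>y, z\<rbrace>\<rbrace> \<oplus> \<lbrace>y, \<lbrace>z, x\<rbrace>\<rbrace> \<oplus> \<lbrace>z, \<lbrace>x, y\<rbrace>\<rbrace> = \<zero>"
    and leibniz:
      "\<lbrakk>x \<in> carrier P; y \<in> carrier P; z \<in> carrier P\<rbrakk> \<Longrightarrow>
         \<lbrace>x, y \<otimes> z\<rbrace> = \<lbrace>x, y\<rbrace> \<otimes> z \<oplus> y \<otimes> \<lbrace>x, z\<rbrace>"

definition commutative_product :: "('k, 'a) nc_poisson \<Rightarrow> bool" where
  "commutative_product P \<longleftrightarrow> (\<forall>x\<in>carrier P. \<forall>y\<in>carrier P. x \<otimes>\<^bsub>P\<^esub> y = y \<otimes>\<^bsub>P\<^esub> x)"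

definition commutative_bracket :: "('k, 'a) nc_poisson \<Rightarrow> bool" where
  "commutative_bracket P \<longleftrightarrow> (\<forall>x\<in>carrier P. \<forall>y\<in>carrier P. \<lbrace>x, y\<rbrace>\<^bsub>P\<^esub> = \<zero>\<^bsub>P\<^esub>)"

definition class_1 :: "('k, 'a) nc_poisson \<Rightarrow> bool" where
  "class_1 P \<longleftrightarrow> commutative_product P"

definition class_2 :: "('k, 'a) nc_poisson \<Rightarrow> bool" where
  "class_2 P \<longleftrightarrow> \<not> commutative_product P \<and>
     (\<forall>x\<in>carrier P. \<forall>y\<in>carrier P. \<lbrace>x, y\<rbrace>\<^bsub>P\<^esub> = x \<otimes>\<^bsub>P\<^esub> y \<ominus>\<^bsub>P\<^esub> y \<otimes>\<^bsub>P\<^esub> x)"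

definition poisson_center :: "('k, 'a) nc_poisson \<Rightarrow> 'a set" where
  "poisson_center P = {z \<in> carrier P. \<forall>w\<in>carrier P.
     z \<otimes>\<^bsub>P\<^esub> w = w \<otimes>\<^bsub>P\<^esub> z \<and> \<lbrace>z, w\<rbrace>\<^bsub>P\<^esub> = \<zero>\<^bsub>P\<^esub>}"

definition lin_span :: "('k::field, 'a) nc_poisson \<Rightarrow> 'a set \<Rightarrow> 'a set" where
  "lin_span P S = (\<lambda>W. submodule W scalars P) hull S"

definition fin_dim :: "('k::field, 'a) nc_poisson \<Rightarrow> 'a set \<Rightarrow> bool" where
  "fin_dim P W \<longleftrightarrow> (\<exists>B. finite B \<and> B \<subseteq> carrier P \<and> W = lin_span P B)"

section \<open>Degree maps, filtrations, associated graded algebras\<close>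

text \<open>
  The type \<^typ>\<open>int extended\<close> also has a greatest element \<^const>\<open>Pinf\<close>, which a degree
  map must avoid.
\<close>

definition degree_map :: "('k, 'a) nc_poisson \<Rightarrow> ('a \<Rightarrow> int extended) \<Rightarrow> bool" where
  "degree_map P u \<longleftrightarrow>
     (\<forall>z\<in>carrier P. u z \<noteq> Pinf) \<and>
     (\<forall>z\<in>carrier P. \<forall>w\<in>carrier P.
        u \<lbrace>z, w\<rbrace>\<^bsub>P\<^esub> \<le> u (z \<otimes>\<^bsub>P\<^esub> w) \<and>
        u (z \<otimes>\<^bsub>P\<^esub> w) = u z + u w \<and>
        u (z \<oplus>\<^bsub>P\<^esub> w) \<le> max (u z) (u w)) \<and>
     (\<forall>z\<in>carrier P. u z = Minf \<longleftrightarrow> z = \<zero>\<^bsub>P\<^esub>)"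

definition filt :: "('k, 'a) nc_poisson \<Rightarrow> ('a \<Rightarrow> int extended) \<Rightarrow> int \<Rightarrow> 'a set" where
  "filt P u t = {a \<in> carrier P. u a \<le> Fin t}"

definition finite_filtration :: "('k::field, 'a) nc_poisson \<Rightarrow> ('a \<Rightarrow> int extended) \<Rightarrow> bool" where
  "finite_filtration P u \<longleftrightarrow> (\<forall>t. fin_dim P (filt P u t))"

definition discrete_filtration :: "('k, 'a) nc_poisson \<Rightarrow> ('a \<Rightarrow> int extended) \<Rightarrow> bool" where
  "discrete_filtration P u \<longleftrightarrow> (\<forall>t<0. filt P u t = {\<zero>\<^bsub>P\<^esub>})"

text \<open>\<open>gr_piece P u i\<close> is the additive group \<open>P\<^sub>i / P\<^sub>i\<^sub>-\<^sub>1\<close>, written multiplicatively.\<close>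

definition gr_piece :: "('k, 'a) nc_poisson \<Rightarrow> ('a \<Rightarrow> int extended) \<Rightarrow> int \<Rightarrow> 'a set monoid" where
  "gr_piece P u i = add_monoid (P\<lparr>carrier := filt P u i\<rparr>) Mod filt P u (i - 1)"

text \<open>
  The operation on the graded algebra induced by \<open>f\<close> sends \<open>x + P\<^sub>i\<^sub>-\<^sub>1\<close> and \<open>y + P\<^sub>j\<^sub>-\<^sub>1\<close> to
  \<open>f x y + P\<^sub>i\<^sub>+\<^sub>j\<^sub>-\<^sub>1\<close>; the component in degree \<open>n\<close> of the result is the sum in \<open>P\<^sub>n / P\<^sub>n\<^sub>-\<^sub>1\<close> of
  the contributions of all pairs \<open>(i, n - i)\<close>.
\<close>

definition gr_op ::
  "('k, 'a) nc_poisson \<Rightarrow> ('a \<Rightarrow> int extended) \<Rightarrow> ('a \<Rightarrow> 'a \<Rightarrow> 'a) \<Rightarrow>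
   (int \<Rightarrow> 'a set) \<Rightarrow> (int \<Rightarrow> 'a set) \<Rightarrow> int \<Rightarrow> 'a set" where
  "gr_op P u f X Y = (\<lambda>n.
     finprod (gr_piece P u n)
       (\<lambda>i. \<Union>x\<in>X i. \<Union>y\<in>Y (n - i). filt P u (n - 1) +>\<^bsub>P\<^esub> f x y)
       {i. X i \<noteq> filt P u (i - 1) \<and> Y (n - i) \<noteq> filt P u (n - i - 1)})"

definition gr :: "('k, 'a) nc_poisson \<Rightarrow> ('a \<Rightarrow> int extended) \<Rightarrow> ('k, int \<Rightarrow> 'a set) nc_poisson" where
  "gr P u = \<lparr>
     carrier = {X. (\<forall>i. X i \<in> carrier (gr_piece P u i)) \<and> finite {i. X i \<noteq> filt P u (i - 1)}},
     monoid.mult = gr_op P u (\<otimes>\<^bsub>P\<^esub>),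
     one = (\<lambda>i. if i = 0 then filt P u (- 1) +>\<^bsub>P\<^esub> \<one>\<^bsub>P\<^esub> else filt P u (i - 1)),
     zero = (\<lambda>i. filt P u (i - 1)),
     add = (\<lambda>X Y i. X i <+>\<^bsub>P\<^esub> Y i),
     module.smult = (\<lambda>c X i. \<Union>x\<in>X i. filt P u (i - 1) +>\<^bsub>P\<^esub> (c \<odot>\<^bsub>P\<^esub> x)),
     pbracket = gr_op P u (\<lambda>x y. \<lbrace>x, y\<rbrace>\<^bsub>P\<^esub>)\<rparr>"

section \<open>Tensor products\<close>

text \<open>
  \<open>P1 \<otimes> P2\<close> is the free vector space on the set \<open>carrier P1 \<times> carrier P2\<close>, that is, the
  finitely supported functions \<open>'a \<times> 'b \<Rightarrow>\<^sub>0 'k\<close> with support in that set, modulo the subspace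
  spanned by the bilinearity relators. Elements of the quotient are cosets; operations on
  it are given by the usual union over representatives.
\<close>

definition free_smult :: "'k::field \<Rightarrow> ('x \<Rightarrow>\<^sub>0 'k) \<Rightarrow> ('x \<Rightarrow>\<^sub>0 'k)" where
  "free_smult c x = Poly_Mapping.map ((*) c) x"

lemma lookup_free_smult:
  "Poly_Mapping.lookup (free_smult c x) k = c * Poly_Mapping.lookup x k"
  unfolding free_smult_def by transfer (auto simp: when_def)

interpretation free_vs: vector_space free_smult
  by unfold_locales
    (auto intro!: poly_mapping_eqI simp: lookup_free_smult lookup_add algebra_simps)

definition free_space :: "('k::field, 'a) nc_poisson \<Rightarrow> ('k, 'b) nc_poisson \<Rightarrow> ('a \<times> 'b \<Rightarrow>\<^sub>0 'k) set" where
  "free_space P1 P2 = {x. Poly_Mapping.keys x \<subseteq> carrier P1 \<times> carrier P2}"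

abbreviation gen :: "'a \<Rightarrow> 'b \<Rightarrow> ('a \<times> 'b \<Rightarrow>\<^sub>0 'k::field)" where
  "gen a b \<equiv> Poly_Mapping.single (a, b) 1"

definition tensor_relators ::
  "('k::field, 'a) nc_poisson \<Rightarrow> ('k, 'b) nc_poisson \<Rightarrow> ('a \<times> 'b \<Rightarrow>\<^sub>0 'k) set" where
  "tensor_relators P1 P2 =
     {gen (a \<oplus>\<^bsub>P1\<^esub> a') b - gen a b - gen a' b | a a' b.
        a \<in> carrier P1 \<and> a' \<in> carrier P1 \<and> b \<in> carrier P2} \<union>
     {gen a (b \<oplus>\<^bsub>P2\<^esub> b') - gen a b - gen a b' | a b b'.
        a \<in> carrier P1 \<and> b \<in> carrier P2 \<and> b' \<in> carrier P2} \<union>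
     {gen (c \<odot>\<^bsub>P1\<^esub> a) b - free_smult c (gen a b) | c a b.
        a \<in> carrier P1 \<and> b \<in> carrier P2} \<union>
     {gen a (c \<odot>\<^bsub>P2\<^esub> b) - free_smult c (gen a b) | c a b.
        a \<in> carrier P1 \<and> b \<in> carrier P2}"

definition tensor_class ::
  "('k::field, 'a) nc_poisson \<Rightarrow> ('k, 'b) nc_poisson \<Rightarrow> ('a \<times> 'b \<Rightarrow>\<^sub>0 'k) \<Rightarrow> ('a \<times> 'b \<Rightarrow>\<^sub>0 'k) set" where
  "tensor_class P1 P2 x = {y. y - x \<in> free_vs.span (tensor_relators P1 P2)}"

definition pure_tensor ::
  "('k::field, 'a) nc_poisson \<Rightarrow> ('k, 'b) nc_poisson \<Rightarrow> 'a \<Rightarrow> 'b \<Rightarrow> ('a \<times> 'b \<Rightarrow>\<^sub>0 'k) set" where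
  "pure_tensor P1 P2 a b = tensor_class P1 P2 (gen a b)"

text \<open>The bilinear extension to the free vector space of a map given on the generators.\<close>

definition bilinear_ext ::
  "('x \<Rightarrow> 'x \<Rightarrow> ('x \<Rightarrow>\<^sub>0 'k::field)) \<Rightarrow> ('x \<Rightarrow>\<^sub>0 'k) \<Rightarrow> ('x \<Rightarrow>\<^sub>0 'k) \<Rightarrow> ('x \<Rightarrow>\<^sub>0 'k)" where
  "bilinear_ext f x y =
     (\<Sum>p\<in>Poly_Mapping.keys x. \<Sum>q\<in>Poly_Mapping.keys y.
        free_smult (Poly_Mapping.lookup x p * Poly_Mapping.lookup y q) (f p q))"

definition free_mult ::
  "('k::field, 'a) nc_poisson \<Rightarrow> ('k, 'b) nc_poisson \<Rightarrow>
   ('a \<times> 'b \<Rightarrow>\<^sub>0 'k) \<Rightarrow> ('a \<times> 'b \<Rightarrow>\<^sub>0 'k) \<Rightarrow> ('a \<times> 'b \<Rightarrow>\<^sub>0 'k)" where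
  "free_mult P1 P2 =
     bilinear_ext (\<lambda>(a1, a2) (b1, b2). gen (a1 \<otimes>\<^bsub>P1\<^esub> b1) (a2 \<otimes>\<^bsub>P2\<^esub> b2))"

definition free_bracket ::
  "('k::field, 'a) nc_poisson \<Rightarrow> ('k, 'b) nc_poisson \<Rightarrow>
   ('a \<times> 'b \<Rightarrow>\<^sub>0 'k) \<Rightarrow> ('a \<times> 'b \<Rightarrow>\<^sub>0 'k) \<Rightarrow> ('a \<times> 'b \<Rightarrow>\<^sub>0 'k)" where
  "free_bracket P1 P2 =
     (if class_1 P1 \<and> class_1 P2 then
        bilinear_ext (\<lambda>(a1, a2) (b1, b2).
          gen \<lbrace>a1, b1\<rbrace>\<^bsub>P1\<^esub> (a2 \<otimes>\<^bsub>P2\<^esub> b2) + gen (b1 \<otimes>\<^bsub>P1\<^esub> a1) \<lbrace>a2, b2\<rbrace>\<^bsub>P2\<^esub>)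
      else (\<lambda>x y. free_mult P1 P2 x y - free_mult P1 P2 y x))"

definition poisson_tensor ::
  "('k::field, 'a) nc_poisson \<Rightarrow> ('k, 'b) nc_poisson \<Rightarrow> ('k, ('a \<times> 'b \<Rightarrow>\<^sub>0 'k) set) nc_poisson" where
  "poisson_tensor P1 P2 = \<lparr>
     carrier = tensor_class P1 P2 ` free_space P1 P2,
     monoid.mult = (\<lambda>X Y. \<Union>x\<in>X. \<Union>y\<in>Y. tensor_class P1 P2 (free_mult P1 P2 x y)),
     one = pure_tensor P1 P2 \<one>\<^bsub>P1\<^esub> \<one>\<^bsub>P2\<^esub>,
     zero = tensor_class P1 P2 0,
     add = (\<lambda>X Y. \<Union>x\<in>X. \<Union>y\<in>Y. tensor_class P1 P2 (x + y)),
     module.smult = (\<lambda>c X. \<Union>x\<in>X. tensor_class P1 P2 (free_smult c x)),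
     pbracket = (\<lambda>X Y. \<Union>x\<in>X. \<Union>y\<in>Y. tensor_class P1 P2 (free_bracket P1 P2 x y))\<rparr>"

text \<open>The subspace \<open>A \<otimes> B\<close> of \<open>P1 \<otimes> P2\<close> for subspaces \<open>A\<close> of \<open>P1\<close> and \<open>B\<close> of \<open>P2\<close>.\<close>

definition tensor_subspace ::
  "('k::field, 'a) nc_poisson \<Rightarrow> ('k, 'b) nc_poisson \<Rightarrow> 'a set \<Rightarrow> 'b set \<Rightarrow> ('a \<times> 'b \<Rightarrow>\<^sub>0 'k) set set" where
  "tensor_subspace P1 P2 A B =
     lin_span (poisson_tensor P1 P2) {pure_tensor P1 P2 a b | a b. a \<in> A \<and> b \<in> B}"

section \<open>Types of elements\<close>

definition ad :: "('k, 'a) nc_poisson \<Rightarrow> 'a \<Rightarrow> 'a \<Rightarrow> 'a" where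
  "ad P z w = \<lbrace>z, w\<rbrace>\<^bsub>P\<^esub>"

definition Ev :: "('k, 'a) nc_poisson \<Rightarrow> 'a \<Rightarrow> 'k set" where
  "Ev P z = {c. \<exists>x \<in> carrier P - {\<zero>\<^bsub>P\<^esub>}. ad P z x = c \<odot>\<^bsub>P\<^esub> x}"

text \<open>\<open>K[ad z](x)\<close>: the values at \<open>x\<close> of all polynomials in \<open>ad z\<close>.\<close>

definition K_ad :: "('k::field, 'a) nc_poisson \<Rightarrow> 'a \<Rightarrow> 'a \<Rightarrow> 'a set" where
  "K_ad P z x =
     {finsum P (\<lambda>i. coeff p i \<odot>\<^bsub>P\<^esub> (ad P z ^^ i) x) {..degree p} | p :: 'k poly. True}"

definition F_set :: "('k::field, 'a) nc_poisson \<Rightarrow> 'a \<Rightarrow> 'a set" where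
  "F_set P z = {x \<in> carrier P. fin_dim P (K_ad P z x)}"

definition N_set :: "('k, 'a) nc_poisson \<Rightarrow> 'a \<Rightarrow> 'a set" where
  "N_set P z = {x \<in> carrier P. \<exists>m. (ad P z ^^ m) x = \<zero>\<^bsub>P\<^esub>}"

definition C_set :: "('k, 'a) nc_poisson \<Rightarrow> 'a \<Rightarrow> 'a set" where
  "C_set P z = {x \<in> carrier P. ad P z x = \<zero>\<^bsub>P\<^esub>}"

definition Omega0' :: "('k::field, 'a) nc_poisson \<Rightarrow> 'a set" where
  "Omega0' P = {z \<in> carrier P. Ev P z = {0} \<and> C_set P z = F_set P z \<and> F_set P z \<subset> carrier P}"

definition strictly_nilpotent :: "('k::field, 'a) nc_poisson \<Rightarrow> 'a set" where
  "strictly_nilpotent P =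
     {z \<in> carrier P. Ev P z = {0} \<and> C_set P z \<subset> N_set P z \<and> N_set P z = carrier P}"

definition weakly_nilpotent :: "('k::field, 'a) nc_poisson \<Rightarrow> 'a set" where
  "weakly_nilpotent P =
     {z \<in> carrier P. Ev P z = {0} \<and> C_set P z \<subset> N_set P z \<and> N_set P z \<subset> carrier P}"

definition nilpotent_elements :: "('k::field, 'a) nc_poisson \<Rightarrow> 'a set" where
  "nilpotent_elements P = strictly_nilpotent P \<union> weakly_nilpotent P"

end

theory Submission
  imports Defs
begin

text \<open>
  In both classes \<open>ad \<Theta> = D\<^sub>1 \<otimes> L\<^sub>2 + R\<^sub>1 \<otimes> D\<^sub>2\<close>, where \<open>D\<^sub>i = ad z\<^sub>i\<close>, \<open>R\<^sub>1\<close> is right multiplication by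
  \<open>z\<^sub>1\<close> and \<open>L\<^sub>2\<close> is left multiplication by \<open>z\<^sub>2\<close>; all these operators commute. As \<open>K\<close> is algebraically closed
  and the filtrations are finite, elements of degree \<open>0\<close> are scalars, so \<open>z\<^sub>i\<close> has positive degree and
  the images of high powers of \<open>R\<^sub>1\<close> and \<open>L\<^sub>2\<close> meet each filtration step trivially. If \<open>(ad \<Theta>) U = U\<close>
  for a finite-dimensional \<open>U\<close>, then \<open>U\<close> lies in every \<open>\<Sum> R\<^sub>1\<^sup>i P\<^sub>1 \<otimes> L\<^sub>2\<^sup>j P\<^sub>2\<close> with \<open>i + j = n\<close>, whence
  \<open>U = 0\<close>: so \<open>Ev(\<Theta>) = {0}\<close> and \<open>F(\<Theta>) = N(\<Theta>)\<close>. If \<open>(ad \<Theta>)\<^sup>n x = 0\<close>, the subspace \<open>A\<close> of \<open>P\<^sub>1\<close> spanned by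
  the left factors of \<open>x\<close> satisfies \<open>D\<^sub>1\<^sup>n A \<subseteq> R\<^sub>1 H\<close> with \<open>H = \<Sum> D\<^sub>1\<^sup>i R\<^sub>1\<^sup>j A\<close>, \<open>i + j = n - 1\<close>, hence
  \<open>D\<^sub>1 H \<subseteq> R\<^sub>1 H\<close>. The vanishing of the bracket of \<open>gr P\<^sub>1\<close> makes \<open>D\<^sub>1\<close> raise degrees by less than \<open>R\<^sub>1\<close>
  does, so \<open>D\<^sub>1\<close> acts locally nilpotently on \<open>H\<close>, and \<open>A \<subseteq> N(z\<^sub>1)\<close>. Symmetrically for \<open>P\<^sub>2\<close>, so that
  \<open>N(\<Theta>) = N(z\<^sub>1) \<otimes> N(z\<^sub>2)\<close>.
\<close>

section \<open>Linear functionals on modules over a field\<close>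

text \<open>No bases are chosen. Equality of tensors is tested by the scalars
  \<open>pairing \<phi> \<psi> l\<close>, on which \<open>ad \<Theta>\<close> acts by composing
  \<phi> and \<psi> with the commuting operators, so that arguments about tensors become inductions
  over functionals. The span of the left factors of x depends on the representation unless that is a
  shortest one; its intrinsic form is the set of contractions (id \<otimes> \<psi>)(x), computed by
  \<open>slice\<close>. A finite-dimensional U with (ad \<Theta>) U = U is likewise replaced by one
  relation x = \<Sum> e_s (ad \<Theta>)^(s+1) x.

  Multiplications by z enter only through linearity, commutation with ad z and the exact rise of the
  degree by that of z. These hold on either side, so the two factors can be exchanged although the
  formula for \<open>ad \<Theta>\<close> treats them differently.

  The vanishing bracket on gr P improves the degree bound of {x, y} by one. That one is decisive: D
  x = R s then puts s strictly below x.\<close>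

lemma scalars_simps [simp]:
  "carrier scalars = UNIV" "a \<otimes>\<^bsub>scalars\<^esub> b = a * b" "\<one>\<^bsub>scalars\<^esub> = 1"
  "\<zero>\<^bsub>scalars\<^esub> = 0" "a \<oplus>\<^bsub>scalars\<^esub> b = a + b"
  by (simp_all add: scalars_def)

lemma cring_scalars: "cring (scalars :: 'k::field ring)"
proof (rule cringI)
  show "abelian_group (scalars :: 'k ring)"
    by (rule abelian_groupI) (auto simp: add.assoc add.commute intro: exI[of _ "- x" for x])
  show "comm_monoid (scalars :: 'k ring)"
    by unfold_locales (auto simp: mult.assoc mult.commute)
qed (auto simp: distrib_right)

lemma minus_scalars [simp]: "\<ominus>\<^bsub>scalars\<^esub> a = - a" for a :: "'k::field"
proof -
  interpret cring "scalars :: 'k ring" by (rule cring_scalars)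
  show ?thesis using minus_equality[of "- a" a] by simp
qed

text \<open>The underlying vector space alone. This treats \<open>P1\<close>, \<open>P2\<close> and
  their tensor product uniformly, the latter through its vector space axioms only.\<close>

locale scalar_module = Module.module scalars M for M :: "('k::field, 'a, 'm) module_scheme" (structure)

text \<open>Values outside the carrier are unconstrained, so functionals are compared on the carrier
  only.\<close>

definition dual_space :: "('k::field, 'a, 'm) module_scheme \<Rightarrow> ('a \<Rightarrow> 'k) set" where
  "dual_space M = {\<phi>. (\<forall>x\<in>carrier M. \<forall>y\<in>carrier M. \<phi> (x \<oplus>\<^bsub>M\<^esub> y) = \<phi> x + \<phi> y) \<and>
     (\<forall>c. \<forall>x\<in>carrier M. \<phi> (c \<odot>\<^bsub>M\<^esub> x) = c * \<phi> x)}"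

lemma dual_add:
  "\<phi> \<in> dual_space M \<Longrightarrow> x \<in> carrier M \<Longrightarrow> y \<in> carrier M \<Longrightarrow> \<phi> (x \<oplus>\<^bsub>M\<^esub> y) = \<phi> x + \<phi> y"
  and dual_smult: "\<phi> \<in> dual_space M \<Longrightarrow> x \<in> carrier M \<Longrightarrow> \<phi> (c \<odot>\<^bsub>M\<^esub> x) = c * \<phi> x"
  by (auto simp: dual_space_def)

definition linear_op :: "('k::field, 'a, 'm) module_scheme \<Rightarrow> ('a \<Rightarrow> 'a) \<Rightarrow> bool" where
  "linear_op M f \<longleftrightarrow> (\<forall>x\<in>carrier M. f x \<in> carrier M) \<and>
     (\<forall>x\<in>carrier M. \<forall>y\<in>carrier M. f (x \<oplus>\<^bsub>M\<^esub> y) = f x \<oplus>\<^bsub>M\<^esub> f y) \<and>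
     (\<forall>c. \<forall>x\<in>carrier M. f (c \<odot>\<^bsub>M\<^esub> x) = c \<odot>\<^bsub>M\<^esub> f x)"

lemma linear_op_closed: "linear_op M f \<Longrightarrow> x \<in> carrier M \<Longrightarrow> f x \<in> carrier M"
  and linear_op_add: "linear_op M f \<Longrightarrow> x \<in> carrier M \<Longrightarrow> y \<in> carrier M \<Longrightarrow>
    f (x \<oplus>\<^bsub>M\<^esub> y) = f x \<oplus>\<^bsub>M\<^esub> f y"
  and linear_op_smult: "linear_op M f \<Longrightarrow> x \<in> carrier M \<Longrightarrow> f (c \<odot>\<^bsub>M\<^esub> x) = c \<odot>\<^bsub>M\<^esub> f x"
  by (auto simp: linear_op_def)

lemma linear_op_funpow: "linear_op M f \<Longrightarrow> linear_op M (f ^^ n)"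
  by (induction n) (auto simp: linear_op_def)

lemma dual_comp: "\<phi> \<in> dual_space M \<Longrightarrow> linear_op M f \<Longrightarrow> \<phi> \<circ> f \<in> dual_space M"
  by (auto simp: dual_space_def linear_op_def)

text \<open>Finite lists \<open>[(a\<^sub>1, b\<^sub>1), \<dots>]\<close> represent the tensors \<open>a\<^sub>1 \<otimes> b\<^sub>1 + \<dots>\<close>.\<close>

definition pairing :: "('a \<Rightarrow> 'k::field) \<Rightarrow> ('b \<Rightarrow> 'k) \<Rightarrow> ('a \<times> 'b) list \<Rightarrow> 'k" where
  "pairing \<phi> \<psi> l = (\<Sum>(a, b)\<leftarrow>l. \<phi> a * \<psi> b)"

lemma pairing_simps [simp]:
  "pairing \<phi> \<psi> [] = 0"
  "pairing \<phi> \<psi> ((a, b) # l) = \<phi> a * \<psi> b + pairing \<phi> \<psi> l"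
  "pairing \<phi> \<psi> (l @ l') = pairing \<phi> \<psi> l + pairing \<phi> \<psi> l'"
  by (simp_all add: pairing_def)

lemma pairing_swap [simp]: "pairing \<psi> \<phi> (map prod.swap l) = pairing \<phi> \<psi> l"
  by (induction l) (auto simp: mult.commute)

lemma pairing_map: "pairing \<phi> \<psi> (map (map_prod f g) l) = pairing (\<phi> \<circ> f) (\<psi> \<circ> g) l"
  by (induction l) auto

text \<open>This is the contraction id \<otimes> \<psi> of the tensor represented by the list. As
  \<psi> runs through the dual space, the contractions of x fill the smallest subspace A such that x
  lies in A \<otimes> P2.\<close>

fun slice :: "('k::field, 'a, 'm) module_scheme \<Rightarrow> ('b \<Rightarrow> 'k) \<Rightarrow> ('a \<times> 'b) list \<Rightarrow> 'a" where
  "slice M \<psi> [] = \<zero>\<^bsub>M\<^esub>"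
| "slice M \<psi> ((a, b) # l) = (\<psi> b \<odot>\<^bsub>M\<^esub> a) \<oplus>\<^bsub>M\<^esub> slice M \<psi> l"

context scalar_module
begin

lemma smult_in [simp, intro]: "x \<in> carrier M \<Longrightarrow> c \<odot> x \<in> carrier M"
  by simp

lemma smult_one' [simp]: "x \<in> carrier M \<Longrightarrow> 1 \<odot> x = x"
  using smult_one by simp

lemma smult_zero' [simp]: "x \<in> carrier M \<Longrightarrow> 0 \<odot> x = \<zero>"
  using smult_l_null by simp

lemma smult_zero_right [simp]: "c \<odot> \<zero> = \<zero>"
  using smult_r_null by simp

lemma smult_plus: "x \<in> carrier M \<Longrightarrow> (c + d) \<odot> x = c \<odot> x \<oplus> d \<odot> x"
  using smult_l_distr by simp

lemma smult_add: "x \<in> carrier M \<Longrightarrow> y \<in> carrier M \<Longrightarrow> c \<odot> (x \<oplus> y) = c \<odot> x \<oplus> c \<odot> y"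
  using smult_r_distr by simp

lemma smult_smult: "x \<in> carrier M \<Longrightarrow> c \<odot> (d \<odot> x) = (c * d) \<odot> x"
  using smult_assoc1[of c d x] by simp

lemma smult_uminus: "x \<in> carrier M \<Longrightarrow> (- c) \<odot> x = \<ominus> (c \<odot> x)"
  using smult_l_minus[of c x] by simp

lemma submodule_scalarsI:
  assumes "H \<subseteq> carrier M" "\<zero> \<in> H" "\<And>x y. x \<in> H \<Longrightarrow> y \<in> H \<Longrightarrow> x \<oplus> y \<in> H"
    and "\<And>c x. x \<in> H \<Longrightarrow> c \<odot> x \<in> H"
  shows "submodule H scalars M"
proof (rule submoduleI)
  fix a assume "a \<in> H"
  with assms(1) assms(4)[of a "- 1"] show "\<ominus> a \<in> H" by (auto simp: smult_uminus subset_iff)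
qed (use assms in auto)

lemma submodule_in: "submodule H scalars M \<Longrightarrow> x \<in> H \<Longrightarrow> x \<in> carrier M"
  and submodule_zero: "submodule H scalars M \<Longrightarrow> \<zero> \<in> H"
  and submodule_add: "submodule H scalars M \<Longrightarrow> x \<in> H \<Longrightarrow> y \<in> H \<Longrightarrow> x \<oplus> y \<in> H"
  and submodule_smult: "submodule H scalars M \<Longrightarrow> x \<in> H \<Longrightarrow> c \<odot> x \<in> H"
  and submodule_uminus: "submodule H scalars M \<Longrightarrow> x \<in> H \<Longrightarrow> \<ominus> x \<in> H"
proof -
  assume H: "submodule H scalars M"
  note E = submoduleE[OF H]
  show "x \<in> H \<Longrightarrow> x \<in> carrier M" using E(1) by auto
  show "x \<in> H \<Longrightarrow> y \<in> H \<Longrightarrow> x \<oplus> y \<in> H" using E(5) .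
  show "x \<in> H \<Longrightarrow> c \<odot> x \<in> H" using E(4) by simp
  show "x \<in> H \<Longrightarrow> \<ominus> x \<in> H" using E(3) .
  from E(2) obtain h where h: "h \<in> H" by auto
  with E(1) have "0 \<odot> h = \<zero>" by auto
  with E(4)[of 0 h] h show "\<zero> \<in> H" by simp
qed

lemma submodule_minus: "submodule H scalars M \<Longrightarrow> x \<in> H \<Longrightarrow> y \<in> H \<Longrightarrow> x \<ominus> y \<in> H"
  by (simp add: a_minus_def submodule_add submodule_uminus)

lemma submodule_zero_set: "submodule {\<zero>} scalars M"
  by (rule submodule_scalarsI) auto

lemma submodule_image:
  assumes H: "submodule H scalars M" and f: "linear_op M f"
  shows "submodule (f ` H) scalars M"
proof (rule submodule_scalarsI)
  have [simp]: "x \<in> H \<Longrightarrow> x \<in> carrier M" for x using H by (rule submodule_in)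
  show "f ` H \<subseteq> carrier M" using f by (auto simp: linear_op_closed)
  have "f \<zero> = 0 \<odot> f \<zero>" using linear_op_smult[OF f, of \<zero> 0] by simp
  also have "\<dots> = \<zero>" using f by (simp add: linear_op_closed)
  finally show "\<zero> \<in> f ` H" using submodule_zero[OF H] by force
  show "x \<oplus> y \<in> f ` H" if "x \<in> f ` H" "y \<in> f ` H" for x y
    using that by (auto simp flip: linear_op_add[OF f] simp: submodule_add[OF H])
  show "c \<odot> x \<in> f ` H" if "x \<in> f ` H" for c x
    using that by (auto simp flip: linear_op_smult[OF f] simp: submodule_smult[OF H])
qed

lemma linear_op_zero: "linear_op M f \<Longrightarrow> f \<zero> = \<zero>"
  using linear_op_smult[of M f \<zero> 0] linear_op_closed[of M f \<zero>] by simp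

lemma dual_zero: "\<phi> \<in> dual_space M \<Longrightarrow> \<phi> \<zero> = 0"
  using dual_smult[of \<phi> M \<zero> 0] by simp

lemma dual_minus:
  assumes "\<phi> \<in> dual_space M" "x \<in> carrier M" "y \<in> carrier M"
  shows "\<phi> (x \<ominus> y) = \<phi> x - \<phi> y"
  using assms dual_smult[OF assms(1,3), of "- 1"]
  by (simp add: a_minus_def dual_add smult_uminus)

text \<open>A maximal submodule avoiding \<open>a\<close> is a hyperplane complementary to the line through \<open>a\<close>.\<close>

lemma separating_functional:
  assumes H: "submodule H scalars M" and a: "a \<in> carrier M" "a \<notin> H"
  obtains \<phi> where "\<phi> \<in> dual_space M" "\<And>h. h \<in> H \<Longrightarrow> \<phi> h = 0" "\<phi> a = 1"
proof -
  define S where "S = {N. submodule N scalars M \<and> H \<subseteq> N \<and> a \<notin> N}"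
  have "\<exists>N\<in>S. \<forall>X\<in>S. N \<subseteq> X \<longrightarrow> X = N"
  proof (rule subset_Zorn_nonempty)
    show "S \<noteq> {}" using H a by (auto simp: S_def)
    fix C assume C: "C \<noteq> {}" "subset.chain S C"
    then have CS: "\<And>X. X \<in> C \<Longrightarrow> submodule X scalars M \<and> H \<subseteq> X \<and> a \<notin> X"
      by (auto simp: subset.chain_def S_def)
    have "submodule (\<Union>C) scalars M"
    proof (rule submodule_scalarsI)
      show "\<Union>C \<subseteq> carrier M" using CS submodule_in by blast
      show "\<zero> \<in> \<Union>C" using C(1) CS submodule_zero by blast
      fix x y assume "x \<in> \<Union>C" "y \<in> \<Union>C"
      then obtain X Y where "X \<in> C" "Y \<in> C" "x \<in> X" "y \<in> Y" by auto
      moreover from this C(2) have "X \<subseteq> Y \<or> Y \<subseteq> X" by (auto simp: subset.chain_def)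
      ultimately show "x \<oplus> y \<in> \<Union>C" using CS submodule_add by blast
    next
      show "c \<odot> x \<in> \<Union>C" if "x \<in> \<Union>C" for c x using CS that submodule_smult by blast
    qed
    then show "\<Union>C \<in> S" using CS C(1) by (auto simp: S_def)
  qed
  then obtain N where N: "submodule N scalars M" "H \<subseteq> N" "a \<notin> N"
    and max: "\<And>X. X \<in> S \<Longrightarrow> N \<subseteq> X \<Longrightarrow> X = N" by (auto simp: S_def)
  have [simp]: "x \<in> N \<Longrightarrow> x \<in> carrier M" for x using submodule_in[OF N(1)] .
  \<comment> \<open>Maximality of N enters here: adjoining an x outside N gives a submodule that
    must contain a, and the resulting equation can be solved for x.\<close>
  have ex: "\<exists>c. \<exists>n\<in>N. x = n \<oplus> c \<odot> a" if x: "x \<in> carrier M" for x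
  proof (cases "x \<in> N")
    case True then show ?thesis using a by (intro exI[of _ 0] bexI[of _ x]) auto
  next
    case False
    define N' where "N' = {n \<oplus> c \<odot> x | n c. n \<in> N}"
    have "submodule N' scalars M"
    proof (rule submodule_scalarsI)
      show "N' \<subseteq> carrier M" using x by (auto simp: N'_def)
      show "\<zero> \<in> N'" unfolding N'_def mem_Collect_eq
        using x submodule_zero[OF N(1)] by (intro exI[of _ \<zero>] exI[of _ 0]) auto
      fix u v assume "u \<in> N'" "v \<in> N'"
      then obtain n c m d where "n \<in> N" "m \<in> N" "u = n \<oplus> c \<odot> x" "v = m \<oplus> d \<odot> x"
        by (auto simp: N'_def)
      then show "u \<oplus> v \<in> N'" unfolding N'_def mem_Collect_eq
        using x by (intro exI[of _ "n \<oplus> m"] exI[of _ "c + d"])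
          (auto simp: smult_plus submodule_add[OF N(1)] a_ac)
    next
      fix c u assume "u \<in> N'"
      then obtain n d where "n \<in> N" "u = n \<oplus> d \<odot> x" by (auto simp: N'_def)
      then show "c \<odot> u \<in> N'" unfolding N'_def mem_Collect_eq
        using x by (intro exI[of _ "c \<odot> n"] exI[of _ "c * d"])
          (auto simp: smult_add smult_smult submodule_smult[OF N(1)])
    qed
    moreover have NN': "N \<subseteq> N'"
    proof
      fix n assume "n \<in> N"
      then show "n \<in> N'" unfolding N'_def mem_Collect_eq
        using x by (intro exI[of _ n] exI[of _ 0]) auto
    qed
    moreover have "x \<in> N'" unfolding N'_def mem_Collect_eq
        using x submodule_zero[OF N(1)] by (intro exI[of _ \<zero>] exI[of _ 1]) auto
    ultimately have "a \<in> N'" using max[of N'] N False by (auto simp: S_def)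
    then obtain n c where n: "n \<in> N" "a = n \<oplus> c \<odot> x" by (auto simp: N'_def)
    have "c \<noteq> 0" using n N(3) x by auto
    have "(- inverse c) \<odot> n \<oplus> inverse c \<odot> a
        = (- inverse c) \<odot> n \<oplus> (inverse c \<odot> n \<oplus> x)"
      using n x \<open>c \<noteq> 0\<close> by (simp add: smult_add smult_smult)
    also have "\<dots> = x" using n x by (simp add: a_assoc[symmetric] smult_plus[symmetric])
    finally show ?thesis using submodule_smult[OF N(1) n(1)] by metis
  qed
  have uniq: "c = d" if "n \<in> N" "m \<in> N" "n \<oplus> c \<odot> a = m \<oplus> d \<odot> a" for c d n m
  proof (rule ccontr)
    assume "c \<noteq> d"
    have "(c - d) \<odot> a = c \<odot> a \<oplus> (- d) \<odot> a" using a smult_plus[of a c "- d"] by simp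
    also have "\<dots> = (\<ominus> n \<oplus> (n \<oplus> c \<odot> a)) \<oplus> (- d) \<odot> a"
      using that(1) a by (simp add: r_neg1)
    also have "\<dots> = \<ominus> n \<oplus> (m \<oplus> (d \<odot> a \<oplus> (- d) \<odot> a))"
      using that a by (simp add: a_assoc)
    also have "\<dots> = \<ominus> n \<oplus> m" using that a by (simp add: smult_plus[symmetric])
    finally have "(c - d) \<odot> a \<in> N"
      using that by (simp add: submodule_add[OF N(1)] submodule_uminus[OF N(1)])
    from submodule_smult[OF N(1) this, of "inverse (c - d)"] have "a \<in> N"
      using \<open>c \<noteq> d\<close> a by (simp add: smult_smult)
    with N(3) show False by simp
  qed
  define \<phi> where "\<phi> x = (SOME c. \<exists>n\<in>N. x = n \<oplus> c \<odot> a)" for x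
  have \<phi>_ex: "\<exists>n\<in>N. x = n \<oplus> \<phi> x \<odot> a" if "x \<in> carrier M" for x
    unfolding \<phi>_def by (rule someI_ex[OF ex[OF that]])
  have \<phi>I: "\<phi> x = c" if "n \<in> N" "x = n \<oplus> c \<odot> a" for x n c
    using \<phi>_ex[of x] that a uniq by (metis a_closed smult_in \<open>\<And>x. x \<in> N \<Longrightarrow> x \<in> carrier M\<close>)
  have "\<phi> \<in> dual_space M"
    unfolding dual_space_def
  proof (intro CollectI conjI ballI allI)
    fix x y assume x: "x \<in> carrier M" and y: "y \<in> carrier M"
    from \<phi>_ex[OF x] \<phi>_ex[OF y] obtain n m where nm: "n \<in> N" "x = n \<oplus> \<phi> x \<odot> a" "m \<in> N" "y = m \<oplus> \<phi> y \<odot> a"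
      by auto
    have "x \<oplus> y = (n \<oplus> \<phi> x \<odot> a) \<oplus> (m \<oplus> \<phi> y \<odot> a)" using nm by simp
    also have "\<dots> = (n \<oplus> m) \<oplus> (\<phi> x + \<phi> y) \<odot> a"
      using nm(1,3) a by (simp add: smult_plus a_ac)
    finally show "\<phi> (x \<oplus> y) = \<phi> x + \<phi> y"
      using nm by (intro \<phi>I[of "n \<oplus> m"]) (auto simp: submodule_add[OF N(1)])
  next
    fix c x assume x: "x \<in> carrier M"
    from \<phi>_ex[OF x] obtain n where nm: "n \<in> N" "x = n \<oplus> \<phi> x \<odot> a" by auto
    have "c \<odot> x = c \<odot> (n \<oplus> \<phi> x \<odot> a)" using nm by simp
    also have "\<dots> = c \<odot> n \<oplus> (c * \<phi> x) \<odot> a"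
      using nm(1) a by (simp add: smult_add smult_smult)
    finally show "\<phi> (c \<odot> x) = c * \<phi> x"
      using nm by (intro \<phi>I[of "c \<odot> n"]) (auto simp: submodule_smult[OF N(1)])
  qed
  moreover have "\<phi> h = 0" if "h \<in> H" for h
    using that N(2) a by (intro \<phi>I[of h]) auto
  moreover have "\<phi> a = 1"
    using a submodule_zero[OF N(1)] by (intro \<phi>I[of \<zero>]) auto
  ultimately show thesis using that by blast
qed

lemma dual_separates:
  assumes "x \<in> carrier M" "\<And>\<phi>. \<phi> \<in> dual_space M \<Longrightarrow> \<phi> x = 0"
  shows "x = \<zero>"
  using separating_functional[OF submodule_zero_set, of x] assms
  by (metis singletonD zero_neq_one)

lemma eq_if_minus_zero:
  "x \<in> carrier M \<Longrightarrow> y \<in> carrier M \<Longrightarrow> x \<ominus> y = \<zero> \<Longrightarrow> x = y"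
  by (metis a_minus_def a_inv_closed minus_equality minus_minus)

lemma dual_separates_eq:
  assumes "x \<in> carrier M" "y \<in> carrier M" "\<And>\<phi>. \<phi> \<in> dual_space M \<Longrightarrow> \<phi> x = \<phi> y"
  shows "x = y"
proof -
  have "x \<ominus> y = \<zero>" using assms by (intro dual_separates) (auto simp: dual_minus)
  then show ?thesis by (rule eq_if_minus_zero[OF assms(1,2)])
qed

lemma slice_in:
  "submodule H scalars M \<Longrightarrow> fst ` set l \<subseteq> H \<Longrightarrow> slice M \<psi> l \<in> H"
  by (induction l) (auto simp: submodule_zero submodule_add submodule_smult)

lemma slice_closed: "fst ` set l \<subseteq> carrier M \<Longrightarrow> slice M \<psi> l \<in> carrier M"
  using slice_in carrier_is_submodule by blast

text \<open>The characterising property of a contraction: since functionals separate points, these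
  scalars determine it.\<close>

lemma dual_slice:
  "\<phi> \<in> dual_space M \<Longrightarrow> fst ` set l \<subseteq> carrier M \<Longrightarrow> \<phi> (slice M \<psi> l) = pairing \<phi> \<psi> l"
  by (induction l) (auto simp: dual_zero dual_add dual_smult slice_closed mult.commute)

end

section \<open>Operators raising a filtration\<close>

context scalar_module
begin

lemma pairing_cong_zero:
  "\<lbrakk>set l \<subseteq> carrier M \<times> B; \<And>x. x \<in> carrier M \<Longrightarrow> \<phi> x = 0\<rbrakk> \<Longrightarrow> pairing \<phi> \<psi> l = 0"
  by (induction l) auto

text \<open>The contraction depends linearly on \<psi>, so its values form a subspace. Each identity
  is verified by applying an arbitrary \<phi>.\<close>

lemma submodule_slices:
  assumes l: "set l \<subseteq> carrier M \<times> carrier M2"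
  shows "submodule {slice M \<psi> l | \<psi>. \<psi> \<in> dual_space M2} scalars M"
proof -
  have fl: "fst ` set l \<subseteq> carrier M" using l by auto
  note [simp] = slice_closed[OF fl]
  show ?thesis
  proof (rule submodule_scalarsI)
    show "{slice M \<psi> l | \<psi>. \<psi> \<in> dual_space M2} \<subseteq> carrier M" by auto
    have "slice M (\<lambda>_. 0) l = \<zero>"
    proof (rule dual_separates)
      have "pairing \<phi> (\<lambda>_. 0) l = 0" for \<phi> by (induction l) auto
      then show "\<phi> (slice M (\<lambda>_. 0) l) = 0" if "\<phi> \<in> dual_space M" for \<phi>
        using that by (simp add: dual_slice[OF _ fl])
    qed simp
    moreover have "(\<lambda>_. 0) \<in> dual_space M2" by (simp add: dual_space_def)
    ultimately show "\<zero> \<in> {slice M \<psi> l | \<psi>. \<psi> \<in> dual_space M2}" by force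
  next
    fix x y assume "x \<in> {slice M \<psi> l | \<psi>. \<psi> \<in> dual_space M2}" "y \<in> {slice M \<psi> l | \<psi>. \<psi> \<in> dual_space M2}"
    then obtain \<psi> \<psi>' where p: "\<psi> \<in> dual_space M2" "\<psi>' \<in> dual_space M2"
      "x = slice M \<psi> l" "y = slice M \<psi>' l" by auto
    have "pairing \<phi> (\<lambda>b. \<psi> b + \<psi>' b) l = pairing \<phi> \<psi> l + pairing \<phi> \<psi>' l" for \<phi>
      by (induction l) (auto simp: algebra_simps)
    then have "x \<oplus> y = slice M (\<lambda>b. \<psi> b + \<psi>' b) l"
      using p by (intro dual_separates_eq) (auto simp: dual_add dual_slice[OF _ fl])
    moreover have "(\<lambda>b. \<psi> b + \<psi>' b) \<in> dual_space M2"
      using p by (auto simp: dual_space_def algebra_simps)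
    ultimately show "x \<oplus> y \<in> {slice M \<psi> l | \<psi>. \<psi> \<in> dual_space M2}" by blast
  next
    fix c x assume "x \<in> {slice M \<psi> l | \<psi>. \<psi> \<in> dual_space M2}"
    then obtain \<psi> where p: "\<psi> \<in> dual_space M2" "x = slice M \<psi> l" by auto
    have "pairing \<phi> (\<lambda>b. c * \<psi> b) l = c * pairing \<phi> \<psi> l" for \<phi>
      by (induction l) (auto simp: algebra_simps)
    then have "c \<odot> x = slice M (\<lambda>b. c * \<psi> b) l"
      using p by (intro dual_separates_eq) (auto simp: dual_smult dual_slice[OF _ fl])
    moreover have "(\<lambda>b. c * \<psi> b) \<in> dual_space M2"
      using p by (auto simp: dual_space_def algebra_simps)
    ultimately show "c \<odot> x \<in> {slice M \<psi> l | \<psi>. \<psi> \<in> dual_space M2}" by blast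
  qed
qed

end

text \<open>\<open>layer M D R A n\<close> is the sum of the \<open>D\<^sup>i R\<^sup>j A\<close> with \<open>i + j = n\<close>.\<close>

primrec layer :: "('k, 'a, 'm) module_scheme \<Rightarrow> ('a \<Rightarrow> 'a) \<Rightarrow> ('a \<Rightarrow> 'a) \<Rightarrow> 'a set \<Rightarrow> nat \<Rightarrow> 'a set" where
  "layer M D R A 0 = A"
| "layer M D R A (Suc n) =
     {D a \<oplus>\<^bsub>M\<^esub> R b | a b. a \<in> layer M D R A n \<and> b \<in> layer M D R A n}"

text \<open>Models D = ad z and R = multiplication by z on either side. \<open>G n\<close> is the
  filtration step P_(n-1); the shift by one makes \<open>G 0\<close> trivial, so that inductions
  over n can start there. \<open>lowering\<close> combines the exact rise of the degree under R with
  the strict bound for D. \<open>escape\<close> says that a high power of R pushes every nonzero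
  value out of a given step.\<close>

locale shift_operators = scalar_module M for M :: "('k::field, 'a, 'm) module_scheme" (structure) +
  fixes G :: "nat \<Rightarrow> 'a set" and D R :: "'a \<Rightarrow> 'a"
  assumes linear_D: "linear_op M D" and linear_R: "linear_op M R"
    and commute: "x \<in> carrier M \<Longrightarrow> D (R x) = R (D x)"
    and submodule_G: "submodule (G n) scalars M"
    and G_0: "G 0 \<subseteq> {\<zero>}" and G_Suc: "G n \<subseteq> G (Suc n)"
    and G_exhaust: "x \<in> carrier M \<Longrightarrow> \<exists>n. x \<in> G n"
    and lowering: "\<lbrakk>x \<in> G (Suc n); s \<in> carrier M; D x = R s\<rbrakk> \<Longrightarrow> s \<in> G n"
    and escape: "\<exists>k. \<forall>s\<in>carrier M. (R ^^ k) s \<in> G n \<longrightarrow> (R ^^ k) s = \<zero>"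
begin

definition nil :: "'a set" where
  "nil = {x \<in> carrier M. \<exists>m. (D ^^ m) x = \<zero>}"

lemma D_closed [simp]: "x \<in> carrier M \<Longrightarrow> D x \<in> carrier M"
  and R_closed [simp]: "x \<in> carrier M \<Longrightarrow> R x \<in> carrier M"
  using linear_D linear_R by (auto simp: linear_op_closed)

lemma D_pow_closed [simp]: "x \<in> carrier M \<Longrightarrow> (D ^^ n) x \<in> carrier M"
  and R_pow_closed [simp]: "x \<in> carrier M \<Longrightarrow> (R ^^ n) x \<in> carrier M"
  by (induction n) auto

lemma D_zero [simp]: "D \<zero> = \<zero>" and R_zero [simp]: "R \<zero> = \<zero>"
  using linear_D linear_R by (auto intro: linear_op_zero)

lemma D_pow_zero [simp]: "(D ^^ n) \<zero> = \<zero>"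
  by (induction n) auto

lemma D_R_pow: "x \<in> carrier M \<Longrightarrow> D ((R ^^ n) x) = (R ^^ n) (D x)"
  by (induction n) (auto simp: commute)

lemma R_D_pow: "x \<in> carrier M \<Longrightarrow> (D ^^ n) (R x) = R ((D ^^ n) x)"
  by (induction n) (auto simp: commute)

lemma D_pow_R_pow: "x \<in> carrier M \<Longrightarrow> (D ^^ m) ((R ^^ n) x) = (R ^^ n) ((D ^^ m) x)"
  by (induction m) (auto simp: D_R_pow)

text \<open>Injectivity of R is the case x = 0 of \<open>lowering\<close>: from D 0 = R s the
  element s falls into \<open>G 0\<close>.\<close>

lemma R_eq_zero: "s \<in> carrier M \<Longrightarrow> R s = \<zero> \<Longrightarrow> s = \<zero>"
  using lowering[of \<zero> 0 s] submodule_zero[OF submodule_G] G_0 by auto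

lemma R_pow_eq_zero: "s \<in> carrier M \<Longrightarrow> (R ^^ n) s = \<zero> \<Longrightarrow> s = \<zero>"
  by (induction n) (auto dest: R_eq_zero[rotated])

lemma G_mono: "m \<le> n \<Longrightarrow> G m \<subseteq> G n"
  using lift_Suc_mono_le[of G] G_Suc by blast

lemma finite_subset_G:
  assumes "finite A" "A \<subseteq> carrier M"
  shows "\<exists>n. A \<subseteq> G n"
  using assms
proof induction
  case (insert a A)
  then obtain n where "A \<subseteq> G n" by auto
  moreover obtain m where "a \<in> G m" using G_exhaust insert.prems by auto
  ultimately have "insert a A \<subseteq> G (max m n)" using G_mono[of m "max m n"] G_mono[of n "max m n"] by auto
  then show ?case ..
qed auto

text \<open>If \<open>D\<close> factors through \<open>R\<close> on \<open>H\<close>, then \<open>D = R \<circ> S\<close> there with \<open>S\<close> lowering the filtration.\<close>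

lemma subset_nil:
  assumes H: "H \<subseteq> carrier M" and ex: "\<And>h. h \<in> H \<Longrightarrow> \<exists>s\<in>H. D h = R s"
  shows "H \<subseteq> nil"
proof -
  have "h \<in> nil" if "h \<in> H" "h \<in> G n" for h n
    using that
  proof (induction n arbitrary: h)
    case 0
    then show ?case using G_0 by (auto simp: nil_def intro: exI[of _ 0])
  next
    case (Suc n)
    from ex[OF Suc.prems(1)] obtain s where s: "s \<in> H" "D h = R s" by auto
    \<comment> \<open>\<open>lowering\<close> places s one filtration step below h, where the
      induction hypothesis applies.\<close>
    then have "s \<in> nil" using Suc H lowering[of h n s] by auto
    then obtain m where m: "(D ^^ m) s = \<zero>" by (auto simp: nil_def)
    have "(D ^^ Suc m) h = (D ^^ m) (D h)" by (simp add: funpow_swap1)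
    also have "\<dots> = R ((D ^^ m) s)" using s H by (auto simp: R_D_pow)
    finally have "(D ^^ Suc m) h = \<zero>" using m by simp
    then show ?case using Suc.prems H unfolding nil_def by blast
  qed
  then show ?thesis using H G_exhaust by blast
qed

context
  fixes A assumes A: "submodule A scalars M"
begin

lemma submodule_layer: "submodule (layer M D R A n) scalars M"
proof (induction n)
  case (Suc n)
  note [simp] = submodule_in[OF Suc]
  show ?case
  proof (rule submodule_scalarsI)
    show "layer M D R A (Suc n) \<subseteq> carrier M" by auto
    show "\<zero> \<in> layer M D R A (Suc n)"
      using submodule_zero[OF Suc] by (auto intro!: exI[of _ \<zero>])
    fix x y assume "x \<in> layer M D R A (Suc n)" "y \<in> layer M D R A (Suc n)"
    then obtain a b c d where *: "a \<in> layer M D R A n" "b \<in> layer M D R A n" "x = D a \<oplus> R b"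
      "c \<in> layer M D R A n" "d \<in> layer M D R A n" "y = D c \<oplus> R d" by auto
    then have "x \<oplus> y = D (a \<oplus> c) \<oplus> R (b \<oplus> d)"
      by (simp add: linear_op_add[OF linear_D] linear_op_add[OF linear_R] a_ac)
    then show "x \<oplus> y \<in> layer M D R A (Suc n)"
      using * submodule_add[OF Suc] by auto
  next
    fix e x assume "x \<in> layer M D R A (Suc n)"
    then obtain a b where *: "a \<in> layer M D R A n" "b \<in> layer M D R A n" "x = D a \<oplus> R b" by auto
    then have "e \<odot> x = D (e \<odot> a) \<oplus> R (e \<odot> b)"
      by (simp add: linear_op_smult[OF linear_D] linear_op_smult[OF linear_R] smult_add)
    then show "e \<odot> x \<in> layer M D R A (Suc n)"
      using * submodule_smult[OF Suc] by auto
  qed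
qed (use A in simp)

lemma layer_in [simp]: "x \<in> layer M D R A n \<Longrightarrow> x \<in> carrier M"
  using submodule_layer by (rule submodule_in)

lemma D_layer: "x \<in> layer M D R A n \<Longrightarrow> D x \<in> layer M D R A (Suc n)"
  using submodule_zero[OF submodule_layer, of n] unfolding layer.simps mem_Collect_eq
  by (intro exI[of _ x] exI[of _ \<zero>]) auto

lemma R_layer: "x \<in> layer M D R A n \<Longrightarrow> R x \<in> layer M D R A (Suc n)"
  using submodule_zero[OF submodule_layer, of n] unfolding layer.simps mem_Collect_eq
  by (intro exI[of _ \<zero>] exI[of _ x]) auto

lemma D_pow_layer: "x \<in> layer M D R A n \<Longrightarrow> (D ^^ m) x \<in> layer M D R A (n + m)"
proof (induction m)
  case (Suc m) then show ?case using D_layer[of "(D ^^ m) x" "n + m"] by simp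
qed simp

lemma R_pow_layer: "x \<in> A \<Longrightarrow> (R ^^ n) x \<in> layer M D R A n"
proof (induction n)
  case (Suc n) then show ?case using R_layer[of "(R ^^ n) x" n] by simp
qed simp

text \<open>Write H for the n-th layer. Applying D to D^i R^j A with i + j = n leaves a factor R if
  j > 0, and the hypothesis supplies one if j = 0; hence D H is contained in R H and
  \<open>subset_nil\<close> gives H \<subseteq> \<open>nil\<close>. Since H contains R^n A, and R^n
  is injective and commutes with D, the same follows for A.\<close>

lemma submodule_subset_nil:
  assumes pow: "\<And>a. a \<in> A \<Longrightarrow> (D ^^ Suc n) a \<in> R ` layer M D R A n"
  shows "A \<subseteq> nil"
proof -
  let ?H = "layer M D R A"
  have H': "submodule (R ` ?H n) scalars M"
    by (rule submodule_image[OF submodule_layer linear_R])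
  \<comment> \<open>Interpolates between the hypothesis (k = 0) and D H \<subseteq> R H (k = n). In
    h = D a + R b the first summand regains the power of D lost by raising k, and the second already
    carries the factor R.\<close>
  have "(D ^^ (Suc n - k)) h \<in> R ` ?H n" if "k \<le> n" "h \<in> ?H k" for k h
    using that
  proof (induction k arbitrary: h)
    case 0 then show ?case using pow[of h] by simp
  next
    case (Suc k)
    then obtain a b where ab: "a \<in> ?H k" "b \<in> ?H k" "h = D a \<oplus> R b" by auto
    define m where "m = n - k"
    have m: "Suc n - Suc k = m" "Suc n - k = Suc m" "n = k + m" using Suc.prems by (auto simp: m_def)
    have "(D ^^ m) h = (D ^^ Suc m) a \<oplus> R ((D ^^ m) b)"
      using ab by (simp add: linear_op_add[OF linear_op_funpow[OF linear_D]] R_D_pow funpow_swap1)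
    moreover have "(D ^^ Suc m) a \<in> R ` ?H n"
      using Suc.IH[of a] Suc.prems ab m by simp
    moreover have "R ((D ^^ m) b) \<in> R ` ?H n"
      using D_pow_layer[OF ab(2), of m] m by simp
    ultimately show ?case using submodule_add[OF H'] m by simp
  qed
  from this[of n] have "\<exists>s\<in>?H n. D h = R s" if "h \<in> ?H n" for h
    using that by auto
  then have sub: "?H n \<subseteq> nil" by (intro subset_nil) auto
  show ?thesis
  proof
    fix a assume a: "a \<in> A"
    then have aM: "a \<in> carrier M" using layer_in[of a 0] by simp
    from sub R_pow_layer[OF a, of n] obtain m where "(D ^^ m) ((R ^^ n) a) = \<zero>"
      by (auto simp: nil_def)
    then have "(D ^^ m) a = \<zero>" using aM R_pow_eq_zero[of "(D ^^ m) a" n] by (simp add: D_pow_R_pow)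
    then show "a \<in> nil" using aM by (auto simp: nil_def)
  qed
qed

end

end

section \<open>The operator \<open>D1 \<otimes> R2 + R1 \<otimes> D2\<close> on lists of pure
  tensors\<close>

locale shift_pair =
  M1: shift_operators M1 G1 D1 R1 + M2: shift_operators M2 G2 D2 R2
  for M1 :: "('k::field, 'a, 'm) module_scheme" and G1 D1 R1
    and M2 :: "('k, 'b, 'n) module_scheme" and G2 D2 R2
begin

text \<open>\<open>step\<close> is the operator \<open>D1 \<otimes> R2 + R1 \<otimes> D2\<close>.\<close>

definition step :: "('a \<times> 'b) list \<Rightarrow> ('a \<times> 'b) list" where
  "step l = map (map_prod D1 R2) l @ map (map_prod R1 D2) l"

lemma step_append_eq: "pairing \<phi> \<psi> (step (l @ l')) = pairing \<phi> \<psi> (step l) + pairing \<phi> \<psi> (step l')"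
  by (simp add: step_def)

text \<open>The transposed operator acting on \<phi> \<otimes> \<psi>. Iterating it requires
  inductions in which both functionals are arbitrary.\<close>

lemma pairing_step:
  "pairing \<phi> \<psi> (step l) = pairing (\<phi> \<circ> D1) (\<psi> \<circ> R2) l + pairing (\<phi> \<circ> R1) (\<psi> \<circ> D2) l"
  by (simp add: step_def pairing_map)

text \<open>Additivity holds only after pairing: the lists themselves differ in the order of their
  entries.\<close>

lemma pairing_step_pow_append:
  "pairing \<phi> \<psi> ((step ^^ n) (l @ l')) = pairing \<phi> \<psi> ((step ^^ n) l) + pairing \<phi> \<psi> ((step ^^ n) l')"
  by (induction n arbitrary: \<phi> \<psi>) (auto simp: pairing_step)

lemma step_closed:
  "set l \<subseteq> carrier M1 \<times> carrier M2 \<Longrightarrow> set (step l) \<subseteq> carrier M1 \<times> carrier M2"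
  by (auto simp: step_def)

lemma step_pow_closed:
  "set l \<subseteq> carrier M1 \<times> carrier M2 \<Longrightarrow> set ((step ^^ n) l) \<subseteq> carrier M1 \<times> carrier M2"
proof (induction n)
  case (Suc n)
  then show ?case using step_closed[of "(step ^^ n) l"] by simp
qed simp

text \<open>The powers of \<open>R2\<close> keep e in the kernel of \<open>D2\<close>, because the
  two commute. Only the summand \<open>D1 \<otimes> R2\<close> therefore acts on a \<otimes>
  e.\<close>

lemma pairing_step_pow_eigen:
  assumes "a \<in> carrier M1" "e \<in> carrier M2" "D2 e = \<zero>\<^bsub>M2\<^esub>" "\<psi> \<in> dual_space M2"
  shows "pairing \<phi> \<psi> ((step ^^ n) [(a, e)]) = \<phi> ((D1 ^^ n) a) * \<psi> ((R2 ^^ n) e)"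
  using assms(4)
proof (induction n arbitrary: \<phi> \<psi>)
  case (Suc n)
  have "\<psi> (D2 ((R2 ^^ n) e)) = 0"
    using assms Suc.prems M2.linear_op_zero[OF linear_op_funpow[OF M2.linear_R]]
    by (simp add: M2.D_R_pow M2.dual_zero)
  then show ?case
    using Suc.IH[OF dual_comp[OF Suc.prems M2.linear_R], of "\<phi> \<circ> D1"]
      Suc.IH[OF dual_comp[OF Suc.prems M2.linear_D], of "\<phi> \<circ> R1"]
    by (simp add: pairing_step comp_def)
qed simp

text \<open>Each term of the binomial expansion contains D1^s and D2^(n-s) with s \<ge> i or n - s
  \<ge> j. The induction replaces this expansion: every application of the operator lowers i or j by
  one.\<close>

lemma pairing_step_pow_nil_single:
  assumes "a \<in> carrier M1" "b \<in> carrier M2" "(D1 ^^ i) a = \<zero>\<^bsub>M1\<^esub>" "(D2 ^^ j) b = \<zero>\<^bsub>M2\<^esub>"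
    and "i + j \<le> n" "\<phi> \<in> dual_space M1" "\<psi> \<in> dual_space M2"
  shows "pairing \<phi> \<psi> ((step ^^ n) [(a, b)]) = 0"
  using assms(1-5)
proof (induction n arbitrary: i j a b)
  case 0
  then show ?case using assms(6) by (simp add: M1.dual_zero)
next
  case (Suc n)
  \<comment> \<open>An entry with a zero factor is not the empty list, so it has to be followed
    separately through the iteration; this settles i = 0, and \<open>zero'\<close> settles j =
    0.\<close>
  have zero: "pairing \<phi> \<psi> ((step ^^ m) [(\<zero>\<^bsub>M1\<^esub>, c)]) = 0" if "c \<in> carrier M2" for m c
    using that
  proof (induction m arbitrary: c)
    case 0 then show ?case using assms(6) by (simp add: M1.dual_zero)
  next
    case (Suc m)
    have "step [(\<zero>\<^bsub>M1\<^esub>, c)] = [(\<zero>\<^bsub>M1\<^esub>, R2 c)] @ [(\<zero>\<^bsub>M1\<^esub>, D2 c)]" by (simp add: step_def)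
    then show ?case using Suc by (simp add: funpow_swap1 pairing_step_pow_append del: append.simps)
  qed
  have zero': "pairing \<phi> \<psi> ((step ^^ m) [(c, \<zero>\<^bsub>M2\<^esub>)]) = 0" if "c \<in> carrier M1" for m c
    using that
  proof (induction m arbitrary: c)
    case 0 then show ?case using assms(7) by (simp add: M2.dual_zero)
  next
    case (Suc m)
    have "step [(c, \<zero>\<^bsub>M2\<^esub>)] = [(D1 c, \<zero>\<^bsub>M2\<^esub>)] @ [(R1 c, \<zero>\<^bsub>M2\<^esub>)]" by (simp add: step_def)
    then show ?case using Suc by (simp add: funpow_swap1 pairing_step_pow_append del: append.simps)
  qed
  show ?case
  proof (cases "i = 0 \<or> j = 0")
    case True
    then show ?thesis using Suc.prems zero[of b "Suc n"] zero'[of a "Suc n"] by auto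
  next
    case False
    then obtain i' j' where ij: "i = Suc i'" "j = Suc j'" by (meson not0_implies_Suc)
    have 1: "step [(a, b)] = [(D1 a, R2 b)] @ [(R1 a, D2 b)]" by (simp add: step_def)
    have z: "R1 \<zero>\<^bsub>M1\<^esub> = \<zero>\<^bsub>M1\<^esub>" "R2 \<zero>\<^bsub>M2\<^esub> = \<zero>\<^bsub>M2\<^esub>" by simp_all
    have "pairing \<phi> \<psi> ((step ^^ n) [(D1 a, R2 b)]) = 0"
      using Suc.prems ij z M2.R_D_pow[of b j] funpow_swap1[of D1 i' a] by (intro Suc.IH[of _ _ i' j]) auto
    moreover have "pairing \<phi> \<psi> ((step ^^ n) [(R1 a, D2 b)]) = 0"
      using Suc.prems ij z M1.R_D_pow[of a i] funpow_swap1[of D2 j' b] by (intro Suc.IH[of _ _ i j']) auto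
    ultimately show ?thesis
      by (simp add: funpow_swap1 1 pairing_step_pow_append del: append.simps)
  qed
qed

text \<open>The bound covers all later exponents too, so that the bounds of finitely many entries
  can be combined.\<close>

lemma pairing_step_pow_nil:
  assumes "set l \<subseteq> M1.nil \<times> M2.nil"
  shows "\<exists>n. \<forall>m\<ge>n. \<forall>\<phi>\<in>dual_space M1. \<forall>\<psi>\<in>dual_space M2. pairing \<phi> \<psi> ((step ^^ m) l) = 0"
  using assms
proof (induction l)
  case Nil
  have "(step ^^ m) [] = []" for m by (induction m) (auto simp: step_def)
  then show ?case by simp
next
  case (Cons p l)
  obtain a b where p: "p = (a, b)" by (cases p)
  from Cons obtain n where n: "\<And>m \<phi> \<psi>. m \<ge> n \<Longrightarrow> \<phi> \<in> dual_space M1 \<Longrightarrow> \<psi> \<in> dual_space M2 \<Longrightarrow>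
    pairing \<phi> \<psi> ((step ^^ m) l) = 0" by auto
  from Cons p obtain i j where ij: "a \<in> carrier M1" "b \<in> carrier M2" "(D1 ^^ i) a = \<zero>\<^bsub>M1\<^esub>" "(D2 ^^ j) b = \<zero>\<^bsub>M2\<^esub>"
    by (auto simp: M1.nil_def M2.nil_def)
  have "pairing \<phi> \<psi> ((step ^^ m) (p # l)) = 0"
    if "m \<ge> n + i + j" "\<phi> \<in> dual_space M1" "\<psi> \<in> dual_space M2" for m \<phi> \<psi>
    using pairing_step_pow_append[of \<phi> \<psi> m "[p]" l] n[of m \<phi> \<psi>]
      pairing_step_pow_nil_single[OF ij, of m \<phi> \<psi>] that p by simp
  then show ?case by blast
qed

text \<open>
  Functionals \<open>\<phi>\<close> vanishing on the image of \<open>R1\<^sup>i\<close> and \<open>\<psi>\<close> vanishing on the image of \<open>R2\<^sup>j\<close> kill \<open>l\<close>, by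
  induction on \<open>i + j\<close>; for large \<open>i\<close> and \<open>j\<close> they separate the elements of a fixed filtration step.
\<close>

lemma relation_imp_zero:
  assumes l: "set l \<subseteq> carrier M1 \<times> carrier M2"
    and rel: "\<And>\<phi> \<psi>. \<lbrakk>\<phi> \<in> dual_space M1; \<psi> \<in> dual_space M2\<rbrakk> \<Longrightarrow>
      pairing \<phi> \<psi> l = (\<Sum>s\<le>N. e s * pairing \<phi> \<psi> ((step ^^ Suc s) l))"
    and \<phi>\<psi>: "\<phi> \<in> dual_space M1" "\<psi> \<in> dual_space M2"
  shows "pairing \<phi> \<psi> l = 0"
proof -
  \<comment> \<open>All exponents n are treated together, because \<open>rel\<close> trades the
    exponent 0 for several positive ones.\<close>
  have *: "pairing \<phi> \<psi> ((step ^^ n) l) = 0"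
    if "\<phi> \<in> dual_space M1" "\<psi> \<in> dual_space M2"
      "\<And>x. x \<in> carrier M1 \<Longrightarrow> \<phi> ((R1 ^^ i) x) = 0" "\<And>x. x \<in> carrier M2 \<Longrightarrow> \<psi> ((R2 ^^ j) x) = 0"
    for \<phi> \<psi> i j n
    using that
  proof (induction "i + j" arbitrary: i j \<phi> \<psi> n rule: less_induct)
    case less
    show ?case
    proof (cases "i = 0 \<or> j = 0")
      case True
      show ?thesis
      proof (cases "i = 0")
        case True
        then show ?thesis using less.prems(3)
          by (intro M1.pairing_cong_zero[OF step_pow_closed[OF l]]) simp
      next
        case False
        then have "set (map prod.swap ((step ^^ n) l)) \<subseteq> carrier M2 \<times> carrier M1"
          using step_pow_closed[OF l, of n] by auto
        then have "pairing \<psi> \<phi> (map prod.swap ((step ^^ n) l)) = 0"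
          by (rule M2.pairing_cong_zero) (use less.prems(4) False True in auto)
        then show ?thesis by simp
      qed
    next
      case False
      then obtain i' j' where ij: "i = Suc i'" "j = Suc j'" by (meson not0_implies_Suc)
      \<comment> \<open>One transposed application leaves a functional composed with
        \<open>D1\<close> or \<open>D2\<close> as good as before, since D and R commute, and
        improves the one composed with R: it kills the image of a smaller power. So i + j drops in
        both summands.\<close>
      have suc: "pairing \<phi> \<psi> ((step ^^ Suc n) l) = 0" for n
      proof -
        have "pairing (\<phi> \<circ> D1) (\<psi> \<circ> R2) ((step ^^ n) l) = 0"
          by (rule less.hyps[of i j'])
            (use less.prems ij M1.linear_D M2.linear_R in \<open>auto simp: dual_comp M1.D_R_pow simp del: funpow.simps, simp_all\<close>)
        moreover have "pairing (\<phi> \<circ> R1) (\<psi> \<circ> D2) ((step ^^ n) l) = 0"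
          by (rule less.hyps[of i' j])
            (use less.prems ij M1.linear_R M2.linear_D in \<open>auto simp: dual_comp M2.D_R_pow simp del: funpow.simps, simp_all\<close>)
        ultimately show ?thesis by (simp add: pairing_step)
      qed
      \<comment> \<open>The exponent 0 offers nothing to transpose; the relation expresses it by
        positive exponents, which vanish by \<open>suc\<close>.\<close>
      have "pairing \<phi> \<psi> l = 0"
        by (subst rel[OF less.prems(1,2)]) (simp only: suc, simp)
      with suc show ?thesis by (cases n) auto
    qed
  qed
  have f: "fst ` set l \<subseteq> carrier M1" "snd ` set l \<subseteq> carrier M2" using l by auto
  \<comment> \<open>The steps \<open>n1\<close> and \<open>n2\<close> contain all factors of l,
    hence all its contractions; \<open>k1\<close> and \<open>k2\<close> are then chosen so that the
    images of these powers meet those steps trivially.\<close>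
  obtain n1 where n1: "fst ` set l \<subseteq> G1 n1" using M1.finite_subset_G[OF _ f(1)] by auto
  obtain n2 where n2: "snd ` set l \<subseteq> G2 n2" using M2.finite_subset_G[OF _ f(2)] by auto
  obtain k1 where k1: "\<And>s. s \<in> carrier M1 \<Longrightarrow> (R1 ^^ k1) s \<in> G1 n1 \<Longrightarrow> (R1 ^^ k1) s = \<zero>\<^bsub>M1\<^esub>"
    using M1.escape by blast
  obtain k2 where k2: "\<And>s. s \<in> carrier M2 \<Longrightarrow> (R2 ^^ k2) s \<in> G2 n2 \<Longrightarrow> (R2 ^^ k2) s = \<zero>\<^bsub>M2\<^esub>"
    using M2.escape by blast
  have sub1: "submodule ((R1 ^^ k1) ` carrier M1) scalars M1"
    by (intro M1.submodule_image M1.carrier_is_submodule linear_op_funpow M1.linear_R)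
  have sub2: "submodule ((R2 ^^ k2) ` carrier M2) scalars M2"
    by (intro M2.submodule_image M2.carrier_is_submodule linear_op_funpow M2.linear_R)
  \<comment> \<open>The condition on \<phi> is removed here, that on \<psi> afterwards in the same
    way. A contraction outside the image of \<open>R1 ^^ k1\<close> would be detected by a
    functional killing that image, against \<open>*\<close>; inside the image it vanishes by the
    choice of \<open>k1\<close>.\<close>
  have vanish: "pairing \<phi> \<psi> l = 0" if \<phi>: "\<phi> \<in> dual_space M1" and \<psi>: "\<psi> \<in> dual_space M2"
    and kill: "\<And>x. x \<in> carrier M2 \<Longrightarrow> \<psi> ((R2 ^^ k2) x) = 0" for \<phi> \<psi>
  proof -
    let ?a = "slice M1 \<psi> l"
    have a: "?a \<in> carrier M1" by (rule M1.slice_closed[OF f(1)])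
    have "?a \<in> (R1 ^^ k1) ` carrier M1"
    proof (rule ccontr)
      assume "?a \<notin> (R1 ^^ k1) ` carrier M1"
      from M1.separating_functional[OF sub1 a this] obtain \<phi>' where
        p: "\<phi>' \<in> dual_space M1" "\<And>h. h \<in> (R1 ^^ k1) ` carrier M1 \<Longrightarrow> \<phi>' h = 0" "\<phi>' ?a = 1"
        by metis
      then show False using *[of \<phi>' \<psi> k1 k2 0] \<psi> kill by (simp add: M1.dual_slice[OF _ f(1)])
    qed
    then have "?a = \<zero>\<^bsub>M1\<^esub>" using k1 M1.slice_in[OF M1.submodule_G n1, of \<psi>] by auto
    then show ?thesis using M1.dual_slice[OF \<phi> f(1), of \<psi>] \<phi> by (simp add: M1.dual_zero)
  qed
  let ?l = "map prod.swap l"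
  have fl: "fst ` set ?l = snd ` set l" by (auto simp: image_image)
  let ?b = "slice M2 \<phi> ?l"
  have b: "?b \<in> carrier M2" using M2.slice_closed fl f(2) by metis
  have db: "\<psi> ?b = pairing \<phi> \<psi> l" if "\<psi> \<in> dual_space M2" for \<psi>
    using M2.dual_slice[OF that, of ?l] fl f(2) by simp
  have "?b \<in> (R2 ^^ k2) ` carrier M2"
  proof (rule ccontr)
    assume "?b \<notin> (R2 ^^ k2) ` carrier M2"
    from M2.separating_functional[OF sub2 b this] obtain \<psi>' where
      p: "\<psi>' \<in> dual_space M2" "\<And>h. h \<in> (R2 ^^ k2) ` carrier M2 \<Longrightarrow> \<psi>' h = 0" "\<psi>' ?b = 1"
      by metis
    then show False using vanish[OF \<phi>\<psi>(1) p(1)] db by auto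
  qed
  moreover have "?b \<in> G2 n2" using M2.slice_in[OF M2.submodule_G] n2 fl by metis
  ultimately have "?b = \<zero>\<^bsub>M2\<^esub>" using k2 by auto
  then show ?thesis using db[OF \<phi>\<psi>(2)] \<phi>\<psi>(2) by (simp add: M2.dual_zero)
qed

text \<open>Operators on the left factor come out of the contraction, those on the right factor are
  absorbed into \<psi>.\<close>

lemma slice_step:
  assumes l: "set l \<subseteq> carrier M1 \<times> carrier M2"
  shows "slice M1 \<psi> (step l) = D1 (slice M1 (\<psi> \<circ> R2) l) \<oplus>\<^bsub>M1\<^esub> R1 (slice M1 (\<psi> \<circ> D2) l)"
proof -
  have f: "fst ` set l \<subseteq> carrier M1" "fst ` set (step l) \<subseteq> carrier M1"
    using l step_closed[OF l] by auto
  note [simp] = M1.slice_closed[OF f(1)] M1.slice_closed[OF f(2)]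
  show ?thesis
  proof (rule M1.dual_separates_eq)
    fix \<phi> assume "\<phi> \<in> dual_space M1"
    then show "\<phi> (slice M1 \<psi> (step l)) = \<phi> (D1 (slice M1 (\<psi> \<circ> R2) l) \<oplus>\<^bsub>M1\<^esub> R1 (slice M1 (\<psi> \<circ> D2) l))"
      using M1.dual_slice[OF dual_comp[OF _ M1.linear_D] f(1)]
        M1.dual_slice[OF dual_comp[OF _ M1.linear_R] f(1)]
      by (simp add: M1.dual_slice[OF _ f(2)] dual_add pairing_step)
  qed auto
qed

text \<open>Let A be the space of left contractions and H its n-th layer. The expansion of the
  vanishing power n + 1 shows that D1^(n+1) sends the contraction by
  \<open>\<psi> \<circ> R2 ^^ Suc n\<close> into R1 H. Injectivity of \<open>R2\<close> extends this
  to all of A, and \<open>submodule_subset_nil\<close> applies.\<close>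

lemma slice_nil:
  assumes l: "set l \<subseteq> carrier M1 \<times> carrier M2"
    and zero: "\<And>\<phi> \<psi>. \<lbrakk>\<phi> \<in> dual_space M1; \<psi> \<in> dual_space M2\<rbrakk> \<Longrightarrow> pairing \<phi> \<psi> ((step ^^ m) l) = 0"
    and \<psi>: "\<psi> \<in> dual_space M2"
  shows "slice M1 \<psi> l \<in> M1.nil"
proof (cases m)
  case 0
  have f: "fst ` set l \<subseteq> carrier M1" using l by auto
  have "slice M1 \<psi> l = \<zero>\<^bsub>M1\<^esub>"
    using zero \<psi> 0 by (intro M1.dual_separates) (auto simp: M1.slice_closed[OF f] M1.dual_slice[OF _ f])
  then show ?thesis by (auto simp: M1.nil_def intro: exI[of _ 0])
next
  case (Suc n)
  define A where "A = {slice M1 \<psi> l | \<psi>. \<psi> \<in> dual_space M2}"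
  have A: "submodule A scalars M1" unfolding A_def by (rule M1.submodule_slices[OF l])
  let ?H = "layer M1 D1 R1 A"
  note subH = M1.submodule_layer[OF A]
  note inH [simp] = M1.layer_in[OF A]
  have slice_layer: "slice M1 \<psi> ((step ^^ k) l) \<in> ?H k" if "\<psi> \<in> dual_space M2" for k \<psi>
    using that
  proof (induction k arbitrary: \<psi>)
    case 0 then show ?case by (auto simp: A_def)
  next
    case (Suc k)
    show ?case
      using Suc.IH[OF dual_comp[OF Suc.prems M2.linear_R]] Suc.IH[OF dual_comp[OF Suc.prems M2.linear_D]]
        slice_step[OF step_pow_closed[OF l, of k], of \<psi>]
      by (simp del: comp_apply add: o_apply[of step]) blast
  qed
  have f: "fst ` set ((step ^^ k) l) \<subseteq> carrier M1" for k using step_pow_closed[OF l, of k] by auto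
  note [simp] = M1.slice_closed[OF f[of 0], simplified]
  \<comment> \<open>Isolates the only term of the binomial expansion that carries no factor
    \<open>R1\<close>.\<close>
  have expand: "\<exists>h\<in>?H k. slice M1 \<psi> ((step ^^ Suc k) l) =
      (D1 ^^ Suc k) (slice M1 (\<psi> \<circ> R2 ^^ Suc k) l) \<oplus>\<^bsub>M1\<^esub> R1 h" if "\<psi> \<in> dual_space M2" for k \<psi>
    using that
  proof (induction k arbitrary: \<psi>)
    case 0
    have "slice M1 (\<psi> \<circ> D2) l \<in> ?H 0"
      using dual_comp[OF 0 M2.linear_D] by (auto simp: A_def)
    then show ?case using slice_step[OF l, of \<psi>] by (auto simp: comp_def)
  next
    case (Suc k)
    from Suc.IH[OF dual_comp[OF Suc.prems M2.linear_R]] obtain h where h: "h \<in> ?H k"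
      "slice M1 (\<psi> \<circ> R2) ((step ^^ Suc k) l) =
        (D1 ^^ Suc k) (slice M1 (\<psi> \<circ> R2 \<circ> R2 ^^ Suc k) l) \<oplus>\<^bsub>M1\<^esub> R1 h" by blast
    define g where "g = slice M1 (\<psi> \<circ> D2) ((step ^^ Suc k) l)"
    have g: "g \<in> ?H (Suc k)" unfolding g_def by (rule slice_layer[OF dual_comp[OF Suc.prems M2.linear_D]])
    have comp: "\<psi> \<circ> R2 \<circ> R2 ^^ Suc k = \<psi> \<circ> R2 ^^ Suc (Suc k)" by (simp add: comp_assoc)
    have "slice M1 \<psi> ((step ^^ Suc (Suc k)) l) =
        D1 (slice M1 (\<psi> \<circ> R2) ((step ^^ Suc k) l)) \<oplus>\<^bsub>M1\<^esub> R1 g"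
      unfolding g_def using slice_step[OF step_pow_closed[OF l, of "Suc k"], of \<psi>] by simp
    also have "\<dots> = D1 ((D1 ^^ Suc k) (slice M1 (\<psi> \<circ> R2 ^^ Suc (Suc k)) l)) \<oplus>\<^bsub>M1\<^esub> R1 (D1 h) \<oplus>\<^bsub>M1\<^esub> R1 g"
      using h g M1.D_pow_closed[of _ "Suc k"]
      by (simp add: linear_op_add[OF M1.linear_D] comp M1.commute inH del: funpow.simps layer.simps)
    also have "\<dots> = (D1 ^^ Suc (Suc k)) (slice M1 (\<psi> \<circ> R2 ^^ Suc (Suc k)) l) \<oplus>\<^bsub>M1\<^esub> R1 (D1 h \<oplus>\<^bsub>M1\<^esub> g)"
      using h g by (simp add: linear_op_add[OF M1.linear_R] M1.a_assoc inH del: layer.simps)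
    finally have "slice M1 \<psi> ((step ^^ Suc (Suc k)) l) =
      (D1 ^^ Suc (Suc k)) (slice M1 (\<psi> \<circ> R2 ^^ Suc (Suc k)) l) \<oplus>\<^bsub>M1\<^esub> R1 (D1 h \<oplus>\<^bsub>M1\<^esub> g)" .
    moreover have "D1 h \<oplus>\<^bsub>M1\<^esub> g \<in> ?H (Suc k)"
      by (rule M1.submodule_add[OF subH M1.D_layer[OF A h(1)] g])
    ultimately show ?case by blast
  qed
  \<comment> \<open>A given \<open>\<psi>0\<close> is not presented in the form
    \<open>\<psi> \<circ> R2 ^^ Suc n\<close>, so the claim is dualised: a \<phi> killing R1 H turns
    l into a contraction b in the second factor. There R2^(n+1) b = 0 can be tested against every
    \<psi>, and b = 0 follows.\<close>
  have "(D1 ^^ Suc n) a \<in> R1 ` ?H n" if "a \<in> A" for a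
  proof (rule ccontr)
    assume not: "(D1 ^^ Suc n) a \<notin> R1 ` ?H n"
    from that obtain \<psi>0 where a: "\<psi>0 \<in> dual_space M2" "a = slice M1 \<psi>0 l" by (auto simp: A_def)
    have "(D1 ^^ Suc n) a \<in> carrier M1" using a M1.D_pow_closed[of a "Suc n"] by simp
    from M1.separating_functional[OF M1.submodule_image[OF subH M1.linear_R] this not]
    obtain \<phi> where \<phi>: "\<phi> \<in> dual_space M1" "\<And>h. h \<in> R1 ` ?H n \<Longrightarrow> \<phi> h = 0" "\<phi> ((D1 ^^ Suc n) a) = 1"
      by metis
    define \<phi>' where "\<phi>' = \<phi> \<circ> D1 ^^ Suc n"
    have \<phi>': "\<phi>' \<in> dual_space M1" unfolding \<phi>'_def by (rule dual_comp[OF \<phi>(1) linear_op_funpow[OF M1.linear_D]])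
    define b where "b = slice M2 \<phi>' (map prod.swap l)"
    have fs: "fst ` set (map prod.swap l) \<subseteq> carrier M2" using l by auto
    have b: "b \<in> carrier M2" unfolding b_def by (rule M2.slice_closed[OF fs])
    have db: "\<psi> b = pairing \<phi>' \<psi> l" if "\<psi> \<in> dual_space M2" for \<psi>
      unfolding b_def using M2.dual_slice[OF that fs] by simp
    have "(R2 ^^ Suc n) b = \<zero>\<^bsub>M2\<^esub>"
    proof (rule M2.dual_separates)
      show "(R2 ^^ Suc n) b \<in> carrier M2" using b M2.R_pow_closed by blast
      fix \<psi> assume \<psi>: "\<psi> \<in> dual_space M2"
      define \<psi>' where "\<psi>' = \<psi> \<circ> R2 ^^ Suc n"
      have \<psi>': "\<psi>' \<in> dual_space M2" unfolding \<psi>'_def by (rule dual_comp[OF \<psi> linear_op_funpow[OF M2.linear_R]])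
      from expand[OF \<psi>] obtain h where h: "h \<in> ?H n" "slice M1 \<psi> ((step ^^ Suc n) l) =
         (D1 ^^ Suc n) (slice M1 \<psi>' l) \<oplus>\<^bsub>M1\<^esub> R1 h" unfolding \<psi>'_def by blast
      have "\<psi> ((R2 ^^ Suc n) b) = pairing \<phi>' \<psi>' l" using db[OF \<psi>'] by (simp add: \<psi>'_def)
      also have "\<dots> = \<phi>' (slice M1 \<psi>' l)" using M1.dual_slice[OF \<phi>', of l \<psi>'] f[of 0] by simp
      also have "\<dots> = \<phi> ((D1 ^^ Suc n) (slice M1 \<psi>' l) \<oplus>\<^bsub>M1\<^esub> R1 h)"
        using \<phi>(1) \<phi>(2)[of "R1 h"] h M1.D_pow_closed[of "slice M1 \<psi>' l" "Suc n"]
        by (simp add: dual_add \<phi>'_def)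
      also have "\<dots> = pairing \<phi> \<psi> ((step ^^ Suc n) l)"
        using M1.dual_slice[OF \<phi>(1) f[of "Suc n"], of \<psi>] h(2) by simp
      also have "\<dots> = 0" using zero[OF \<phi>(1) \<psi>] Suc by simp
      finally show "\<psi> ((R2 ^^ Suc n) b) = 0" .
    qed
    then have "b = \<zero>\<^bsub>M2\<^esub>" using b by (rule M2.R_pow_eq_zero[rotated])
    then have "0 = pairing \<phi>' \<psi>0 l" using db[OF a(1)] a by (simp add: M2.dual_zero)
    also have "\<dots> = \<phi>' (slice M1 \<psi>0 l)" using M1.dual_slice[OF \<phi>', of l \<psi>0] f[of 0] by simp
    also have "\<dots> = 1" using \<phi>(3) a by (simp add: \<phi>'_def)
    finally show False by simp
  qed
  then have "A \<subseteq> M1.nil" by (rule M1.submodule_subset_nil[OF A])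
  then show ?thesis using \<psi> by (auto simp: A_def)
qed

end

section \<open>Tensor products as lists of pure tensors\<close>

text \<open>The scaling is a parameter so that the same extension serves maps into the free space
  and maps into the field.\<close>

definition linear_extension :: "('k::field \<Rightarrow> 'v \<Rightarrow> 'v::ab_group_add) \<Rightarrow> ('x \<Rightarrow> 'v) \<Rightarrow> ('x \<Rightarrow>\<^sub>0 'k) \<Rightarrow> 'v" where
  "linear_extension s f x = (\<Sum>p\<in>Poly_Mapping.keys x. s (Poly_Mapping.lookup x p) (f p))"

context vector_space
begin

lemma linear_extension_superset:
  assumes "finite S" "Poly_Mapping.keys x \<subseteq> S"
  shows "linear_extension scale f x = (\<Sum>p\<in>S. scale (Poly_Mapping.lookup x p) (f p))"
  unfolding linear_extension_def
  by (rule sum.mono_neutral_left) (use assms in \<open>auto simp: in_keys_iff\<close>)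

lemma linear_extension_add:
  "linear_extension scale f (x + y) = linear_extension scale f x + linear_extension scale f y"
proof -
  define S where "S = Poly_Mapping.keys x \<union> Poly_Mapping.keys y"
  have S: "finite S" "Poly_Mapping.keys x \<subseteq> S" "Poly_Mapping.keys y \<subseteq> S" "Poly_Mapping.keys (x + y) \<subseteq> S"
    using Poly_Mapping.keys_add[of x y] by (auto simp: S_def)
  show ?thesis
    by (simp add: linear_extension_superset[OF S(1)] S lookup_add scale_left_distrib sum.distrib)
qed

lemma linear_extension_smult:
  "linear_extension scale f (free_smult c x) = scale c (linear_extension scale f x)"
proof -
  have k: "Poly_Mapping.keys (free_smult c x) \<subseteq> Poly_Mapping.keys x"
    by (auto simp: in_keys_iff lookup_free_smult)
  show ?thesis
    by (subst linear_extension_superset[OF finite_keys k])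
      (simp add: lookup_free_smult scale_sum_right linear_extension_def)
qed

lemma linear_extension_zero [simp]: "linear_extension scale f 0 = 0"
  by (simp add: linear_extension_def)

lemma linear_extension_single [simp]:
  "linear_extension scale f (Poly_Mapping.single p 1) = f p"
  by (simp add: linear_extension_def)

lemma linear_extension_minus:
  "linear_extension scale f (x - y) = linear_extension scale f x - linear_extension scale f y"
  using linear_extension_add[of f "x - y" y] by simp

end

interpretation field_vs: vector_space "(*) :: 'k::field \<Rightarrow> 'k \<Rightarrow> 'k"
  by unfold_locales (simp_all add: algebra_simps)

text \<open>Over the field itself this simplification rule would reassociate products against
  \<open>mult.assoc\<close>.\<close>

lemmas [simp del] = field_vs.scale_scale

lemma bilinear_ext_eq:
  "bilinear_ext f x y = linear_extension free_smult (\<lambda>p. linear_extension free_smult (f p) y) x"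
  by (simp add: bilinear_ext_def linear_extension_def free_vs.scale_sum_right)

lemma bilinear_ext_flip: "bilinear_ext f x y = bilinear_ext (\<lambda>p q. f q p) y x"
  unfolding bilinear_ext_def by (subst sum.swap) (simp add: mult.commute)

lemma bilinear_ext_minus_left: "bilinear_ext f (x - x') y = bilinear_ext f x y - bilinear_ext f x' y"
  by (simp add: bilinear_ext_eq free_vs.linear_extension_minus)

lemma bilinear_ext_minus_right: "bilinear_ext f x (y - y') = bilinear_ext f x y - bilinear_ext f x y'"
  by (simp add: bilinear_ext_flip[of f x] bilinear_ext_minus_left)

lemma poly_mapping_eq_sum_single:
  "x = (\<Sum>p\<in>Poly_Mapping.keys x. free_smult (Poly_Mapping.lookup x p) (Poly_Mapping.single p 1))"
proof (rule poly_mapping_eqI)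
  fix k
  show "Poly_Mapping.lookup x k =
    Poly_Mapping.lookup (\<Sum>p\<in>Poly_Mapping.keys x. free_smult (Poly_Mapping.lookup x p) (Poly_Mapping.single p 1)) k"
    by (simp add: lookup_sum lookup_free_smult lookup_single when_def if_distrib[of "\<lambda>t. _ * t"]
        in_keys_iff cong: if_cong)
qed

text \<open>The span of a list, built along the list so that the coefficient of each entry can be
  peeled off; a hull such as \<open>lin_span\<close> exposes no coefficients.\<close>

primrec combinations :: "('k::field, 'a, 'm) module_scheme \<Rightarrow> 'a list \<Rightarrow> 'a set" where
  "combinations M [] = {\<zero>\<^bsub>M\<^esub>}"
| "combinations M (b # bs) = {(c \<odot>\<^bsub>M\<^esub> b) \<oplus>\<^bsub>M\<^esub> y | c y. y \<in> combinations M bs}"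

context scalar_module
begin

lemma submodule_combinations:
  "set bs \<subseteq> carrier M \<Longrightarrow> submodule (combinations M bs) scalars M"
proof (induction bs)
  case Nil then show ?case by (simp add: submodule_zero_set)
next
  case (Cons b bs)
  then have S: "submodule (combinations M bs) scalars M" and b: "b \<in> carrier M" by auto
  note [simp] = submodule_in[OF S]
  show ?case
  proof (rule submodule_scalarsI)
    show "combinations M (b # bs) \<subseteq> carrier M" using b by auto
    show "\<zero> \<in> combinations M (b # bs)" unfolding combinations.simps mem_Collect_eq
      using b submodule_zero[OF S] by (intro exI[of _ 0] exI[of _ \<zero>]) auto
    fix x y assume "x \<in> combinations M (b # bs)" "y \<in> combinations M (b # bs)"
    then obtain c u d v where "u \<in> combinations M bs" "v \<in> combinations M bs"
      "x = c \<odot> b \<oplus> u" "y = d \<odot> b \<oplus> v" by auto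
    then show "x \<oplus> y \<in> combinations M (b # bs)" unfolding combinations.simps mem_Collect_eq
      using b submodule_add[OF S] by (intro exI[of _ "c + d"] exI[of _ "u \<oplus> v"]) (auto simp: smult_plus a_ac)
  next
    fix e x assume "x \<in> combinations M (b # bs)"
    then obtain c u where "u \<in> combinations M bs" "x = c \<odot> b \<oplus> u" by auto
    then show "e \<odot> x \<in> combinations M (b # bs)" unfolding combinations.simps mem_Collect_eq
      using b submodule_smult[OF S] by (intro exI[of _ "e * c"] exI[of _ "e \<odot> u"]) (auto simp: smult_add smult_smult)
  qed
qed

lemma set_subset_combinations:
  "set bs \<subseteq> carrier M \<Longrightarrow> set bs \<subseteq> combinations M bs"
proof (induction bs)
  case (Cons b bs)
  then have S: "submodule (combinations M bs) scalars M" by (auto intro: submodule_combinations)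
  have "b \<in> combinations M (b # bs)" unfolding combinations.simps mem_Collect_eq
    using Cons.prems submodule_zero[OF S] by (intro exI[of _ 1] exI[of _ \<zero>]) auto
  moreover have "x \<in> combinations M (b # bs)" if "x \<in> set bs" for x
    unfolding combinations.simps mem_Collect_eq
    using Cons that by (intro exI[of _ 0] exI[of _ x]) auto
  ultimately show ?case by auto
qed simp

end

section \<open>Congruence modulo the bilinearity relators and separation by functionals\<close>

locale tensor_pair = P1: scalar_module P1 + P2: scalar_module P2
  for P1 :: "('k::field, 'a) nc_poisson" and P2 :: "('k, 'b) nc_poisson"
begin

abbreviation "pairs \<equiv> carrier P1 \<times> carrier P2"
abbreviation "relspan \<equiv> free_vs.span (tensor_relators P1 P2)"
abbreviation "T \<equiv> poisson_tensor P1 P2"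

definition cg :: "('a \<times> 'b \<Rightarrow>\<^sub>0 'k) \<Rightarrow> ('a \<times> 'b \<Rightarrow>\<^sub>0 'k) \<Rightarrow> bool" where
  "cg x y \<longleftrightarrow> x - y \<in> relspan"

lemma cg_refl [simp]: "cg x x"
  by (simp add: cg_def free_vs.span_zero)

lemma cg_sym: "cg x y \<Longrightarrow> cg y x"
  using free_vs.span_neg[of "x - y"] by (simp add: cg_def)

lemma cg_trans [trans]: "cg x y \<Longrightarrow> cg y z \<Longrightarrow> cg x z"
  using free_vs.span_add[of "x - y" _ "y - z"] by (simp add: cg_def)

lemma cg_add: "cg x y \<Longrightarrow> cg x' y' \<Longrightarrow> cg (x + x') (y + y')"
  using free_vs.span_add[of "x - y" _ "x' - y'"] by (simp add: cg_def algebra_simps)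

lemma cg_diff: "cg x y \<Longrightarrow> cg x' y' \<Longrightarrow> cg (x - x') (y - y')"
  using free_vs.span_diff[of "x - y" _ "x' - y'"] by (simp add: cg_def algebra_simps)

lemma cg_smult: "cg x y \<Longrightarrow> cg (free_smult c x) (free_smult c y)"
  using free_vs.span_scale[of "x - y" _ c] by (simp add: cg_def free_vs.scale_right_diff_distrib)

lemma cg_gen_add_left: "a \<in> carrier P1 \<Longrightarrow> a' \<in> carrier P1 \<Longrightarrow> b \<in> carrier P2 \<Longrightarrow>
    cg (gen (a \<oplus>\<^bsub>P1\<^esub> a') b) (gen a b + gen a' b)"
  unfolding cg_def by (rule free_vs.span_base) (auto simp: tensor_relators_def diff_diff_eq)

lemma cg_gen_add_right: "a \<in> carrier P1 \<Longrightarrow> b \<in> carrier P2 \<Longrightarrow> b' \<in> carrier P2 \<Longrightarrow>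
    cg (gen a (b \<oplus>\<^bsub>P2\<^esub> b')) (gen a b + gen a b')"
  unfolding cg_def by (rule free_vs.span_base) (auto simp: tensor_relators_def diff_diff_eq)

lemma cg_gen_smult_left: "a \<in> carrier P1 \<Longrightarrow> b \<in> carrier P2 \<Longrightarrow>
    cg (gen (c \<odot>\<^bsub>P1\<^esub> a) b) (free_smult c (gen a b))"
  unfolding cg_def by (rule free_vs.span_base) (auto simp: tensor_relators_def)

lemma cg_gen_smult_right: "a \<in> carrier P1 \<Longrightarrow> b \<in> carrier P2 \<Longrightarrow>
    cg (gen a (c \<odot>\<^bsub>P2\<^esub> b)) (free_smult c (gen a b))"
  unfolding cg_def by (rule free_vs.span_base) (auto simp: tensor_relators_def)

lemma cg_gen_zero_left: "b \<in> carrier P2 \<Longrightarrow> cg (gen \<zero>\<^bsub>P1\<^esub> b) 0"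
  using cg_gen_smult_left[of "\<zero>\<^bsub>P1\<^esub>" b 0] by simp

lemma cg_gen_zero_right: "a \<in> carrier P1 \<Longrightarrow> cg (gen a \<zero>\<^bsub>P2\<^esub>) 0"
  using cg_gen_smult_right[of a "\<zero>\<^bsub>P2\<^esub>" 0] by simp

lemma mem_tensor_class: "y \<in> tensor_class P1 P2 x \<longleftrightarrow> cg y x"
  by (simp add: tensor_class_def cg_def)

lemma tensor_class_eq: "tensor_class P1 P2 x = tensor_class P1 P2 y \<longleftrightarrow> cg x y"
  unfolding set_eq_iff mem_tensor_class using cg_sym cg_trans cg_refl by blast

text \<open>Bilinearity is demanded only modulo the relators, which is exactly what lets the linear
  extension map \<open>relspan\<close> into itself and so descend to the tensor product.\<close>

definition balanced :: "('a \<times> 'b \<Rightarrow> ('a \<times> 'b \<Rightarrow>\<^sub>0 'k)) \<Rightarrow> bool" where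
  "balanced F \<longleftrightarrow>
     (\<forall>a\<in>carrier P1. \<forall>a'\<in>carrier P1. \<forall>b\<in>carrier P2. cg (F (a \<oplus>\<^bsub>P1\<^esub> a', b)) (F (a, b) + F (a', b))) \<and>
     (\<forall>a\<in>carrier P1. \<forall>b\<in>carrier P2. \<forall>b'\<in>carrier P2. cg (F (a, b \<oplus>\<^bsub>P2\<^esub> b')) (F (a, b) + F (a, b'))) \<and>
     (\<forall>c. \<forall>a\<in>carrier P1. \<forall>b\<in>carrier P2. cg (F (c \<odot>\<^bsub>P1\<^esub> a, b)) (free_smult c (F (a, b)))) \<and>
     (\<forall>c. \<forall>a\<in>carrier P1. \<forall>b\<in>carrier P2. cg (F (a, c \<odot>\<^bsub>P2\<^esub> b)) (free_smult c (F (a, b))))"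

lemma balanced_gen:
  assumes "linear_op P1 f" "linear_op P2 g"
  shows "balanced (\<lambda>(a, b). gen (f a) (g b))"
  using assms
  by (auto simp: balanced_def linear_op_def cg_gen_add_left cg_gen_add_right cg_gen_smult_left cg_gen_smult_right)

lemma balanced_add:
  assumes F: "balanced F" and G: "balanced G"
  shows "balanced (\<lambda>p. F p + G p)"
proof -
  have *: "cg (x + x') (y + y' + (z + z'))" if "cg x (y + z)" "cg x' (y' + z')" for x x' y y' z z'
    using cg_add[OF that] by (simp add: algebra_simps)
  show ?thesis
    using F G unfolding balanced_def by (simp add: * free_vs.scale_right_distrib cg_add)
qed

lemma balanced_diff:
  assumes F: "balanced F" and G: "balanced G"
  shows "balanced (\<lambda>p. F p - G p)"
proof -
  have *: "cg (x - x') (y - y' + (z - z'))" if "cg x (y + z)" "cg x' (y' + z')" for x x' y y' z z'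
    using cg_diff[OF that] by (simp add: algebra_simps)
  show ?thesis
    using F G unfolding balanced_def by (simp add: * free_vs.scale_right_diff_distrib cg_diff)
qed

lemma linear_extension_relspan:
  assumes F: "balanced F" and r: "r \<in> relspan"
  shows "linear_extension free_smult F r \<in> relspan"
  using r
proof (induction rule: free_vs.span_induct)
  case base
  show ?case
    by (auto simp: free_vs.subspace_def free_vs.linear_extension_add free_vs.linear_extension_smult
        free_vs.span_zero free_vs.span_add free_vs.span_scale)
next
  case (step r)
  then show ?case using F
    by (auto simp: tensor_relators_def balanced_def cg_def free_vs.linear_extension_minus
        free_vs.linear_extension_add free_vs.linear_extension_smult diff_diff_eq)
qed

text \<open>This makes the union over representatives that defines the bracket a single class. The
  difference of the two values splits into terms each having a factor in
  \<open>relspan\<close>.\<close>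

lemma bilinear_ext_cg:
  assumes bal: "\<And>p. p \<in> pairs \<Longrightarrow> balanced (f p)" "\<And>p. p \<in> pairs \<Longrightarrow> balanced (\<lambda>q. f q p)"
    and y: "Poly_Mapping.keys y \<subseteq> pairs" and x: "Poly_Mapping.keys x \<subseteq> pairs"
    and cg: "cg x' x" "cg y' y"
  shows "cg (bilinear_ext f x' y') (bilinear_ext f x y)"
proof -
  have right: "bilinear_ext f x r \<in> relspan"
    if bal: "\<And>p. p \<in> pairs \<Longrightarrow> balanced (f p)" and "Poly_Mapping.keys x \<subseteq> pairs" "r \<in> relspan"
    for f x r
    unfolding bilinear_ext_eq linear_extension_def[of _ _ x]
    by (intro free_vs.span_sum free_vs.span_scale linear_extension_relspan bal) (use that in auto)
  have rel: "bilinear_ext f r q \<in> relspan" if "r \<in> relspan" "Poly_Mapping.keys q \<subseteq> pairs" for r q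
    by (subst bilinear_ext_flip, rule right) (use bal that in auto)
  \<comment> \<open>The map f is balanced only at generators in \<open>pairs\<close>; the relators,
    and hence all differences of congruent elements, are supported there.\<close>
  have keys: "Poly_Mapping.keys r \<subseteq> pairs" if "r \<in> relspan" for r
    using that
  proof (induction rule: free_vs.span_induct)
    case base
    show ?case
    proof (rule free_vs.subspaceI)
      show "x + y \<in> {r. Poly_Mapping.keys r \<subseteq> pairs}"
        if "x \<in> {r. Poly_Mapping.keys r \<subseteq> pairs}" "y \<in> {r. Poly_Mapping.keys r \<subseteq> pairs}" for x y
        using that Poly_Mapping.keys_add[of x y] by auto
      show "free_smult c x \<in> {r. Poly_Mapping.keys r \<subseteq> pairs}"
        if "x \<in> {r. Poly_Mapping.keys r \<subseteq> pairs}" for c x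
        using that by (auto simp: in_keys_iff lookup_free_smult subset_iff)
    qed auto
  next
    case (step r)
    then show ?case
      by (auto simp: tensor_relators_def in_keys_iff lookup_minus lookup_free_smult lookup_single when_def
          split: if_splits)
  qed
  have "bilinear_ext f x' y' - bilinear_ext f x y =
      bilinear_ext f x (y' - y) + (bilinear_ext f (x' - x) y + bilinear_ext f (x' - x) (y' - y))"
    by (simp add: bilinear_ext_minus_left bilinear_ext_minus_right)
  also have "\<dots> \<in> relspan"
    using cg bal x y keys by (intro free_vs.span_add rel right) (auto simp: cg_def)
  finally show ?thesis by (simp add: cg_def)
qed

definition rep :: "('a \<times> 'b) list \<Rightarrow> ('a \<times> 'b \<Rightarrow>\<^sub>0 'k)" where
  "rep l = (\<Sum>(a, b)\<leftarrow>l. gen a b)"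

lemma rep_simps [simp]:
  "rep [] = 0" "rep ((a, b) # l) = gen a b + rep l" "rep (l @ l') = rep l + rep l'"
  by (simp_all add: rep_def)

definition tens :: "('a \<times> 'b) list \<Rightarrow> ('a \<times> 'b \<Rightarrow>\<^sub>0 'k) set" where
  "tens l = tensor_class P1 P2 (rep l)"

lemma tens_eq: "tens l = tens l' \<longleftrightarrow> cg (rep l) (rep l')"
  by (simp add: tens_def tensor_class_eq)

lemma tens_single: "tens [(a, b)] = pure_tensor P1 P2 a b"
  by (simp add: tens_def pure_tensor_def)

lemma keys_rep: "set l \<subseteq> pairs \<Longrightarrow> Poly_Mapping.keys (rep l) \<subseteq> pairs"
proof (induction l)
  case (Cons p l)
  then show ?case using Poly_Mapping.keys_add[of "gen (fst p) (snd p) :: _ \<Rightarrow>\<^sub>0 'k" "rep l"] by (cases p) auto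
qed simp

definition scale_list :: "'k \<Rightarrow> ('a \<times> 'b) list \<Rightarrow> ('a \<times> 'b) list" where
  "scale_list c = map (\<lambda>(a, b). (c \<odot>\<^bsub>P1\<^esub> a, b))"

lemma scale_list_closed: "set l \<subseteq> pairs \<Longrightarrow> set (scale_list c l) \<subseteq> pairs"
  by (auto simp: scale_list_def)

lemma cg_scale_list: "set l \<subseteq> pairs \<Longrightarrow> cg (rep (scale_list c l)) (free_smult c (rep l))"
  by (induction l) (auto simp: scale_list_def free_vs.scale_right_distrib intro!: cg_add cg_gen_smult_left)

text \<open>Coefficients are absorbed into the left factors, so every class is represented by a
  plain list of pairs.\<close>

lemma carrier_T: "carrier T = tens ` {l. set l \<subseteq> pairs}"
proof -
  have "\<exists>l. set l \<subseteq> pairs \<and> cg x (rep l)" if x: "Poly_Mapping.keys x \<subseteq> pairs" for x :: "'a \<times> 'b \<Rightarrow>\<^sub>0 'k"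
  proof -
    have "\<exists>l. set l \<subseteq> pairs \<and>
        cg (\<Sum>p\<in>S. free_smult (Poly_Mapping.lookup x p) (Poly_Mapping.single p 1)) (rep l)"
      if "finite S" "S \<subseteq> pairs" for S
      using that
    proof (induction)
      case (insert p S)
      then obtain l where l: "set l \<subseteq> pairs"
        "cg (\<Sum>p\<in>S. free_smult (Poly_Mapping.lookup x p) (Poly_Mapping.single p 1)) (rep l)" by auto
      obtain a b where p: "p = (a, b)" by (cases p)
      let ?c = "Poly_Mapping.lookup x p"
      from insert p have "cg (free_smult ?c (gen a b)) (gen (?c \<odot>\<^bsub>P1\<^esub> a) b)"
        by (intro cg_sym[OF cg_gen_smult_left]) auto
      then show ?case using l insert p
        by (intro exI[of _ "(?c \<odot>\<^bsub>P1\<^esub> a, b) # l"]) (auto intro: cg_add)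
    qed (auto intro: exI[of _ "[]"])
    from this[OF finite_keys x] show ?thesis by (simp flip: poly_mapping_eq_sum_single)
  qed
  note ex = this
  have T: "carrier T = tensor_class P1 P2 ` {x. Poly_Mapping.keys x \<subseteq> pairs}"
    by (simp add: poisson_tensor_def free_space_def)
  show ?thesis
  proof
    show "carrier T \<subseteq> tens ` {l. set l \<subseteq> pairs}"
      unfolding T using ex by (auto simp: tens_def image_iff tensor_class_eq)
    show "tens ` {l. set l \<subseteq> pairs} \<subseteq> carrier T"
      unfolding T tens_def using keys_rep by blast
  qed
qed

lemma UN_tensor_class:
  "(\<And>x'. cg x' x \<Longrightarrow> h x' = c) \<Longrightarrow> (\<Union>x'\<in>tensor_class P1 P2 x. h x') = c"
  using mem_tensor_class[of _ x] cg_refl[of x] by blast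

lemma add_T: "tens l \<oplus>\<^bsub>T\<^esub> tens l' = tens (l @ l')"
  unfolding poisson_tensor_def tens_def ring.simps module.simps nc_poisson.simps
  by (intro UN_tensor_class) (simp add: tensor_class_eq cg_add)

lemma zero_T: "\<zero>\<^bsub>T\<^esub> = tens []"
  by (simp add: poisson_tensor_def tens_def)

lemma smult_T: "set l \<subseteq> pairs \<Longrightarrow> c \<odot>\<^bsub>T\<^esub> tens l = tens (scale_list c l)"
  unfolding poisson_tensor_def tens_def ring.simps module.simps nc_poisson.simps
  by (intro UN_tensor_class) (auto simp: tensor_class_eq intro: cg_trans[OF cg_smult cg_sym[OF cg_scale_list]])

lemma tens_in [simp]: "set l \<subseteq> pairs \<Longrightarrow> tens l \<in> carrier T"
  by (auto simp: carrier_T)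

lemma linear_extension_pairing:
  "linear_extension (*) (\<lambda>(a, b). \<phi> a * \<psi> b) (rep l) = pairing \<phi> \<psi> l"
  by (induction l) (auto simp: field_vs.linear_extension_add)

text \<open>The form \<phi> \<otimes> \<psi> on the free space kills the relators, so the pairing
  depends only on the tensor.\<close>

lemma cg_pairing:
  assumes "\<phi> \<in> dual_space P1" "\<psi> \<in> dual_space P2" "cg (rep l) (rep l')"
  shows "pairing \<phi> \<psi> l = pairing \<phi> \<psi> l'"
proof -
  let ?F = "linear_extension (*) (\<lambda>(a, b). \<phi> a * \<psi> b)"
  have "?F r = 0" if "r \<in> relspan" for r
    using that
  proof (induction rule: free_vs.span_induct)
    case base
    show ?case
      by (auto simp: free_vs.subspace_def field_vs.linear_extension_add
          field_vs.linear_extension_smult)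
  next
    case (step r)
    then show ?case using assms(1,2)
      by (auto simp: tensor_relators_def field_vs.linear_extension_minus field_vs.linear_extension_smult
          field_vs.linear_extension_add dual_add dual_smult diff_diff_eq distrib_left distrib_right)
  qed
  from this[of "rep l - rep l'"] assms(3) show ?thesis
    by (simp add: cg_def field_vs.linear_extension_minus linear_extension_pairing)
qed

text \<open>From a \<otimes> (c b' + y) + a' \<otimes> b' = (a' + c a) \<otimes> b' + a \<otimes> y
  the entry is distributed over the others one at a time, changing only their left factors.\<close>

lemma redundant_entry:
  assumes "set r \<subseteq> pairs" "a \<in> carrier P1" "b \<in> combinations P2 (map snd r)"
  shows "\<exists>r'. length r' = length r \<and> set r' \<subseteq> pairs \<and> tens ((a, b) # r) = tens r'"
  using assms
proof (induction r arbitrary: b)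
  case Nil
  then show ?case using cg_gen_zero_right[of a] by (simp add: tens_eq)
next
  case (Cons p r)
  obtain a' b' where p: "p = (a', b')" by (cases p)
  with Cons.prems obtain c y where y: "y \<in> combinations P2 (map snd r)" "b = (c \<odot>\<^bsub>P2\<^esub> b') \<oplus>\<^bsub>P2\<^esub> y"
    by auto
  from Cons.IH[OF _ _ y(1)] Cons.prems obtain r' where r': "length r' = length r" "set r' \<subseteq> pairs"
    "cg (gen a y + rep r) (rep r')" by (auto simp: tens_eq)
  have S: "submodule (combinations P2 (map snd r)) scalars P2"
    using Cons.prems by (intro P2.submodule_combinations) auto
  have in_P: "a \<in> carrier P1" "a' \<in> carrier P1" "b' \<in> carrier P2" "y \<in> carrier P2"
    using Cons.prems p P2.submodule_in[OF S y(1)] by auto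
  have "cg (gen a b) (free_smult c (gen a b') + gen a y)"
    unfolding y(2) by (rule cg_trans[OF cg_gen_add_right cg_add[OF cg_gen_smult_right]])
      (use in_P in auto)
  moreover have "cg (free_smult c (gen a b') + gen a' b') (gen (a' \<oplus>\<^bsub>P1\<^esub> (c \<odot>\<^bsub>P1\<^esub> a)) b')"
    using cg_sym[OF cg_trans[OF cg_gen_add_left cg_add[OF cg_refl cg_gen_smult_left]], of a' c a b'] in_P
    by (simp add: add.commute)
  ultimately have "cg (gen a b + (free_smult c (gen a b') + gen a' b') + (gen a y + rep r))
      (free_smult c (gen a b') + gen a y + gen (a' \<oplus>\<^bsub>P1\<^esub> (c \<odot>\<^bsub>P1\<^esub> a)) b' + rep r')"
    by (intro cg_add r'(3))
  from cg_diff[OF this cg_refl[of "free_smult c (gen a b') + gen a y"]]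
  have "cg (gen a b + (gen a' b' + rep r)) (gen (a' \<oplus>\<^bsub>P1\<^esub> (c \<odot>\<^bsub>P1\<^esub> a)) b' + rep r')"
    by (simp add: algebra_simps)
  then show ?case using r' in_P p
    by (intro exI[of _ "(a' \<oplus>\<^bsub>P1\<^esub> (c \<odot>\<^bsub>P1\<^esub> a), b') # r'"]) (auto simp: tens_eq)
qed

text \<open>A functional that is 1 at b and 0 on the other right factors isolates the left factor of
  that entry.\<close>

lemma irredundant_entry:
  assumes r: "set r \<subseteq> pairs" and b: "b \<in> carrier P2" "b \<notin> combinations P2 (map snd r)"
  obtains \<psi> where "\<psi> \<in> dual_space P2" "\<And>\<phi> a. pairing \<phi> \<psi> ((a, b) # r) = \<phi> a"
proof -
  have s: "set (map snd r) \<subseteq> carrier P2" using r by auto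
  from P2.separating_functional[OF P2.submodule_combinations[OF s] b] obtain \<psi> where
    \<psi>: "\<psi> \<in> dual_space P2" "\<And>h. h \<in> combinations P2 (map snd r) \<Longrightarrow> \<psi> h = 0" "\<psi> b = 1" by metis
  have "pairing \<phi> \<psi> q = 0" if "set q \<subseteq> set r" for \<phi> q
    using that \<psi>(2) P2.set_subset_combinations[OF s] by (induction q) force+
  with \<psi> show thesis by (intro that[of \<psi>]) auto
qed

text \<open>A nonempty list can always be shortened: a dependent right factor is absorbed by the
  rest, and for an independent one some \<psi> isolates the left factor, which must then be 0. Hence
  the forms \<phi> \<otimes> \<psi> separate the points of the tensor product.\<close>

lemma pairing_zero_imp:
  assumes "set l \<subseteq> pairs"
    "\<And>\<phi> \<psi>. \<phi> \<in> dual_space P1 \<Longrightarrow> \<psi> \<in> dual_space P2 \<Longrightarrow> pairing \<phi> \<psi> l = 0"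
  shows "tens l = tens []"
  using assms
proof (induction "length l" arbitrary: l rule: less_induct)
  case less
  show ?case
  proof (cases l)
    case (Cons p r)
    obtain a b where p: "p = (a, b)" by (cases p)
    have ab: "a \<in> carrier P1" "b \<in> carrier P2" "set r \<subseteq> pairs" using less.prems Cons p by auto
    have "\<exists>r'. length r' < length l \<and> set r' \<subseteq> pairs \<and> tens l = tens r'"
    proof (cases "b \<in> combinations P2 (map snd r)")
      case True
      from redundant_entry[OF ab(3,1) True] Cons p show ?thesis by (metis lessI length_Cons)
    next
      case False
      from irredundant_entry[OF ab(3,2) this] obtain \<psi> where
        \<psi>: "\<psi> \<in> dual_space P2" "\<And>\<phi> a. pairing \<phi> \<psi> ((a, b) # r) = \<phi> a" by metis
      have "a = \<zero>\<^bsub>P1\<^esub>" using less.prems(2)[OF _ \<psi>(1)] Cons p ab \<psi>(2)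
        by (intro P1.dual_separates) auto
      then have "tens l = tens r"
        using cg_add[OF cg_gen_zero_left[OF ab(2)] cg_refl[of "rep r"]] Cons p by (simp add: tens_eq)
      then show ?thesis using Cons ab by auto
    qed
    then obtain r' where r': "length r' < length l" "set r' \<subseteq> pairs" "tens l = tens r'" by blast
    have "tens r' = tens []"
      using less.prems(2) cg_pairing r'(3) by (intro less.hyps r') (simp add: tens_eq)
    with r' show ?thesis by simp
  qed simp
qed

lemma pairing_scale_list:
  "\<phi> \<in> dual_space P1 \<Longrightarrow> set l \<subseteq> pairs \<Longrightarrow> pairing \<phi> \<psi> (scale_list c l) = c * pairing \<phi> \<psi> l"
  by (induction l) (auto simp: scale_list_def dual_smult distrib_left mult.assoc)

lemma tens_eq_pairing:
  assumes "set l \<subseteq> pairs" "set l' \<subseteq> pairs"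
  shows "tens l = tens l' \<longleftrightarrow> (\<forall>\<phi>\<in>dual_space P1. \<forall>\<psi>\<in>dual_space P2. pairing \<phi> \<psi> l = pairing \<phi> \<psi> l')"
proof
  assume R: "\<forall>\<phi>\<in>dual_space P1. \<forall>\<psi>\<in>dual_space P2. pairing \<phi> \<psi> l = pairing \<phi> \<psi> l'"
  have "tens (l @ scale_list (- 1) l') = tens []"
    using assms scale_list_closed[OF assms(2)] R by (intro pairing_zero_imp) (auto simp: pairing_scale_list)
  then have "cg (rep l + rep (scale_list (- 1) l')) 0" by (simp add: tens_eq)
  moreover have "cg (rep (scale_list (- 1) l')) (- rep l')"
    using cg_scale_list[OF assms(2), of "- 1"] by simp
  ultimately have "cg (rep l) (rep l')"
    using cg_diff[of "rep l + rep (scale_list (- 1) l')" 0 "rep (scale_list (- 1) l')" "- rep l'"] by simp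
  then show "tens l = tens l'" by (simp add: tens_eq)
qed (use cg_pairing in \<open>auto simp: tens_eq\<close>)

lemma tens_eq_zero:
  "set l \<subseteq> pairs \<Longrightarrow> tens l = \<zero>\<^bsub>T\<^esub> \<longleftrightarrow>
    (\<forall>\<phi>\<in>dual_space P1. \<forall>\<psi>\<in>dual_space P2. pairing \<phi> \<psi> l = 0)"
  using tens_eq_pairing[of l "[]"] by (simp add: zero_T)

lemma scalar_module_T: "scalar_module T"
  unfolding scalar_module_def
proof (rule moduleI)
  show "abelian_group T"
  proof (rule abelian_groupI)
    fix x y assume "x \<in> carrier T" "y \<in> carrier T"
    then show "x \<oplus>\<^bsub>T\<^esub> y \<in> carrier T" by (auto simp: carrier_T add_T)
  next
    fix x y z assume "x \<in> carrier T" "y \<in> carrier T" "z \<in> carrier T"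
    then show "x \<oplus>\<^bsub>T\<^esub> y \<oplus>\<^bsub>T\<^esub> z = x \<oplus>\<^bsub>T\<^esub> (y \<oplus>\<^bsub>T\<^esub> z)" by (auto simp: carrier_T add_T)
  next
    fix x y assume "x \<in> carrier T" "y \<in> carrier T"
    then obtain l l' where "x = tens l" "y = tens l'" by (auto simp: carrier_T)
    then show "x \<oplus>\<^bsub>T\<^esub> y = y \<oplus>\<^bsub>T\<^esub> x" by (simp add: add_T tens_eq add.commute)
  next
    fix x assume "x \<in> carrier T"
    then obtain l where l: "set l \<subseteq> pairs" "x = tens l" by (auto simp: carrier_T)
    have "tens (scale_list (- 1) l) \<oplus>\<^bsub>T\<^esub> x = \<zero>\<^bsub>T\<^esub>"
      using l scale_list_closed[OF l(1)] by (simp add: add_T tens_eq_zero pairing_scale_list)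
    then show "\<exists>y\<in>carrier T. y \<oplus>\<^bsub>T\<^esub> x = \<zero>\<^bsub>T\<^esub>" by (rule bexI) (intro tens_in scale_list_closed l(1))
  qed (auto simp: carrier_T add_T zero_T)
next
  fix a and x assume "x \<in> carrier T"
  then show "a \<odot>\<^bsub>T\<^esub> x \<in> carrier T"
    using scale_list_closed by (auto simp: carrier_T smult_T)
next
  fix a b :: 'k and x assume "x \<in> carrier T"
  then obtain l where l: "set l \<subseteq> pairs" "x = tens l" by (auto simp: carrier_T)
  show "(a \<oplus>\<^bsub>scalars\<^esub> b) \<odot>\<^bsub>T\<^esub> x = a \<odot>\<^bsub>T\<^esub> x \<oplus>\<^bsub>T\<^esub> b \<odot>\<^bsub>T\<^esub> x"
    using l scale_list_closed[OF l(1)]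
    by (simp add: smult_T add_T tens_eq_pairing pairing_scale_list algebra_simps)
  show "(a \<otimes>\<^bsub>scalars\<^esub> b) \<odot>\<^bsub>T\<^esub> x = a \<odot>\<^bsub>T\<^esub> (b \<odot>\<^bsub>T\<^esub> x)"
    using l scale_list_closed[OF l(1)] scale_list_closed[OF scale_list_closed[OF l(1)]]
    by (simp add: smult_T tens_eq_pairing pairing_scale_list algebra_simps)
next
  fix a :: 'k and x y assume "x \<in> carrier T" "y \<in> carrier T"
  then obtain l l' where l: "set l \<subseteq> pairs" "x = tens l" "set l' \<subseteq> pairs" "y = tens l'"
    by (auto simp: carrier_T)
  then have "set (l @ l') \<subseteq> pairs" by simp
  with l show "a \<odot>\<^bsub>T\<^esub> (x \<oplus>\<^bsub>T\<^esub> y) = a \<odot>\<^bsub>T\<^esub> x \<oplus>\<^bsub>T\<^esub> a \<odot>\<^bsub>T\<^esub> y"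
    by (simp add: smult_T add_T scale_list_def)
next
  fix x assume "x \<in> carrier T"
  then obtain l where l: "set l \<subseteq> pairs" "x = tens l" by (auto simp: carrier_T)
  show "\<one>\<^bsub>scalars\<^esub> \<odot>\<^bsub>T\<^esub> x = x"
    using l scale_list_closed[OF l(1)] by (simp add: smult_T tens_eq_pairing pairing_scale_list)
qed (rule cring_scalars)

lemma slice_determined:
  assumes l: "set l \<subseteq> pairs" and a: "a \<in> carrier P1"
    and eq: "\<And>\<phi>. \<phi> \<in> dual_space P1 \<Longrightarrow> pairing \<phi> \<psi> l = \<phi> a"
  shows "slice P1 \<psi> l = a"
proof -
  have f: "fst ` set l \<subseteq> carrier P1" using l by auto
  show ?thesis using a eq by (intro P1.dual_separates_eq) (auto simp: P1.slice_closed[OF f] P1.dual_slice[OF _ f])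
qed

end

lemma tensor_pair_swap: "tensor_pair P1 P2 \<Longrightarrow> tensor_pair P2 P1"
  by (simp add: tensor_pair_def)

context tensor_pair
begin

lemma tens_swap_eq:
  assumes "set l \<subseteq> pairs" "set l' \<subseteq> pairs"
  shows "tensor_pair.tens P2 P1 (map prod.swap l) = tensor_pair.tens P2 P1 (map prod.swap l') \<longleftrightarrow>
    tens l = tens l'"
proof -
  interpret S: tensor_pair P2 P1 by (rule tensor_pair_swap) (rule tensor_pair_axioms)
  have "set (map prod.swap l) \<subseteq> S.pairs" "set (map prod.swap l') \<subseteq> S.pairs" using assms by auto
  then show ?thesis using assms by (simp add: S.tens_eq_pairing tens_eq_pairing) blast
qed

text \<open>If b were independent of the other right factors, a would itself be a contraction and
  lie in V. So b is dependent and its entry can be absorbed.\<close>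

lemma shorten_entry:
  assumes l: "set l \<subseteq> pairs" "(a, b) \<in> set l"
    and slice: "\<And>\<psi>. \<psi> \<in> dual_space P2 \<Longrightarrow> slice P1 \<psi> l \<in> V"
    and a: "a \<notin> V"
  shows "\<exists>l'. length l' < length l \<and> set l' \<subseteq> pairs \<and> tens l = tens l'"
proof -
  from split_list[OF l(2)] obtain xs ys where xy: "l = xs @ (a, b) # ys" by blast
  define r where "r = xs @ ys"
  have eq: "pairing \<phi> \<psi> l = pairing \<phi> \<psi> ((a, b) # r)" "tens l = tens ((a, b) # r)" for \<phi> \<psi>
    by (simp_all add: xy r_def algebra_simps tens_eq)
  have len: "length l = Suc (length r)" by (simp add: xy r_def)
  have ab: "set r \<subseteq> pairs" "a \<in> carrier P1" "b \<in> carrier P2" using l by (auto simp: xy r_def)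
  show ?thesis
  proof (cases "b \<in> combinations P2 (map snd r)")
    case True
    from redundant_entry[OF ab(1,2) True] eq len show ?thesis by (metis lessI)
  next
    case False
    from irredundant_entry[OF ab(1,3) False] obtain \<psi> where
      \<psi>: "\<psi> \<in> dual_space P2" "\<And>\<phi> a. pairing \<phi> \<psi> ((a, b) # r) = \<phi> a" by metis
    have "slice P1 \<psi> l = a" by (rule slice_determined[OF l(1) ab(2)]) (simp only: eq(1) \<psi>(2))
    with slice[OF \<psi>(1)] a show ?thesis by simp
  qed
qed

lemma slice_cong:
  assumes "set l \<subseteq> pairs" "set l' \<subseteq> pairs" "tens l = tens l'" "\<psi> \<in> dual_space P2"
  shows "slice P1 \<psi> l = slice P1 \<psi> l'"
proof -
  have f: "fst ` set l' \<subseteq> carrier P1" using assms by auto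
  show ?thesis using assms P1.dual_slice[OF _ f]
    by (intro slice_determined) (auto simp: P1.slice_closed[OF f] tens_eq_pairing)
qed

text \<open>Contractions are invariants of the tensor, so the hypotheses survive every shortening of
  the list. A list that cannot be shortened has all left factors in V and, by exchanging the
  factors, all right factors in W.\<close>

lemma slices_decompose:
  assumes "set l \<subseteq> pairs"
    "\<And>\<psi>. \<psi> \<in> dual_space P2 \<Longrightarrow> slice P1 \<psi> l \<in> V"
    "\<And>\<phi>. \<phi> \<in> dual_space P1 \<Longrightarrow> slice P2 \<phi> (map prod.swap l) \<in> W"
  shows "\<exists>l'. set l' \<subseteq> pairs \<inter> (V \<times> W) \<and> tens l' = tens l"
  using assms
proof (induction "length l" arbitrary: l rule: less_induct)
  case less
  interpret S: tensor_pair P2 P1 by (rule tensor_pair_swap) (rule tensor_pair_axioms)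
  have sw: "set (map prod.swap l) \<subseteq> S.pairs" using less.prems(1) by auto
  show ?case
  proof (cases "set l \<subseteq> V \<times> W")
    case True
    then show ?thesis using less.prems by blast
  next
    case False
    then obtain a b where ab: "(a, b) \<in> set l" "a \<notin> V \<or> b \<notin> W" by auto
    have "\<exists>l'. length l' < length l \<and> set l' \<subseteq> pairs \<and> tens l = tens l'"
    proof (cases "a \<in> V")
      case False
      then show ?thesis using shorten_entry less.prems ab by metis
    next
      case True
      with ab have b: "b \<notin> W" "(b, a) \<in> set (map prod.swap l)" by force+
      from S.shorten_entry[OF sw b(2) less.prems(3) b(1)] obtain q where
        q: "length q < length l" "set q \<subseteq> S.pairs" "S.tens (map prod.swap l) = S.tens q" by auto
      have "map prod.swap (map prod.swap q) = q" by (simp add: comp_def)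
      moreover have "set (map prod.swap q) \<subseteq> pairs" using q by auto
      ultimately show ?thesis using tens_swap_eq[OF less.prems(1)] q
        by (metis length_map)
    qed
    then obtain l' where l': "length l' < length l" "set l' \<subseteq> pairs" "tens l = tens l'" by blast
    have sw': "set (map prod.swap l') \<subseteq> S.pairs" using l'(2) by auto
    have "\<exists>l''. set l'' \<subseteq> pairs \<inter> (V \<times> W) \<and> tens l'' = tens l'"
    proof (rule less.hyps[OF l'(1,2)])
      fix \<psi> assume "\<psi> \<in> dual_space P2"
      then show "slice P1 \<psi> l' \<in> V"
        using slice_cong[OF less.prems(1) l'(2,3)] less.prems(2) by metis
    next
      fix \<phi> assume "\<phi> \<in> dual_space P1"
      then show "slice P2 \<phi> (map prod.swap l') \<in> W"
        using S.slice_cong[OF sw sw'] tens_swap_eq[OF less.prems(1) l'(2)] l'(3) less.prems(3) by metis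
    qed
    then show ?thesis using l'(3) by simp
  qed
qed

end

section \<open>Finite-dimensional subspaces and Poisson algebras\<close>

lemma (in scalar_module) submodule_Inter:
  assumes "A \<noteq> {}" "\<And>N. N \<in> A \<Longrightarrow> submodule N scalars M"
  shows "submodule (\<Inter>A) scalars M"
proof (rule submodule_scalarsI)
  show "\<Inter>A \<subseteq> carrier M" using assms submodule_in by fast
qed (use assms(2) submodule_zero submodule_add submodule_smult in \<open>auto dest: bspec\<close>)

lemma submodule_lin_span:
  assumes "scalar_module M" "B \<subseteq> carrier M"
  shows "submodule (lin_span M B) scalars M"
proof -
  interpret scalar_module M by fact
  show ?thesis unfolding lin_span_def hull_def
    by (rule submodule_Inter) (use assms carrier_is_submodule in auto)
qed

lemma lin_span_minimal: "submodule N scalars M \<Longrightarrow> B \<subseteq> N \<Longrightarrow> lin_span M B \<subseteq> N"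
  unfolding lin_span_def by (rule hull_minimal)

lemma lin_span_superset: "B \<subseteq> lin_span M B"
  unfolding lin_span_def by (rule hull_subset)

text \<open>Coefficients with respect to B turn the sequence into vectors of a free space, where the
  dimension bound of the library yields a relation. The relation is stated through functionals, the
  form in which it is used later.\<close>

lemma lin_span_dependent:
  fixes M :: "('k::field, 'a) nc_poisson" and v :: "nat \<Rightarrow> 'a"
  assumes M: "scalar_module M" and B: "finite B" "B \<subseteq> carrier M" and v: "\<And>i. v i \<in> lin_span M B"
  shows "\<exists>(c :: nat \<Rightarrow> 'k) N. (\<exists>i\<le>N. c i \<noteq> 0) \<and> (\<forall>\<phi>\<in>dual_space M. (\<Sum>i\<le>N. c i * \<phi> (v i)) = 0)"
proof -
  interpret scalar_module M by fact
  define S where "S = {x \<in> carrier M. \<exists>d. \<forall>\<phi>\<in>dual_space M. \<phi> x = (\<Sum>b\<in>B. d b * \<phi> b)}"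
  have "submodule S scalars M"
  proof (rule submodule_scalarsI)
    show "\<zero>\<^bsub>M\<^esub> \<in> S" by (auto simp: S_def dual_zero intro!: exI[of _ "\<lambda>_. 0"])
    fix x y assume "x \<in> S" "y \<in> S"
    then obtain d e where *: "x \<in> carrier M" "y \<in> carrier M" "\<forall>\<phi>\<in>dual_space M. \<phi> x = (\<Sum>b\<in>B. d b * \<phi> b)"
      "\<forall>\<phi>\<in>dual_space M. \<phi> y = (\<Sum>b\<in>B. e b * \<phi> b)" by (auto simp: S_def)
    then have "\<forall>\<phi>\<in>dual_space M. \<phi> (x \<oplus>\<^bsub>M\<^esub> y) = (\<Sum>b\<in>B. (d b + e b) * \<phi> b)"
      by (simp add: dual_add distrib_right sum.distrib)
    with * show "x \<oplus>\<^bsub>M\<^esub> y \<in> S" unfolding S_def mem_Collect_eq by (intro conjI a_closed exI[of _ "\<lambda>b. d b + e b"])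
  next
    fix c x assume "x \<in> S"
    then obtain d where *: "x \<in> carrier M" "\<forall>\<phi>\<in>dual_space M. \<phi> x = (\<Sum>b\<in>B. d b * \<phi> b)"
      by (auto simp: S_def)
    then have "\<forall>\<phi>\<in>dual_space M. \<phi> (c \<odot>\<^bsub>M\<^esub> x) = (\<Sum>b\<in>B. (c * d b) * \<phi> b)"
      by (simp add: dual_smult mult.assoc flip: sum_distrib_left)
    with * show "c \<odot>\<^bsub>M\<^esub> x \<in> S" unfolding S_def mem_Collect_eq by (intro conjI smult_in exI[of _ "\<lambda>b. c * d b"])
  qed (auto simp: S_def)
  moreover have "B \<subseteq> S"
  proof
    fix b assume b: "b \<in> B"
    have "\<phi> b = (\<Sum>b'\<in>B. (if b' = b then 1 else 0) * \<phi> b')" for \<phi> :: "'a \<Rightarrow> 'k"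
      using b B by (simp add: if_distrib[of "\<lambda>t. t * _"] cong: if_cong)
    then show "b \<in> S" using b B unfolding S_def mem_Collect_eq
      by (intro conjI exI[of _ "\<lambda>b'. if b' = b then 1 else 0"] ballI) auto
  qed
  ultimately have "v i \<in> S" for i using v lin_span_minimal by blast
  then obtain d where d: "\<And>i \<phi>. \<phi> \<in> dual_space M \<Longrightarrow> \<phi> (v i) = (\<Sum>b\<in>B. d i b * \<phi> b)"
    unfolding S_def mem_Collect_eq by metis
  define w :: "nat \<Rightarrow> ('a \<Rightarrow>\<^sub>0 'k)" where "w i = (\<Sum>b\<in>B. free_smult (d i b) (Poly_Mapping.single b 1))" for i
  have lookup_w: "Poly_Mapping.lookup (w i) b = d i b" if "b \<in> B" for i b
    using that B
    by (simp add: w_def lookup_sum lookup_free_smult lookup_single when_def if_distrib[of "\<lambda>t. _ * t"] cong: if_cong)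
  \<comment> \<open>The indices up to \<open>card B\<close> give one vector more than there are
    generators.\<close>
  let ?N = "card B"
  show ?thesis
  proof (cases "inj_on w {..?N}")
    case True
    let ?G = "(\<lambda>b. Poly_Mapping.single b 1 :: 'a \<Rightarrow>\<^sub>0 'k) ` B"
    have "w i \<in> free_vs.span ?G" for i
      unfolding w_def by (rule free_vs.span_sum, rule free_vs.span_scale, rule free_vs.span_base) blast
    then have "w ` {..?N} \<subseteq> free_vs.span ?G" by blast
    moreover have "card (w ` {..?N}) > card ?G"
      using True card_image_le[OF B(1), of "\<lambda>b. Poly_Mapping.single b 1 :: 'a \<Rightarrow>\<^sub>0 'k"]
      by (simp add: card_image)
    ultimately have "free_vs.dependent (w ` {..?N})"
      using free_vs.independent_span_bound[of ?G "w ` {..?N}"] B by auto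
    then obtain c where c: "\<exists>x\<in>w ` {..?N}. c x \<noteq> 0" "(\<Sum>x\<in>w ` {..?N}. free_smult (c x) x) = 0"
      using free_vs.dependent_finite[of "w ` {..?N}"] by auto
    then have "(\<Sum>i\<le>?N. free_smult (c (w i)) (w i)) = 0" by (simp only: sum.reindex[OF True] comp_def)
    then have lookup_zero: "Poly_Mapping.lookup (\<Sum>i\<le>?N. free_smult (c (w i)) (w i)) b = 0" for b by simp
    have z: "(\<Sum>i\<le>?N. c (w i) * d i b) = 0" if "b \<in> B" for b
      using lookup_zero[of b] that by (simp add: lookup_sum lookup_free_smult lookup_w)
    have "(\<Sum>i\<le>?N. c (w i) * \<phi> (v i)) = 0" if "\<phi> \<in> dual_space M" for \<phi>
    proof -
      have "(\<Sum>i\<le>?N. c (w i) * \<phi> (v i)) = (\<Sum>b\<in>B. (\<Sum>i\<le>?N. c (w i) * d i b) * \<phi> b)"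
        unfolding d[OF that] sum_distrib_left sum_distrib_right by (subst sum.swap) (simp add: mult.assoc)
      also have "\<dots> = 0" by (simp add: z)
      finally show ?thesis .
    qed
    with c(1) show ?thesis by (intro exI[of _ "\<lambda>i. c (w i)"] exI[of _ ?N]) auto
  next
    \<comment> \<open>Linear dependence of a set does not see repetitions, so two equal vectors need
      their own relation: coefficient 1 at i and -1 at j.\<close>
    case False
    then obtain i j where ij: "i \<le> ?N" "j \<le> ?N" "i \<noteq> j" "w i = w j" by (auto simp: inj_on_def)
    then have "\<phi> (v i) = \<phi> (v j)" if "\<phi> \<in> dual_space M" for \<phi>
      using lookup_w[of _ i] lookup_w[of _ j] by (simp add: d[OF that])
    moreover define c :: "nat \<Rightarrow> 'k" where "c k = (if k = i then 1 else 0) - (if k = j then 1 else 0)" for k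
    have "(\<Sum>k\<le>?N. c k * \<phi> (v k)) = \<phi> (v i) - \<phi> (v j)" for \<phi> :: "'a \<Rightarrow> 'k"
      using ij by (simp add: c_def left_diff_distrib sum_subtractf if_distrib[of "\<lambda>t. t * _"] cong: if_cong)
    moreover have "c i \<noteq> 0" using ij by (simp add: c_def)
    ultimately show ?thesis using ij(1) by (intro exI[of _ c] exI[of _ ?N]) auto
  qed
qed

text \<open>Split off a root c of p, so p = (X - c) q. Either q(L) y is nonzero, hence an
  eigenvector for c, or q is an annihilating polynomial of smaller degree.\<close>

lemma eigenvector_exists:
  fixes M :: "('k::alg_closed_field, 'a, 'm) module_scheme"
  assumes M: "scalar_module M" and L: "linear_op M L" and y: "y \<in> carrier M" "y \<noteq> \<zero>\<^bsub>M\<^esub>"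
    and p: "p \<noteq> 0" "\<And>\<phi>. \<phi> \<in> dual_space M \<Longrightarrow> (\<Sum>i\<le>degree p. coeff p i * \<phi> ((L ^^ i) y)) = 0"
  shows "\<exists>c. \<exists>x\<in>carrier M - {\<zero>\<^bsub>M\<^esub>}. L x = c \<odot>\<^bsub>M\<^esub> x"
  using p
proof (induction "degree p" arbitrary: p)
  case 0
  interpret scalar_module M by fact
  have "coeff p 0 \<noteq> 0" using 0 leading_coeff_0_iff[of p] by simp
  then have "y = \<zero>\<^bsub>M\<^esub>"
    using 0 by (intro dual_separates y) auto
  with y show ?case by simp
next
  case (Suc n)
  interpret scalar_module M by fact
  from Suc.hyps(2) obtain c where c: "poly p c = 0" using alg_closed_imp_poly_has_root[of p] by auto
  then obtain q where q: "p = [:- c, 1:] * q" by (auto simp: poly_eq_0_iff_dvd)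
  then have q0: "q \<noteq> 0" using Suc.prems by auto
  then have "degree p = Suc (degree q)" unfolding q by (subst degree_mult_eq) auto
  then have n: "degree q = n" using Suc.hyps by simp
  \<comment> \<open>Pairing each power with its exponent lets \<open>coeff q\<close> play the part
    of the second functional, so that the contraction is q(L) y.\<close>
  define l where "l = map (\<lambda>i. ((L ^^ i) y, i)) [0..<Suc n]"
  define x where "x = slice M (coeff q) l"
  have Ly: "(L ^^ i) y \<in> carrier M" for i using linear_op_closed[OF linear_op_funpow[OF L] y(1)] .
  have l: "fst ` set l \<subseteq> carrier M" using Ly by (auto simp: l_def)
  have x: "x \<in> carrier M" unfolding x_def by (rule slice_closed[OF l])
  have \<phi>x: "\<phi> x = (\<Sum>i\<le>n. coeff q i * \<phi> ((L ^^ i) y))" if "\<phi> \<in> dual_space M" for \<phi>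
    unfolding x_def dual_slice[OF that l]
    by (simp add: pairing_def l_def comp_def mult.commute interv_sum_list_conv_sum_set_nat
        atLeast0LessThan lessThan_Suc_atMost del: upt_Suc)
  show ?case
  proof (cases "x = \<zero>\<^bsub>M\<^esub>")
    case True
    then show ?thesis using Suc.hyps(1)[of q] n q0 \<phi>x dual_zero by simp
  next
    case False
    have "L x = c \<odot>\<^bsub>M\<^esub> x"
    proof (rule dual_separates_eq)
      fix \<phi> assume \<phi>: "\<phi> \<in> dual_space M"
      have "\<phi> (L x) - \<phi> (c \<odot>\<^bsub>M\<^esub> x) =
          (\<Sum>i\<le>n. coeff q i * \<phi> ((L ^^ Suc i) y)) - c * (\<Sum>i\<le>n. coeff q i * \<phi> ((L ^^ i) y))"
        using \<phi>x[OF dual_comp[OF \<phi> L]] \<phi>x[OF \<phi>] \<phi> x by (simp add: dual_smult)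
      also have "(\<Sum>i\<le>n. coeff q i * \<phi> ((L ^^ Suc i) y)) =
          (\<Sum>i\<le>Suc n. (if i = 0 then 0 else coeff q (i - 1)) * \<phi> ((L ^^ i) y))"
        by (simp add: sum.atMost_Suc_shift del: sum.atMost_Suc)
      also have "(\<Sum>i\<le>n. coeff q i * \<phi> ((L ^^ i) y)) = (\<Sum>i\<le>Suc n. coeff q i * \<phi> ((L ^^ i) y))"
        using n by (simp add: coeff_eq_0)
      also have "(\<Sum>i\<le>Suc n. (if i = 0 then 0 else coeff q (i - 1)) * \<phi> ((L ^^ i) y)) -
          c * (\<Sum>i\<le>Suc n. coeff q i * \<phi> ((L ^^ i) y)) =
          (\<Sum>i\<le>Suc n. ((if i = 0 then 0 else coeff q (i - 1)) - c * coeff q i) * \<phi> ((L ^^ i) y))"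
        by (simp only: sum_distrib_left sum_subtractf left_diff_distrib mult.assoc)
      also have "\<dots> = (\<Sum>i\<le>degree p. coeff p i * \<phi> ((L ^^ i) y))"
        unfolding Suc.hyps(2)[symmetric]
        by (intro sum.cong refl arg_cong2[where f = "(*)"])
          (auto simp: q coeff_pCons split: nat.splits)
      also have "\<dots> = 0" by (rule Suc.prems(2)[OF \<phi>])
      finally show "\<phi> (L x) = \<phi> (c \<odot>\<^bsub>M\<^esub> x)" by simp
    qed (use x linear_op_closed[OF L] in auto)
    then show ?thesis using x False by blast
  qed
qed

lemma lin_span_eigenvector:
  fixes M :: "('k::alg_closed_field, 'a) nc_poisson"
  assumes M: "scalar_module M" and L: "linear_op M L" and y: "y \<in> carrier M" "y \<noteq> \<zero>\<^bsub>M\<^esub>"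
    and B: "finite B" "B \<subseteq> carrier M" "\<And>i. (L ^^ i) y \<in> lin_span M B"
  shows "\<exists>c. \<exists>x\<in>carrier M - {\<zero>\<^bsub>M\<^esub>}. L x = c \<odot>\<^bsub>M\<^esub> x"
proof -
  from lin_span_dependent[where v = "\<lambda>i. (L ^^ i) y", OF M B] obtain c :: "nat \<Rightarrow> 'k" and N i where
    c: "i \<le> N" "c i \<noteq> 0" "\<forall>\<phi>\<in>dual_space M. (\<Sum>i\<le>N. c i * \<phi> ((L ^^ i) y)) = 0" by blast
  \<comment> \<open>The leading coefficients may vanish, so the degree of p can be smaller than N
    and the sums have to be compared.\<close>
  define p where "p = Poly (map c [0..<Suc N])"
  have co: "coeff p j = (if j \<le> N then c j else 0)" for j
    by (simp add: p_def nth_default_def less_Suc_eq_le del: upt_Suc)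
  have "p \<noteq> 0" using c co[of i] by auto
  moreover have "degree p \<le> N" by (rule degree_le) (simp add: co)
  have "(\<Sum>i\<le>degree p. coeff p i * \<phi> ((L ^^ i) y)) = 0" if "\<phi> \<in> dual_space M" for \<phi>
  proof -
    have "(\<Sum>i\<le>degree p. coeff p i * \<phi> ((L ^^ i) y)) = (\<Sum>i\<le>N. coeff p i * \<phi> ((L ^^ i) y))"
      by (rule sum.mono_neutral_left) (use \<open>degree p \<le> N\<close> in \<open>auto simp: coeff_eq_0\<close>)
    also have "\<dots> = 0" using c(3) that by (simp add: co)
    finally show ?thesis .
  qed
  ultimately show ?thesis by (rule eigenvector_exists[OF M L y])
qed

context nc_poisson_algebra
begin

lemma scalar_module_P: "scalar_module P"
  by (simp add: scalar_module_def module_axioms)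

lemma linear_op_ad: "z \<in> carrier P \<Longrightarrow> linear_op P (ad P z)"
  by (auto simp: linear_op_def ad_def bracket_closed bracket_add_right bracket_smult_right)

lemma linear_op_ad': "z \<in> carrier P \<Longrightarrow> linear_op P (\<lambda>x. \<lbrace>x, z\<rbrace>)"
  by (auto simp: linear_op_def bracket_closed bracket_add_left bracket_smult_left)

lemma linear_op_mult_left: "z \<in> carrier P \<Longrightarrow> linear_op P (\<lambda>x. z \<otimes> x)"
  by (auto simp: linear_op_def r_distr smult_mult_right)

lemma linear_op_mult_right: "z \<in> carrier P \<Longrightarrow> linear_op P (\<lambda>x. x \<otimes> z)"
  by (auto simp: linear_op_def l_distr smult_mult_left)

lemma bracket_zero_right [simp]: "x \<in> carrier P \<Longrightarrow> \<lbrace>x, \<zero>\<rbrace> = \<zero>"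
  using scalar_module.linear_op_zero[OF scalar_module_P linear_op_ad] by (simp add: ad_def)

text \<open>The Leibniz rule for 1 = 1 1 gives {x, 1} = {x, 1} + {x, 1}.\<close>

lemma bracket_one_right: "x \<in> carrier P \<Longrightarrow> \<lbrace>x, \<one>\<rbrace> = \<zero>"
  using leibniz[of x \<one> \<one>] bracket_closed[of x \<one>] by simp

lemma bracket_anticomm:
  assumes "x \<in> carrier P" "y \<in> carrier P"
  shows "\<lbrace>x, y\<rbrace> \<oplus> \<lbrace>y, x\<rbrace> = \<zero>"
  using bracket_alternating[of "x \<oplus> y"] bracket_alternating[of x] bracket_alternating[of y] assms
  by (simp add: bracket_add_left bracket_add_right bracket_closed a_comm)

lemma bracket_one_left: "x \<in> carrier P \<Longrightarrow> \<lbrace>\<one>, x\<rbrace> = \<zero>"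
  using bracket_anticomm[of x \<one>] bracket_closed[of \<one> x] by (simp add: bracket_one_right)

lemma scalar_in_center: "c \<odot> \<one> \<in> poisson_center P"
  by (simp add: poisson_center_def smult_mult_left smult_mult_right bracket_smult_left bracket_one_left
      scalar_module.smult_in[OF scalar_module_P] scalar_module.smult_zero_right[OF scalar_module_P])

text \<open>In Class 1 all products commute and in Class 2 the bracket is the commutator, so failure
  of centrality always shows in the bracket.\<close>

lemma noncentral_bracket:
  assumes "z \<in> carrier P - poisson_center P" "class_1 P \<or> class_2 P"
  obtains w where "w \<in> carrier P" "\<lbrace>z, w\<rbrace> \<noteq> \<zero>"
proof -
  from assms(1) obtain w where w: "w \<in> carrier P" "z \<otimes> w \<noteq> w \<otimes> z \<or> \<lbrace>z, w\<rbrace> \<noteq> \<zero>" "z \<in> carrier P"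
    by (auto simp: poisson_center_def)
  have "\<lbrace>z, w\<rbrace> \<noteq> \<zero>"
  proof
    assume "\<lbrace>z, w\<rbrace> = \<zero>"
    then have "z \<otimes> w \<ominus> w \<otimes> z = \<zero>" "z \<otimes> w \<noteq> w \<otimes> z"
      using assms(2) w by (auto simp: class_1_def class_2_def commutative_product_def)
    then show False using w scalar_module.eq_if_minus_zero[OF scalar_module_P] by simp
  qed
  with w(1) show thesis by (rule that)
qed

end

section \<open>The adjoint operator of a pure tensor\<close>

lemma (in scalar_module) submodule_kernel:
  assumes f: "linear_op M f"
  shows "submodule {x \<in> carrier M. f x = \<zero>} scalars M"
  by (rule submodule_scalarsI)
    (use f in \<open>auto simp: linear_op_zero linear_op_add linear_op_smult\<close>)

context shift_pair
begin

lemma shift_pair_swap: "shift_pair M2 G2 D2 R2 M1 G1 D1 R1"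
  by (simp add: shift_pair_def M1.shift_operators_axioms M2.shift_operators_axioms)

lemma pairing_step_pow_swap:
  "pairing \<psi> \<phi> ((shift_pair.step D2 R2 D1 R1 ^^ n) (map prod.swap l)) = pairing \<phi> \<psi> ((step ^^ n) l)"
proof -
  interpret S: shift_pair M2 G2 D2 R2 M1 G1 D1 R1 by (rule shift_pair_swap)
  show ?thesis
    by (induction n arbitrary: \<phi> \<psi>) (simp_all add: pairing_step S.pairing_step add.commute)
qed

text \<open>The left contractions lie in \<open>M1.nil\<close>, which \<open>D1\<close> kills here,
  so the summand \<open>D1 \<otimes> R2\<close> vanishes on the tensor. What remains is R1 \<otimes>
  D2, and cancelling the injective \<open>R1\<close> leaves id \<otimes> D2.\<close>

lemma kernel_slice:
  assumes l: "set l \<subseteq> carrier M1 \<times> carrier M2"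
    and zero: "\<And>\<phi> \<psi>. \<lbrakk>\<phi> \<in> dual_space M1; \<psi> \<in> dual_space M2\<rbrakk> \<Longrightarrow> pairing \<phi> \<psi> (step l) = 0"
    and nil: "\<And>x. x \<in> M1.nil \<Longrightarrow> D1 x = \<zero>\<^bsub>M1\<^esub>"
    and \<phi>: "\<phi> \<in> dual_space M1"
  shows "D2 (slice M2 \<phi> (map prod.swap l)) = \<zero>\<^bsub>M2\<^esub>"
proof (rule M2.dual_separates)
  have f: "fst ` set l \<subseteq> carrier M1" "fst ` set (map prod.swap l) \<subseteq> carrier M2" using l by auto
  note b = M2.slice_closed[OF f(2), of \<phi>]
  then show "D2 (slice M2 \<phi> (map prod.swap l)) \<in> carrier M2" by simp
  fix \<psi> assume \<psi>: "\<psi> \<in> dual_space M2"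
  have a: "slice M1 (\<psi> \<circ> D2) l \<in> carrier M1" by (rule M1.slice_closed[OF f(1)])
  have "R1 (slice M1 (\<psi> \<circ> D2) l) = \<zero>\<^bsub>M1\<^esub>"
  proof (rule M1.dual_separates)
    fix \<phi> assume \<phi>: "\<phi> \<in> dual_space M1"
    have "slice M1 (\<psi> \<circ> R2) l \<in> M1.nil"
      using zero by (intro slice_nil[OF l, of 1] dual_comp[OF \<psi> M2.linear_R]) auto
    then have "pairing (\<phi> \<circ> D1) (\<psi> \<circ> R2) l = 0"
      using nil M1.dual_slice[OF dual_comp[OF \<phi> M1.linear_D] f(1), of "\<psi> \<circ> R2"] \<phi>
      by (simp add: M1.dual_zero)
    with zero[OF \<phi> \<psi>] have "pairing (\<phi> \<circ> R1) (\<psi> \<circ> D2) l = 0" by (simp add: pairing_step)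
    then show "\<phi> (R1 (slice M1 (\<psi> \<circ> D2) l)) = 0"
      using M1.dual_slice[OF dual_comp[OF \<phi> M1.linear_R] f(1), of "\<psi> \<circ> D2"] by simp
  qed (use a in simp)
  then have "slice M1 (\<psi> \<circ> D2) l = \<zero>\<^bsub>M1\<^esub>" using a by (rule M1.R_eq_zero[rotated])
  then have "pairing \<phi> (\<psi> \<circ> D2) l = 0"
    using M1.dual_slice[OF \<phi> f(1), of "\<psi> \<circ> D2"] \<phi> by (simp add: M1.dual_zero)
  then show "\<psi> (D2 (slice M2 \<phi> (map prod.swap l))) = 0"
    using M2.dual_slice[OF dual_comp[OF \<psi> M2.linear_D] f(2), of \<phi>] by simp
qed

text \<open>While the constant coefficient is 0, one factor of the operator is removed by passing to
  \<open>step l\<close>. Once it is nonzero, dividing by it gives the relation required by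
  \<open>relation_imp_zero\<close>. So annihilation by a polynomial implies annihilation by a
  power.\<close>

lemma dependent_imp_zero:
  assumes "set l \<subseteq> carrier M1 \<times> carrier M2" "\<exists>i\<le>N. c i \<noteq> 0"
    and "\<And>\<phi> \<psi>. \<phi> \<in> dual_space M1 \<Longrightarrow> \<psi> \<in> dual_space M2 \<Longrightarrow>
      (\<Sum>i\<le>N. c i * pairing \<phi> \<psi> ((step ^^ i) l)) = 0"
  shows "\<exists>m. \<forall>\<phi>\<in>dual_space M1. \<forall>\<psi>\<in>dual_space M2. pairing \<phi> \<psi> ((step ^^ m) l) = 0"
  using assms
proof (induction N arbitrary: l c)
  case 0
  then show ?case by (intro exI[of _ 0]) auto
next
  case (Suc N)
  have sum: "c 0 * pairing \<phi> \<psi> l + (\<Sum>s\<le>N. c (Suc s) * pairing \<phi> \<psi> ((step ^^ Suc s) l)) = 0"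
    if "\<phi> \<in> dual_space M1" "\<psi> \<in> dual_space M2" for \<phi> \<psi>
    using Suc.prems(3)[OF that] by (simp add: sum.atMost_Suc_shift del: sum.atMost_Suc)
  show ?case
  proof (cases "c 0 = 0")
    case True
    have "\<exists>m. \<forall>\<phi>\<in>dual_space M1. \<forall>\<psi>\<in>dual_space M2. pairing \<phi> \<psi> ((step ^^ m) (step l)) = 0"
    proof (rule Suc.IH[of _ "\<lambda>i. c (Suc i)"])
      show "set (step l) \<subseteq> carrier M1 \<times> carrier M2" using Suc.prems(1) by (rule step_closed)
      from Suc.prems(2) True obtain i where "i \<le> Suc N" "c i \<noteq> 0" "i \<noteq> 0" by metis
      then show "\<exists>i\<le>N. c (Suc i) \<noteq> 0" by (intro exI[of _ "i - 1"]) auto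
    next
      show "(\<Sum>i\<le>N. c (Suc i) * pairing \<phi> \<psi> ((step ^^ i) (step l))) = 0"
        if "\<phi> \<in> dual_space M1" "\<psi> \<in> dual_space M2" for \<phi> \<psi>
        using sum[OF that] True by (simp add: funpow_swap1)
    qed
    then obtain m where "\<forall>\<phi>\<in>dual_space M1. \<forall>\<psi>\<in>dual_space M2. pairing \<phi> \<psi> ((step ^^ m) (step l)) = 0" ..
    then show ?thesis by (intro exI[of _ "Suc m"]) (simp add: funpow_swap1)
  next
    case False
    have "pairing \<phi> \<psi> l = 0" if "\<phi> \<in> dual_space M1" "\<psi> \<in> dual_space M2" for \<phi> \<psi>
    proof (rule relation_imp_zero[where N = N and e = "\<lambda>s. - (c (Suc s) / c 0)", OF Suc.prems(1) _ that])
      fix \<phi> \<psi> assume "\<phi> \<in> dual_space M1" "\<psi> \<in> dual_space M2"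
      from sum[OF this] have "c 0 * pairing \<phi> \<psi> l = - (\<Sum>s\<le>N. c (Suc s) * pairing \<phi> \<psi> ((step ^^ Suc s) l))"
        by (simp add: eq_neg_iff_add_eq_0)
      then have "pairing \<phi> \<psi> l = - (\<Sum>s\<le>N. c (Suc s) * pairing \<phi> \<psi> ((step ^^ Suc s) l)) / c 0"
        using False by (simp add: field_simps)
      then show "pairing \<phi> \<psi> l = (\<Sum>s\<le>N. - (c (Suc s) / c 0) * pairing \<phi> \<psi> ((step ^^ Suc s) l))"
        by (simp add: sum_divide_distrib sum_negf)
    qed
    then show ?thesis by (intro exI[of _ 0]) simp
  qed
qed

end

text \<open>Identifies the abstract operator with \<open>ad \<Theta>\<close>. The vectors
  \<open>e1\<close> and \<open>e2\<close>, later the units, transfer properties of one factor to the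
  tensor product by a \<otimes> e2 and e1 \<otimes> b.\<close>

locale poisson_shift_pair =
  shift_pair P1 G1 D1 R1 P2 G2 D2 R2 + tensor_pair P1 P2
  for P1 :: "('k::field, 'a) nc_poisson" and G1 D1 R1
    and P2 :: "('k, 'b) nc_poisson" and G2 D2 R2 +
  fixes \<Theta> :: "('a \<times> 'b \<Rightarrow>\<^sub>0 'k) set" and e1 e2
  assumes \<Theta>_in: "\<Theta> \<in> carrier (poisson_tensor P1 P2)"
    and ad_tens: "set l \<subseteq> carrier P1 \<times> carrier P2 \<Longrightarrow> ad (poisson_tensor P1 P2) \<Theta> (tens l) = tens (step l)"
    and e1: "e1 \<in> carrier P1" "e1 \<noteq> \<zero>\<^bsub>P1\<^esub>" "D1 e1 = \<zero>\<^bsub>P1\<^esub>"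
    and e2: "e2 \<in> carrier P2" "e2 \<noteq> \<zero>\<^bsub>P2\<^esub>" "D2 e2 = \<zero>\<^bsub>P2\<^esub>"
    and noncentral: "\<exists>a\<in>carrier P1. D1 a \<noteq> \<zero>\<^bsub>P1\<^esub>"
begin

sublocale T: scalar_module "poisson_tensor P1 P2"
  by (rule scalar_module_T)

abbreviation "ker1 \<equiv> {x \<in> carrier P1. D1 x = \<zero>\<^bsub>P1\<^esub>}"
abbreviation "ker2 \<equiv> {x \<in> carrier P2. D2 x = \<zero>\<^bsub>P2\<^esub>}"

lemma tensE:
  assumes "X \<in> carrier T" obtains l where "set l \<subseteq> pairs" "X = tens l"
  using assms by (auto simp: carrier_T)

lemma ad_pow_tens: "set l \<subseteq> pairs \<Longrightarrow> (ad T \<Theta> ^^ n) (tens l) = tens ((step ^^ n) l)"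
  by (induction n) (auto simp: ad_tens step_pow_closed)

lemma ad_pow_tens_zero:
  "set l \<subseteq> pairs \<Longrightarrow> (ad T \<Theta> ^^ n) (tens l) = \<zero>\<^bsub>T\<^esub> \<longleftrightarrow>
     (\<forall>\<phi>\<in>dual_space P1. \<forall>\<psi>\<in>dual_space P2. pairing \<phi> \<psi> ((step ^^ n) l) = 0)"
  by (simp add: ad_pow_tens tens_eq_zero step_pow_closed)

lemma ad_tens_zero:
  "set l \<subseteq> pairs \<Longrightarrow> ad T \<Theta> (tens l) = \<zero>\<^bsub>T\<^esub> \<longleftrightarrow>
     (\<forall>\<phi>\<in>dual_space P1. \<forall>\<psi>\<in>dual_space P2. pairing \<phi> \<psi> (step l) = 0)"
  using ad_pow_tens_zero[of l 1] by simp

lemma linear_op_adT: "linear_op T (ad T \<Theta>)"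
  unfolding linear_op_def
proof (intro conjI ballI allI)
  fix X assume "X \<in> carrier T"
  then show "ad T \<Theta> X \<in> carrier T" by (elim tensE) (simp add: ad_tens step_closed)
next
  fix X Y assume "X \<in> carrier T" "Y \<in> carrier T"
  then show "ad T \<Theta> (X \<oplus>\<^bsub>T\<^esub> Y) = ad T \<Theta> X \<oplus>\<^bsub>T\<^esub> ad T \<Theta> Y"
    by (elim tensE) (simp add: ad_tens add_T tens_eq_pairing step_closed step_append_eq)
next
  fix c X assume "X \<in> carrier T"
  then obtain l where l: "set l \<subseteq> pairs" "X = tens l" by (rule tensE)
  have "pairing \<phi> \<psi> (step (scale_list c l)) = pairing \<phi> \<psi> (scale_list c (step l))"
    if "\<phi> \<in> dual_space P1" for \<phi> \<psi>
    using l(1) dual_comp[OF that M1.linear_D] dual_comp[OF that M1.linear_R] step_closed[OF l(1)] that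
    by (simp add: pairing_step pairing_scale_list distrib_left)
  then show "ad T \<Theta> (c \<odot>\<^bsub>T\<^esub> X) = c \<odot>\<^bsub>T\<^esub> ad T \<Theta> X"
    using l scale_list_closed[OF l(1), of c] step_closed[OF l(1)] scale_list_closed[OF step_closed[OF l(1)], of c]
      step_closed[OF scale_list_closed[OF l(1)], of c]
    by (simp add: ad_tens smult_T tens_eq_pairing)
qed

lemma ad_zero: "ad T \<Theta> \<zero>\<^bsub>T\<^esub> = \<zero>\<^bsub>T\<^esub>"
  using T.linear_op_zero[OF linear_op_adT] .

lemma ad_pow_in: "X \<in> carrier T \<Longrightarrow> (ad T \<Theta> ^^ n) X \<in> carrier T"
  using linear_op_closed[OF linear_op_funpow[OF linear_op_adT]] .

text \<open>The n-th power sends a \<otimes> e2 to D1^n a \<otimes> R2^n e2, whose right factor is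
  nonzero because \<open>R2\<close> is injective.\<close>

lemma pure_nil1:
  assumes "a \<in> carrier P1"
  shows "(ad T \<Theta> ^^ n) (tens [(a, e2)]) = \<zero>\<^bsub>T\<^esub> \<longleftrightarrow> (D1 ^^ n) a = \<zero>\<^bsub>P1\<^esub>"
proof
  assume *: "(ad T \<Theta> ^^ n) (tens [(a, e2)]) = \<zero>\<^bsub>T\<^esub>"
  have "(R2 ^^ n) e2 \<noteq> \<zero>\<^bsub>P2\<^esub>" using e2 M2.R_pow_eq_zero by blast
  then obtain \<psi> where \<psi>: "\<psi> \<in> dual_space P2" "\<psi> ((R2 ^^ n) e2) \<noteq> 0"
    using M2.dual_separates[of "(R2 ^^ n) e2"] e2(1) by auto
  show "(D1 ^^ n) a = \<zero>\<^bsub>P1\<^esub>"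
  proof (rule M1.dual_separates)
    fix \<phi> assume "\<phi> \<in> dual_space P1"
    then show "\<phi> ((D1 ^^ n) a) = 0"
      using * \<psi> assms e2 pairing_step_pow_eigen[OF assms e2(1,3) \<psi>(1), of \<phi> n] by (auto simp: ad_pow_tens_zero)
  qed (use assms in simp)
next
  assume "(D1 ^^ n) a = \<zero>\<^bsub>P1\<^esub>"
  then show "(ad T \<Theta> ^^ n) (tens [(a, e2)]) = \<zero>\<^bsub>T\<^esub>"
    using assms e2 by (simp add: ad_pow_tens_zero pairing_step_pow_eigen M1.dual_zero)
qed

lemma pure_nil2:
  assumes "b \<in> carrier P2"
  shows "(ad T \<Theta> ^^ n) (tens [(e1, b)]) = \<zero>\<^bsub>T\<^esub> \<longleftrightarrow> (D2 ^^ n) b = \<zero>\<^bsub>P2\<^esub>"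
proof -
  interpret S: shift_pair P2 G2 D2 R2 P1 G1 D1 R1 by (rule shift_pair_swap)
  have eq: "pairing \<phi> \<psi> ((step ^^ n) [(e1, b)]) = \<psi> ((D2 ^^ n) b) * \<phi> ((R1 ^^ n) e1)"
    if "\<phi> \<in> dual_space P1" for \<phi> \<psi>
    using S.pairing_step_pow_eigen[OF assms e1(1,3) that, of \<psi> n] pairing_step_pow_swap[of \<psi> \<phi> n "[(e1, b)]"]
    by simp
  show ?thesis
  proof
    assume *: "(ad T \<Theta> ^^ n) (tens [(e1, b)]) = \<zero>\<^bsub>T\<^esub>"
    have "(R1 ^^ n) e1 \<noteq> \<zero>\<^bsub>P1\<^esub>" using e1 M1.R_pow_eq_zero by blast
    then obtain \<phi> where \<phi>: "\<phi> \<in> dual_space P1" "\<phi> ((R1 ^^ n) e1) \<noteq> 0"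
      using M1.dual_separates[of "(R1 ^^ n) e1"] e1(1) by auto
    show "(D2 ^^ n) b = \<zero>\<^bsub>P2\<^esub>"
    proof (rule M2.dual_separates)
      fix \<psi> assume "\<psi> \<in> dual_space P2"
      then show "\<psi> ((D2 ^^ n) b) = 0"
        using * \<phi> assms e1 eq[OF \<phi>(1), of \<psi>] by (auto simp: ad_pow_tens_zero)
    qed (use assms in simp)
  next
    assume "(D2 ^^ n) b = \<zero>\<^bsub>P2\<^esub>"
    then show "(ad T \<Theta> ^^ n) (tens [(e1, b)]) = \<zero>\<^bsub>T\<^esub>"
      using assms e1 by (simp add: ad_pow_tens_zero eq M2.dual_zero)
  qed
qed

lemma Ev_T: "Ev T \<Theta> = {0}"
proof
  have X: "tens [(e1, e2)] \<in> carrier T" using e1 e2 by simp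
  moreover have "tens [(e1, e2)] \<noteq> \<zero>\<^bsub>T\<^esub>" using pure_nil1[OF e1(1), of 0] e1 by simp
  moreover have "ad T \<Theta> (tens [(e1, e2)]) = \<zero>\<^bsub>T\<^esub>" using pure_nil1[OF e1(1), of 1] e1 by simp
  ultimately have "\<exists>x\<in>carrier T - {\<zero>\<^bsub>T\<^esub>}. ad T \<Theta> x = 0 \<odot>\<^bsub>T\<^esub> x"
    by (intro bexI[of _ "tens [(e1, e2)]"]) (simp_all add: T.smult_zero'[OF X])
  then show "{0} \<subseteq> Ev T \<Theta>" by (simp add: Ev_def)
  show "Ev T \<Theta> \<subseteq> {0}"
  proof
    fix c assume "c \<in> Ev T \<Theta>"
    then obtain X where X: "X \<in> carrier T" "X \<noteq> \<zero>\<^bsub>T\<^esub>" "ad T \<Theta> X = c \<odot>\<^bsub>T\<^esub> X" by (auto simp: Ev_def)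
    then obtain l where l: "set l \<subseteq> pairs" "X = tens l" by (auto elim: tensE)
    have "c = 0"
    proof (rule ccontr)
      assume c: "c \<noteq> 0"
      have "pairing \<phi> \<psi> (step l) = c * pairing \<phi> \<psi> l" if "\<phi> \<in> dual_space P1" "\<psi> \<in> dual_space P2" for \<phi> \<psi>
        using X(3) l that step_closed[OF l(1)] scale_list_closed[OF l(1), of c]
        by (simp add: ad_tens smult_T tens_eq_pairing pairing_scale_list)
      \<comment> \<open>An eigenvector for c satisfies x = c^(-1) (ad \<Theta>) x, a relation with a
        single term.\<close>
      then have "pairing \<phi> \<psi> l = 0" if "\<phi> \<in> dual_space P1" "\<psi> \<in> dual_space P2" for \<phi> \<psi>
        using c that by (intro relation_imp_zero[where N = 0 and e = "\<lambda>_. 1 / c", OF l(1)]) auto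
      then have "X = \<zero>\<^bsub>T\<^esub>" using l by (simp add: tens_eq_zero)
      with X show False by simp
    qed
    then show "c \<in> {0}" by simp
  qed
qed

text \<open>The form \<phi> \<otimes> \<psi> becomes an actual functional on classes, evaluated on a
  chosen list. It translates relations between elements of the tensor product into relations between
  pairings.\<close>

lemma dual_T:
  assumes "\<phi> \<in> dual_space P1" "\<psi> \<in> dual_space P2"
  obtains \<Phi> where "\<Phi> \<in> dual_space T" "\<And>l. set l \<subseteq> pairs \<Longrightarrow> \<Phi> (tens l) = pairing \<phi> \<psi> l"
proof -
  have "\<forall>X\<in>carrier T. \<exists>l. set l \<subseteq> pairs \<and> tens l = X" by (auto simp: carrier_T)
  from bchoice[OF this] obtain pick where pick: "\<forall>X\<in>carrier T. set (pick X) \<subseteq> pairs \<and> tens (pick X) = X" ..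
  define \<Phi> where "\<Phi> X = pairing \<phi> \<psi> (pick X)" for X
  have \<Phi>: "\<Phi> (tens l) = pairing \<phi> \<psi> l" if "set l \<subseteq> pairs" for l
  proof -
    have "set (pick (tens l)) \<subseteq> pairs" "tens (pick (tens l)) = tens l" using pick that by auto
    then show ?thesis unfolding \<Phi>_def using assms tens_eq_pairing[OF _ that] by simp
  qed
  have "\<Phi> \<in> dual_space T"
    unfolding dual_space_def
  proof (intro CollectI conjI ballI allI)
    fix X Y assume "X \<in> carrier T" "Y \<in> carrier T"
    then show "\<Phi> (X \<oplus>\<^bsub>T\<^esub> Y) = \<Phi> X + \<Phi> Y" by (elim tensE) (simp add: add_T \<Phi>)
  next
    fix c X assume "X \<in> carrier T"
    then show "\<Phi> (c \<odot>\<^bsub>T\<^esub> X) = c * \<Phi> X"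
      using assms by (elim tensE) (simp add: smult_T \<Phi> scale_list_closed pairing_scale_list)
  qed
  with \<Phi> show thesis by (intro that[of \<Phi>])
qed

lemma ad_pow_in_K_ad:
  assumes X: "X \<in> carrier T"
  shows "(ad T \<Theta> ^^ n) X \<in> K_ad T \<Theta> X"
proof -
  let ?p = "monom (1 :: 'k) n"
  have "finsum T (\<lambda>i. coeff ?p i \<odot>\<^bsub>T\<^esub> (ad T \<Theta> ^^ i) X) {..n} =
      finsum T (\<lambda>i. if n = i then (ad T \<Theta> ^^ i) X else \<zero>\<^bsub>T\<^esub>) {..n}"
    using ad_pow_in[OF X] by (intro T.finsum_cong') auto
  also have "\<dots> = (ad T \<Theta> ^^ n) X"
    using ad_pow_in[OF X] by (intro T.finsum_singleton) auto
  finally have "(ad T \<Theta> ^^ n) X = finsum T (\<lambda>i. coeff ?p i \<odot>\<^bsub>T\<^esub> (ad T \<Theta> ^^ i) X) {..degree ?p}"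
    by (simp add: degree_monom_eq)
  then show ?thesis unfolding K_ad_def by blast
qed

text \<open>Finite dimension makes the iterates (ad \<Theta>)^i X linearly dependent, and
  \<open>dependent_imp_zero\<close> turns the dependence into nilpotency.\<close>

lemma F_subset_N: "F_set T \<Theta> \<subseteq> N_set T \<Theta>"
proof
  fix X assume "X \<in> F_set T \<Theta>"
  then obtain B where X: "X \<in> carrier T" and B: "finite B" "B \<subseteq> carrier T" "K_ad T \<Theta> X = lin_span T B"
    by (auto simp: F_set_def fin_dim_def)
  from X obtain l where l: "set l \<subseteq> pairs" "X = tens l" by (rule tensE)
  have "(ad T \<Theta> ^^ i) X \<in> lin_span T B" for i using ad_pow_in_K_ad[OF X] B(3) by simp
  from lin_span_dependent[where v = "\<lambda>i. (ad T \<Theta> ^^ i) X", OF scalar_module_T B(1,2) this]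
  obtain c :: "nat \<Rightarrow> 'k" and N where c: "\<exists>i\<le>N. c i \<noteq> 0"
    "\<And>\<Phi>. \<Phi> \<in> dual_space T \<Longrightarrow> (\<Sum>i\<le>N. c i * \<Phi> ((ad T \<Theta> ^^ i) X)) = 0" by blast
  have "(\<Sum>i\<le>N. c i * pairing \<phi> \<psi> ((step ^^ i) l)) = 0"
    if \<phi>\<psi>: "\<phi> \<in> dual_space P1" "\<psi> \<in> dual_space P2" for \<phi> \<psi>
  proof -
    obtain \<Phi> where \<Phi>: "\<Phi> \<in> dual_space T" "\<And>l. set l \<subseteq> pairs \<Longrightarrow> \<Phi> (tens l) = pairing \<phi> \<psi> l"
      using dual_T[OF \<phi>\<psi>] by metis
    show ?thesis using c(2)[OF \<Phi>(1)] l by (simp add: ad_pow_tens step_pow_closed \<Phi>(2))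
  qed
  from dependent_imp_zero[OF l(1) c(1) this] show "X \<in> N_set T \<Theta>"
    using X l by (auto simp: N_set_def ad_pow_tens_zero)
qed

text \<open>Only the constant coefficient of a polynomial in ad \<Theta> acts, so K[ad \<Theta>](X)
  is spanned by X.\<close>

lemma C_subset_F: "C_set T \<Theta> \<subseteq> F_set T \<Theta>"
proof
  fix X assume "X \<in> C_set T \<Theta>"
  then have X: "X \<in> carrier T" "ad T \<Theta> X = \<zero>\<^bsub>T\<^esub>" by (auto simp: C_set_def)
  have pow: "(ad T \<Theta> ^^ Suc i) X = \<zero>\<^bsub>T\<^esub>" for i
    by (induction i) (use X ad_zero in auto)
  have "finsum T (\<lambda>i. coeff p i \<odot>\<^bsub>T\<^esub> (ad T \<Theta> ^^ i) X) {..degree p} = coeff p 0 \<odot>\<^bsub>T\<^esub> X" for p :: "'k poly"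
  proof -
    have "finsum T (\<lambda>i. coeff p i \<odot>\<^bsub>T\<^esub> (ad T \<Theta> ^^ i) X) {..degree p} =
        finsum T (\<lambda>i. if 0 = i then coeff p i \<odot>\<^bsub>T\<^esub> X else \<zero>\<^bsub>T\<^esub>) {..degree p}"
    proof (rule T.finsum_cong')
      fix i show "coeff p i \<odot>\<^bsub>T\<^esub> (ad T \<Theta> ^^ i) X = (if 0 = i then coeff p i \<odot>\<^bsub>T\<^esub> X else \<zero>\<^bsub>T\<^esub>)"
        using pow[of "i - 1"] X by (cases i) auto
    qed (use X in auto)
    also have "\<dots> = coeff p 0 \<odot>\<^bsub>T\<^esub> X" using X by (intro T.finsum_singleton) auto
    finally show ?thesis .
  qed
  then have K: "K_ad T \<Theta> X = {c \<odot>\<^bsub>T\<^esub> X | c. True}"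
    unfolding K_ad_def by (auto intro: exI[of _ "[:c:]" for c])
  have "submodule {c \<odot>\<^bsub>T\<^esub> X | c. True} scalars T"
  proof (rule T.submodule_scalarsI)
    show "\<zero>\<^bsub>T\<^esub> \<in> {c \<odot>\<^bsub>T\<^esub> X | c. True}" unfolding mem_Collect_eq using X by (intro exI[of _ 0]) simp
    show "x \<oplus>\<^bsub>T\<^esub> y \<in> {c \<odot>\<^bsub>T\<^esub> X | c. True}"
      if "x \<in> {c \<odot>\<^bsub>T\<^esub> X | c. True}" "y \<in> {c \<odot>\<^bsub>T\<^esub> X | c. True}" for x y
      using that X by (auto simp flip: T.smult_plus)
    show "c \<odot>\<^bsub>T\<^esub> x \<in> {c \<odot>\<^bsub>T\<^esub> X | c. True}" if "x \<in> {c \<odot>\<^bsub>T\<^esub> X | c. True}" for c x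
      using that X by (auto simp: T.smult_smult)
  qed (use X in auto)
  moreover have "{X} \<subseteq> {c \<odot>\<^bsub>T\<^esub> X | c. True}" using T.smult_one'[OF X(1)] by (auto intro: exI[of _ 1])
  ultimately have "lin_span T {X} \<subseteq> {c \<odot>\<^bsub>T\<^esub> X | c. True}" by (rule lin_span_minimal)
  moreover have "{c \<odot>\<^bsub>T\<^esub> X | c. True} \<subseteq> lin_span T {X}"
    using T.submodule_smult[OF submodule_lin_span[OF scalar_module_T]] lin_span_superset[of "{X}" T] X by auto
  ultimately show "X \<in> F_set T \<Theta>"
    using X K unfolding F_set_def fin_dim_def by (intro CollectI conjI exI[of _ "{X}"]) auto
qed

lemma N_set_slices:
  assumes l: "set l \<subseteq> pairs" and N: "tens l \<in> N_set T \<Theta>"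
  shows "\<psi> \<in> dual_space P2 \<Longrightarrow> slice P1 \<psi> l \<in> M1.nil"
    and "\<phi> \<in> dual_space P1 \<Longrightarrow> slice P2 \<phi> (map prod.swap l) \<in> M2.nil"
proof -
  from N obtain m where m: "\<And>\<phi> \<psi>. \<phi> \<in> dual_space P1 \<Longrightarrow> \<psi> \<in> dual_space P2 \<Longrightarrow> pairing \<phi> \<psi> ((step ^^ m) l) = 0"
    using l by (auto simp: N_set_def ad_pow_tens_zero)
  show "slice P1 \<psi> l \<in> M1.nil" if "\<psi> \<in> dual_space P2"
    using slice_nil[OF l m that] .
  interpret S: shift_pair P2 G2 D2 R2 P1 G1 D1 R1 by (rule shift_pair_swap)
  have "set (map prod.swap l) \<subseteq> carrier P2 \<times> carrier P1" using l by auto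
  then show "slice P2 \<phi> (map prod.swap l) \<in> M2.nil" if "\<phi> \<in> dual_space P1"
    using S.slice_nil[of "map prod.swap l" m \<phi>] m that by (simp add: pairing_step_pow_swap)
qed

lemma step_kernel:
  "set l \<subseteq> ker1 \<times> ker2 \<Longrightarrow> \<phi> \<in> dual_space P1 \<Longrightarrow> \<psi> \<in> dual_space P2 \<Longrightarrow> pairing \<phi> \<psi> (step l) = 0"
  by (induction l) (auto simp: pairing_step M1.dual_zero M2.dual_zero)

lemma tens_kernel:
  assumes "set l \<subseteq> ker1 \<times> ker2"
  shows "tens l \<in> C_set T \<Theta>"
proof -
  have l: "set l \<subseteq> pairs" using assms by auto
  then show ?thesis using step_kernel[OF assms] by (simp add: C_set_def ad_tens_zero)
qed

lemma N_subset_C: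
  assumes "M1.nil = ker1" "M2.nil = ker2"
  shows "N_set T \<Theta> \<subseteq> C_set T \<Theta>"
proof
  fix X assume N: "X \<in> N_set T \<Theta>"
  then obtain l where l: "set l \<subseteq> pairs" "X = tens l" by (auto simp: N_set_def elim: tensE)
  from slices_decompose[OF l(1), of ker1 ker2] N_set_slices[OF l(1)] N l(2) assms
  obtain l' where "set l' \<subseteq> ker1 \<times> ker2" "X = tens l'" by auto
  then show "X \<in> C_set T \<Theta>" using tens_kernel by blast
qed

lemma C_set_neq_carrier: "C_set T \<Theta> \<noteq> carrier T"
proof -
  from noncentral obtain a where a: "a \<in> carrier P1" "D1 a \<noteq> \<zero>\<^bsub>P1\<^esub>" by blast
  then have "tens [(a, e2)] \<in> carrier T - C_set T \<Theta>"
    using pure_nil1[OF a(1), of 1] e2 by (simp add: C_set_def)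
  then show ?thesis by blast
qed

lemma Omega0'_T: "M1.nil = ker1 \<Longrightarrow> M2.nil = ker2 \<Longrightarrow> \<Theta> \<in> Omega0' T"
proof -
  assume "M1.nil = ker1" "M2.nil = ker2"
  then have "C_set T \<Theta> = F_set T \<Theta>" using C_subset_F F_subset_N N_subset_C by blast
  moreover from this C_set_neq_carrier have "F_set T \<Theta> \<subset> carrier T" by (auto simp: F_set_def)
  ultimately show ?thesis using Ev_T \<Theta>_in by (simp add: Omega0'_def)
qed

lemma C_set_eq:
  assumes "M1.nil = ker1 \<or> M2.nil = ker2"
  shows "C_set T \<Theta> = tensor_subspace P1 P2 ker1 ker2"
proof
  show "tensor_subspace P1 P2 ker1 ker2 \<subseteq> C_set T \<Theta>"
    unfolding tensor_subspace_def
  proof (rule lin_span_minimal)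
    show "submodule (C_set T \<Theta>) scalars T"
      using T.submodule_kernel[OF linear_op_adT] by (simp add: C_set_def)
    show "{pure_tensor P1 P2 a b |a b. a \<in> ker1 \<and> b \<in> ker2} \<subseteq> C_set T \<Theta>"
      using tens_kernel[of "[(a, b)]" for a b] by (auto simp flip: tens_single)
  qed
  let ?U = "tensor_subspace P1 P2 ker1 ker2"
  have "{pure_tensor P1 P2 a b |a b. a \<in> ker1 \<and> b \<in> ker2} \<subseteq> carrier T"
    by (auto simp flip: tens_single)
  then have U: "submodule ?U scalars T"
    unfolding tensor_subspace_def by (rule submodule_lin_span[OF scalar_module_T])
  have tU: "tens l \<in> ?U" if "set l \<subseteq> ker1 \<times> ker2" for l
    using that
  proof (induction l)
    case Nil
    show ?case using T.submodule_zero[OF U] by (simp add: zero_T)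
  next
    case (Cons p l)
    obtain a b where p: "p = (a, b)" by (cases p)
    have "pure_tensor P1 P2 a b \<in> ?U"
      unfolding tensor_subspace_def by (rule subsetD[OF lin_span_superset]) (use Cons.prems p in auto)
    then have "tens [p] \<in> ?U" by (simp add: tens_single p)
    moreover have "tens l \<in> ?U" using Cons by simp
    ultimately have "tens [p] \<oplus>\<^bsub>T\<^esub> tens l \<in> ?U" by (rule T.submodule_add[OF U])
    then show ?case by (simp add: add_T)
  qed
  show "C_set T \<Theta> \<subseteq> ?U"
  proof
    fix X assume C: "X \<in> C_set T \<Theta>"
    then have N: "X \<in> N_set T \<Theta>" using C_subset_F F_subset_N by blast
    from C obtain l where l: "set l \<subseteq> pairs" "X = tens l" by (auto simp: C_set_def elim: tensE)
    have zero: "pairing \<phi> \<psi> (step l) = 0" if "\<phi> \<in> dual_space P1" "\<psi> \<in> dual_space P2" for \<phi> \<psi>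
      using C l that by (simp add: C_set_def ad_tens_zero)
    interpret S: shift_pair P2 G2 D2 R2 P1 G1 D1 R1 by (rule shift_pair_swap)
    have sl: "set (map prod.swap l) \<subseteq> carrier P2 \<times> carrier P1" using l by auto
    have f: "fst ` set l \<subseteq> carrier P1" "fst ` set (map prod.swap l) \<subseteq> carrier P2" using l by auto
    \<comment> \<open>On the side where N equals C, contractions are in the kernel because X lies in
      N(\<Theta>); on the other side \<open>kernel_slice\<close> takes over.\<close>
    have "(\<forall>\<psi>\<in>dual_space P2. slice P1 \<psi> l \<in> ker1) \<and>
        (\<forall>\<phi>\<in>dual_space P1. slice P2 \<phi> (map prod.swap l) \<in> ker2)"
      using assms
    proof
      assume nil: "M1.nil = ker1"
      have "D2 (slice P2 \<phi> (map prod.swap l)) = \<zero>\<^bsub>P2\<^esub>" if "\<phi> \<in> dual_space P1" for \<phi>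
        by (rule kernel_slice[OF l(1) zero _ that]) (use nil in auto)
      moreover have "slice P1 \<psi> l \<in> ker1" if "\<psi> \<in> dual_space P2" for \<psi>
        using N_set_slices(1)[OF l(1)] N l(2) nil that by auto
      ultimately show ?thesis using M2.slice_closed[OF f(2)] by auto
    next
      assume nil: "M2.nil = ker2"
      have "D1 (slice P1 \<psi> (map prod.swap (map prod.swap l))) = \<zero>\<^bsub>P1\<^esub>" if "\<psi> \<in> dual_space P2" for \<psi>
      proof (rule S.kernel_slice[OF sl _ _ that])
        fix \<phi> \<psi> assume "\<phi> \<in> dual_space P2" "\<psi> \<in> dual_space P1"
        then show "pairing \<phi> \<psi> (S.step (map prod.swap l)) = 0"
          using pairing_step_pow_swap[of \<phi> \<psi> 1 l] zero by simp
      qed (use nil in auto)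
      then have "D1 (slice P1 \<psi> l) = \<zero>\<^bsub>P1\<^esub>" if "\<psi> \<in> dual_space P2" for \<psi>
        using that by (simp add: comp_def)
      moreover have "slice P2 \<phi> (map prod.swap l) \<in> ker2" if "\<phi> \<in> dual_space P1" for \<phi>
        using N_set_slices(2)[OF l(1)] N l(2) nil that by auto
      ultimately show ?thesis using M1.slice_closed[OF f(1)] by auto
    qed
    with slices_decompose[OF l(1), of ker1 ker2] l(2) obtain l' where
      "set l' \<subseteq> ker1 \<times> ker2" "X = tens l'" by auto
    then show "X \<in> ?U" using tU by blast
  qed
qed

lemma C_psubset_N:
  assumes "ker1 \<noteq> M1.nil \<or> ker2 \<noteq> M2.nil"
  shows "C_set T \<Theta> \<subset> N_set T \<Theta>"
proof -
  have sub: "ker1 \<subseteq> M1.nil" "ker2 \<subseteq> M2.nil"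
    by (auto simp: M1.nil_def M2.nil_def intro: exI[of _ 1])
  have "\<exists>X. X \<in> N_set T \<Theta> - C_set T \<Theta>"
    using assms
  proof
    assume "ker1 \<noteq> M1.nil"
    with sub obtain a m where a: "a \<in> carrier P1" "D1 a \<noteq> \<zero>\<^bsub>P1\<^esub>" "(D1 ^^ m) a = \<zero>\<^bsub>P1\<^esub>"
      by (auto simp: M1.nil_def)
    then have "tens [(a, e2)] \<in> N_set T \<Theta> - C_set T \<Theta>"
      using pure_nil1[OF a(1), of 1] pure_nil1[OF a(1), of m] e2 by (auto simp: C_set_def N_set_def)
    then show ?thesis ..
  next
    assume "ker2 \<noteq> M2.nil"
    with sub obtain b m where b: "b \<in> carrier P2" "D2 b \<noteq> \<zero>\<^bsub>P2\<^esub>" "(D2 ^^ m) b = \<zero>\<^bsub>P2\<^esub>"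
      by (auto simp: M2.nil_def)
    then have "tens [(e1, b)] \<in> N_set T \<Theta> - C_set T \<Theta>"
      using pure_nil2[OF b(1), of 1] pure_nil2[OF b(1), of m] e1 by (auto simp: C_set_def N_set_def)
    then show ?thesis ..
  qed
  then show ?thesis using C_subset_F F_subset_N by blast
qed

text \<open>One direction tests nilpotency on a \<otimes> e2 and e1 \<otimes> b; the other adds up
  the nilpotency bounds of the finitely many entries of a tensor.\<close>

lemma N_eq_carrier: "N_set T \<Theta> = carrier T \<longleftrightarrow> M1.nil = carrier P1 \<and> M2.nil = carrier P2"
proof (intro iffI conjI)
  assume N: "N_set T \<Theta> = carrier T"
  show "M1.nil = carrier P1"
  proof
    show "carrier P1 \<subseteq> M1.nil"
    proof
      fix a assume a: "a \<in> carrier P1"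
      then have "tens [(a, e2)] \<in> N_set T \<Theta>" using N e2 by simp
      then show "a \<in> M1.nil" using a pure_nil1[OF a] by (auto simp: N_set_def M1.nil_def)
    qed
  qed (auto simp: M1.nil_def)
  show "M2.nil = carrier P2"
  proof
    show "carrier P2 \<subseteq> M2.nil"
    proof
      fix b assume b: "b \<in> carrier P2"
      then have "tens [(e1, b)] \<in> N_set T \<Theta>" using N e1 by simp
      then show "b \<in> M2.nil" using b pure_nil2[OF b] by (auto simp: N_set_def M2.nil_def)
    qed
  qed (auto simp: M2.nil_def)
next
  assume nil: "M1.nil = carrier P1 \<and> M2.nil = carrier P2"
  have "X \<in> N_set T \<Theta>" if X: "X \<in> carrier T" for X
  proof -
    obtain l where l: "set l \<subseteq> pairs" "X = tens l" using X by (rule tensE)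
    with pairing_step_pow_nil[of l] nil obtain n where
      "\<forall>\<phi>\<in>dual_space P1. \<forall>\<psi>\<in>dual_space P2. pairing \<phi> \<psi> ((step ^^ n) l) = 0" by auto
    then show ?thesis using X l by (auto simp: N_set_def ad_pow_tens_zero)
  qed
  then show "N_set T \<Theta> = carrier T" by (auto simp: N_set_def)
qed

lemma nilpotent_T: "ker1 \<noteq> M1.nil \<or> ker2 \<noteq> M2.nil \<Longrightarrow> \<Theta> \<in> nilpotent_elements T"
  using Ev_T \<Theta>_in C_psubset_N
  by (auto simp: nilpotent_elements_def strictly_nilpotent_def weakly_nilpotent_def N_set_def)

lemma strictly_nilpotent_T:
  "ker1 \<noteq> M1.nil \<or> ker2 \<noteq> M2.nil \<Longrightarrow>
    \<Theta> \<in> strictly_nilpotent T \<longleftrightarrow> M1.nil = carrier P1 \<and> M2.nil = carrier P2"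
  using Ev_T \<Theta>_in C_psubset_N by (simp add: strictly_nilpotent_def N_eq_carrier)

end

text \<open>If N(z) is everything, an eigenvalue c satisfies c^m x = 0 for some m, while the unit
  realises the eigenvalue 0; w shows that C(z) is smaller than N(z).\<close>

lemma (in nc_poisson_algebra) strictly_nilpotent_iff:
  assumes z: "z \<in> carrier P" and w: "w \<in> carrier P" "\<lbrace>z, w\<rbrace> \<noteq> \<zero>"
  shows "z \<in> strictly_nilpotent P \<longleftrightarrow> N_set P z = carrier P"
proof
  assume N: "N_set P z = carrier P"
  interpret V: scalar_module P by (rule scalar_module_P)
  have one: "\<one> \<noteq> \<zero>" using one_zeroI w by (metis bracket_zero_right l_null l_one z)
  have "\<lbrace>z, \<one>\<rbrace> = 0 \<odot> \<one>" using z by (simp add: bracket_one_right)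
  then have "0 \<in> Ev P z" using one by (auto simp: Ev_def ad_def)
  moreover have "c = 0" if "c \<in> Ev P z" for c
  proof -
    from that obtain x where x: "x \<in> carrier P" "x \<noteq> \<zero>" "ad P z x = c \<odot> x" by (auto simp: Ev_def)
    have pow: "(ad P z ^^ n) x = c ^ n \<odot> x" for n
      by (induction n) (auto simp: x linear_op_smult[OF linear_op_ad[OF z]] V.smult_smult mult.commute)
    from N x obtain m where "(ad P z ^^ m) x = \<zero>" by (auto simp: N_set_def)
    then have zero: "c ^ m \<odot> x = \<zero>" by (simp add: pow)
    show "c = 0"
    proof (rule ccontr)
      assume "c \<noteq> 0"
      then have "x = inverse (c ^ m) \<odot> (c ^ m \<odot> x)" using x by (simp add: V.smult_smult)
      with zero x show False by simp
    qed
  qed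
  ultimately have "Ev P z = {0}" by auto
  moreover have "C_set P z \<subset> N_set P z" using N w by (auto simp: C_set_def ad_def)
  ultimately show "z \<in> strictly_nilpotent P" using N z by (simp add: strictly_nilpotent_def)
qed (simp add: strictly_nilpotent_def)

section \<open>Filtrations with commutative associated graded algebra\<close>

locale filtered_poisson = nc_poisson_algebra P
  for P :: "('k::alg_closed_field, 'a) nc_poisson" (structure) +
  fixes u :: "'a \<Rightarrow> int extended"
  assumes degree: "degree_map P u"
    and nonneg: "\<forall>x\<in>carrier P. u x = Minf \<or> 0 \<le> u x"
    and filt_finite: "finite_filtration P u"
    and gr_commutative: "commutative_bracket (gr P u)"
begin

sublocale V: scalar_module P
  by (rule scalar_module_P)

lemma u_bracket: "x \<in> carrier P \<Longrightarrow> y \<in> carrier P \<Longrightarrow> u \<lbrace>x, y\<rbrace> \<le> u x + u y"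
  and u_mult: "x \<in> carrier P \<Longrightarrow> y \<in> carrier P \<Longrightarrow> u (x \<otimes> y) = u x + u y"
  and u_Minf: "x \<in> carrier P \<Longrightarrow> u x = Minf \<longleftrightarrow> x = \<zero>"
  and u_Pinf: "x \<in> carrier P \<Longrightarrow> u x \<noteq> Pinf"
  using degree unfolding degree_map_def by metis+

lemma u_nonzero:
  assumes "x \<in> carrier P" "x \<noteq> \<zero>"
  obtains k where "u x = Fin (int k)"
proof (cases "u x")
  case (Fin t)
  then have "0 \<le> t" using nonneg assms by (auto simp: zero_extended_def)
  then show thesis using Fin that[of "nat t"] by simp
qed (use assms u_Minf u_Pinf in auto)

lemma no_zero_divisors: "x \<in> carrier P \<Longrightarrow> y \<in> carrier P \<Longrightarrow> x \<otimes> y = \<zero> \<Longrightarrow> x = \<zero> \<or> y = \<zero>"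
  using u_mult[of x y] u_Minf[of "x \<otimes> y"] by (metis m_closed plus_extended.simps(1) u_nonzero extended.distinct(3))

abbreviation "Ft \<equiv> filt P u"

text \<open>Closure under scalars is read off from P_t being a linear span, not from the
  inequalities for u.\<close>

lemma filt_submodule: "submodule (Ft t) scalars P"
proof -
  from filt_finite obtain B where "B \<subseteq> carrier P" "Ft t = lin_span P B"
    unfolding finite_filtration_def fin_dim_def by metis
  then show ?thesis by (simp add: submodule_lin_span[OF scalar_module_P])
qed

lemma filt_mono: "s \<le> t \<Longrightarrow> Ft s \<subseteq> Ft t"
  by (auto simp: filt_def intro: order_trans)

lemma filt_add: "u x \<le> Fin i \<Longrightarrow> u y \<le> Fin j \<Longrightarrow> u x + u y \<le> Fin (i + j)"
  by (cases "u x"; cases "u y") auto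

lemma filt_bracket_weak: "x \<in> Ft i \<Longrightarrow> y \<in> Ft j \<Longrightarrow> \<lbrace>x, y\<rbrace> \<in> Ft (i + j)"
  using u_bracket[of x y] filt_add[of x i y j] by (auto simp: filt_def bracket_closed)

lemma filt_module: "Module.module scalars (P\<lparr>carrier := Ft t\<rparr>)"
  using submodule.submodule_is_module[OF filt_submodule module_axioms] .

lemma filt_group: "comm_group (add_monoid (P\<lparr>carrier := Ft t\<rparr>))"
  using filt_module Module.module.axioms(2) abelian_group.a_comm_group by blast

lemma filt_subgroup: "subgroup (Ft (t - 1)) (add_monoid (P\<lparr>carrier := Ft t\<rparr>))"
proof -
  have "submodule (Ft (t - 1)) scalars (P\<lparr>carrier := Ft t\<rparr>)"
    by (rule Module.module.module_incl_imp_submodule[OF filt_module]) (use filt_mono filt_module in auto)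
  then show ?thesis by (rule submodule.axioms(1))
qed

lemma gr_piece_group: "comm_group (gr_piece P u t)"
  unfolding gr_piece_def by (rule comm_group.abelian_FactGroup[OF filt_group filt_subgroup])

lemma coset_eq: "Ft s +> x = {h \<oplus> x | h. h \<in> Ft s}"
  by (auto simp: a_r_coset_def r_coset_def)

lemma carrier_gr_piece: "carrier (gr_piece P u t) = {Ft (t - 1) +> x | x. x \<in> Ft t}"
  by (auto simp: gr_piece_def carrier_FactGroup a_r_coset_def r_coset_def)

lemma filt_in: "x \<in> Ft t \<Longrightarrow> x \<in> carrier P"
  by (simp add: filt_def)

lemma coset_absorb:
  assumes "e \<in> Ft s" "c \<in> carrier P"
  shows "Ft s +> (e \<oplus> c) = Ft s +> c"
proof -
  note [simp] = filt_in
  have "\<exists>h'\<in>Ft s. h \<oplus> (e \<oplus> c) = h' \<oplus> c" if "h \<in> Ft s" for h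
    using that assms V.submodule_add[OF filt_submodule that assms(1)]
    by (intro bexI[of _ "h \<oplus> e"]) (auto simp: a_assoc)
  moreover have "\<exists>h'\<in>Ft s. h \<oplus> c = h' \<oplus> (e \<oplus> c)" if "h \<in> Ft s" for h
  proof
    show "h \<ominus> e \<in> Ft s" using V.submodule_minus[OF filt_submodule that assms(1)] .
    show "h \<oplus> c = h \<ominus> e \<oplus> (e \<oplus> c)" using that assms by (simp add: a_minus_def a_assoc r_neg1)
  qed
  ultimately show ?thesis by (fastforce simp: coset_eq)
qed

text \<open>
  The bracket of the classes of \<open>x\<close> and \<open>y\<close> in \<open>gr P\<close> is the class of \<open>\<lbrace>x, y\<rbrace>\<close> in degree \<open>i + j\<close>.
\<close>

lemma filt_bracket:
  assumes x: "x \<in> Ft i" and y: "y \<in> Ft j"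
  shows "\<lbrace>x, y\<rbrace> \<in> Ft (i + j - 1)"
proof (cases "x \<in> Ft (i - 1) \<or> y \<in> Ft (j - 1)")
  \<comment> \<open>An argument of smaller degree gains the missing one already in the weak bound;
    its class in gr P would be 0.\<close>
  case True
  then show ?thesis
    using filt_bracket_weak[of x "i - 1" y j] filt_bracket_weak[of x i y "j - 1"] x y
    by (auto simp: algebra_simps)
next
  case False
  note [simp] = filt_in
  define n where "n = i + j"
  \<comment> \<open>The homogeneous element of degree i given by x: in any other degree k the zero
    class is the subspace \<open>Ft (k - 1)\<close> itself.\<close>
  define X where "X k = (if k = i then Ft (i - 1) +> x else Ft (k - 1))" for k
  define Y where "Y k = (if k = j then Ft (j - 1) +> y else Ft (k - 1))" for k
  have zero_in: "\<zero> \<in> Ft t" for t by (rule V.submodule_zero[OF filt_submodule])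
  have self: "z \<in> Ft (t - 1) +> z" if "z \<in> Ft t" for z t
    using that zero_in[of "t - 1"] by (auto simp: coset_eq intro!: exI[of _ \<zero>])
  have triv: "Ft (t - 1) \<in> carrier (gr_piece P u t)" for t
    using comm_groupE(2)[OF gr_piece_group[of t]] by (simp add: gr_piece_def)
  have XY: "x \<in> X i" "y \<in> Y j" using self x y by (auto simp: X_def Y_def)
  then have ne: "X i \<noteq> Ft (i - 1)" "Y j \<noteq> Ft (j - 1)" using False by auto
  have supp: "{k. X k \<noteq> Ft (k - 1)} = {i}" "{k. Y k \<noteq> Ft (k - 1)} = {j}"
    using ne by (auto simp: X_def Y_def)
  have "X \<in> carrier (gr P u)" "Y \<in> carrier (gr P u)"
    using x y triv by (auto simp: gr_def supp) (auto simp: X_def Y_def carrier_gr_piece)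
  then have zero: "\<lbrace>X, Y\<rbrace>\<^bsub>gr P u\<^esub> = \<zero>\<^bsub>gr P u\<^esub>"
    using gr_commutative by (auto simp: commutative_bracket_def)
  define g where "g = (\<lambda>k. \<Union>x\<in>X k. \<Union>y\<in>Y (n - k). Ft (n - 1) +> \<lbrace>x, y\<rbrace>)"
  have index: "{k. X k \<noteq> Ft (k - 1) \<and> Y (n - k) \<noteq> Ft (n - k - 1)} = {i}"
    using ne by (auto simp: X_def Y_def n_def)
  \<comment> \<open>The bracket on gr P is a union over representatives; changing them alters {x, y}
    only by an e of degree at most n - 1.\<close>
  have const: "Ft (n - 1) +> \<lbrace>x', y'\<rbrace> = Ft (n - 1) +> \<lbrace>x, y\<rbrace>" if "x' \<in> X i" "y' \<in> Y j" for x' y'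
  proof -
    from that obtain h h' where h: "h \<in> Ft (i - 1)" "h' \<in> Ft (j - 1)" "x' = h \<oplus> x" "y' = h' \<oplus> y"
      by (auto simp: X_def Y_def coset_eq)
    define e where "e = (\<lbrace>h, h'\<rbrace> \<oplus> \<lbrace>h, y\<rbrace>) \<oplus> \<lbrace>x, h'\<rbrace>"
    have "\<lbrace>h, h'\<rbrace> \<in> Ft (n - 1)"
      using filt_bracket_weak[OF h(1,2)] filt_mono[of "i - 1 + (j - 1)" "n - 1"] by (auto simp: n_def)
    moreover have "\<lbrace>h, y\<rbrace> \<in> Ft (n - 1)" "\<lbrace>x, h'\<rbrace> \<in> Ft (n - 1)"
      using filt_bracket_weak[OF h(1) y] filt_bracket_weak[OF x h(2)] by (auto simp: n_def algebra_simps)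
    ultimately have e: "e \<in> Ft (n - 1)"
      unfolding e_def by (intro V.submodule_add[OF filt_submodule])
    have "\<lbrace>x', y'\<rbrace> = e \<oplus> \<lbrace>x, y\<rbrace>"
      using h x y by (simp add: e_def bracket_add_left bracket_add_right bracket_closed a_ac)
    then show ?thesis using coset_absorb[OF e] x y by (simp add: bracket_closed)
  qed
  have "n - i = j" by (simp add: n_def)
  then have g: "g i = Ft (n - 1) +> \<lbrace>x, y\<rbrace>"
    using const XY unfolding g_def by blast
  have "\<lbrace>x, y\<rbrace> \<in> Ft n" using filt_bracket_weak[OF x y] by (simp add: n_def)
  then have gc: "g i \<in> carrier (gr_piece P u n)" and mem: "\<lbrace>x, y\<rbrace> \<in> g i"
    using self by (auto simp: g carrier_gr_piece)
  interpret Q: comm_group "gr_piece P u n" by (rule gr_piece_group)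
  have "\<lbrace>X, Y\<rbrace>\<^bsub>gr P u\<^esub> n = finprod (gr_piece P u n) g {i}"
    by (simp add: gr_def gr_op_def index g_def)
  also have "\<dots> = g i" using gc by (subst Q.finprod_insert) auto
  finally show ?thesis using mem zero by (simp add: gr_def n_def)
qed

text \<open>If z had degree 0, multiplication by z would preserve the finite-dimensional P_0 and
  have an eigenvector x. Then (z - c) x = 0, and as there are no zero divisors z would be a scalar,
  hence central.\<close>

lemma degree_pos:
  assumes z: "z \<in> carrier P - poisson_center P"
  obtains d where "u z = Fin (int d)" "d > 0"
proof -
  have zP: "z \<in> carrier P" using z by simp
  have "\<zero> = 0 \<odot> \<one>" by simp
  then have "\<zero> \<in> poisson_center P" using scalar_in_center by metis
  with z have z0: "z \<noteq> \<zero>" by auto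
  from u_nonzero[OF zP z0] obtain d where d: "u z = Fin (int d)" .
  have one0: "\<one> \<noteq> \<zero>" using z0 zP by (metis l_null l_one)
  have "d \<noteq> 0"
  proof
    assume "d = 0"
    then have uz: "u z = Fin 0" using d by simp
    obtain k where "u \<one> = Fin (int k)" using u_nonzero[OF one_closed one0] .
    with u_mult[of \<one> \<one>] have u1: "u \<one> = Fin 0" by simp
    have L: "linear_op P (\<lambda>x. z \<otimes> x)" by (rule linear_op_mult_left[OF zP])
    have "((\<lambda>x. z \<otimes> x) ^^ i) \<one> \<in> carrier P \<and> u (((\<lambda>x. z \<otimes> x) ^^ i) \<one>) = Fin 0" for i
      by (induction i) (auto simp: u1 u_mult uz zP)
    then have "((\<lambda>x. z \<otimes> x) ^^ i) \<one> \<in> Ft 0" for i by (simp add: filt_def)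
    moreover obtain B where "finite B" "B \<subseteq> carrier P" "Ft 0 = lin_span P B"
      using filt_finite unfolding finite_filtration_def fin_dim_def by metis
    ultimately have "\<exists>c. \<exists>x\<in>carrier P - {\<zero>}. z \<otimes> x = c \<odot> x"
      by (intro lin_span_eigenvector[OF scalar_module_P L one_closed one0, of B]) simp_all
    then obtain c x where x: "x \<in> carrier P" "x \<noteq> \<zero>" "z \<otimes> x = c \<odot> x" by blast
    have "(z \<ominus> c \<odot> \<one>) \<otimes> x = \<zero>"
      using x zP by (simp add: a_minus_def l_distr l_minus smult_mult_left r_neg)
    then have "z \<ominus> c \<odot> \<one> = \<zero>" using no_zero_divisors[OF minus_closed[OF zP V.smult_in[OF one_closed]] x(1)] x(2) by metis
    then have "z = c \<odot> \<one>" by (rule V.eq_if_minus_zero[OF zP V.smult_in[OF one_closed]])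
    then show False using z scalar_in_center[of c] by simp
  qed
  with d that show thesis by blast
qed

text \<open>The side of the multiplication is left open, as the two tensor factors need different
  ones.\<close>

lemma shift_operators:
  assumes z: "z \<in> carrier P - poisson_center P"
    and R: "linear_op P R" "\<And>x. x \<in> carrier P \<Longrightarrow> \<lbrace>z, R x\<rbrace> = R \<lbrace>z, x\<rbrace>"
      "\<And>x. x \<in> carrier P \<Longrightarrow> u (R x) = u x + u z"
  shows "shift_operators P (\<lambda>n. Ft (int n - 1)) (ad P z) R"
proof (intro shift_operators.intro shift_operators_axioms.intro scalar_module_P)
  have zP: "z \<in> carrier P" using z by simp
  obtain d where d: "u z = Fin (int d)" "d > 0" using degree_pos[OF z] .
  show "linear_op P (ad P z)" by (rule linear_op_ad[OF zP])
  show "linear_op P R" by (rule R)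
  show "submodule (Ft (int n - 1)) scalars P" for n by (rule filt_submodule)
  show "ad P z (R x) = R (ad P z x)" if "x \<in> carrier P" for x using R(2)[OF that] by (simp add: ad_def)
  show "Ft (int 0 - 1) \<subseteq> {\<zero>}"
  proof
    fix x assume x: "x \<in> Ft (int 0 - 1)"
    show "x \<in> {\<zero>}"
    proof (rule ccontr)
      assume "x \<notin> {\<zero>}"
      with x obtain k where "u x = Fin (int k)" using u_nonzero[of x] filt_in[of x] by blast
      with x show False by (simp add: filt_def)
    qed
  qed
  show "Ft (int n - 1) \<subseteq> Ft (int (Suc n) - 1)" for n by (rule filt_mono) simp
  show "\<exists>n. x \<in> Ft (int n - 1)" if x: "x \<in> carrier P" for x
  proof (cases "x = \<zero>")
    case True
    then show ?thesis using V.submodule_zero[OF filt_submodule] by auto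
  next
    case False
    from u_nonzero[OF x False] obtain k where "u x = Fin (int k)" .
    then show ?thesis using x by (intro exI[of _ "Suc k"]) (simp add: filt_def)
  qed
  show "s \<in> Ft (int n - 1)" if x: "x \<in> Ft (int (Suc n) - 1)" and s: "s \<in> carrier P" "ad P z x = R s" for x s n
  proof -
    \<comment> \<open>With x in P_n, the sharpened bound gives degree at most d + n - 1 for R s, and
      R adds exactly d; so s has degree at most n - 1.\<close>
    have "z \<in> Ft (int d)" using zP d by (simp add: filt_def)
    from filt_bracket[OF this x] have "u (R s) \<le> Fin (int d + (int n - 1))"
      using s(2) by (simp add: ad_def filt_def algebra_simps)
    then have "u s + Fin (int d) \<le> Fin (int d + (int n - 1))" using R(3)[OF s(1)] d by simp
    then show ?thesis using s(1) by (cases "u s") (auto simp: filt_def)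
  qed
  show "\<exists>k. \<forall>s\<in>carrier P. (R ^^ k) s \<in> Ft (int n - 1) \<longrightarrow> (R ^^ k) s = \<zero>" for n
  proof (intro exI[of _ n] ballI impI)
    fix s assume s: "s \<in> carrier P" and in_filt: "(R ^^ n) s \<in> Ft (int n - 1)"
    show "(R ^^ n) s = \<zero>"
    proof (cases "s = \<zero>")
      case True
      then show ?thesis using V.linear_op_zero[OF linear_op_funpow[OF R(1)]] by simp
    next
      case False
      from u_nonzero[OF s False] obtain k where k: "u s = Fin (int k)" .
      \<comment> \<open>Every application adds d \<ge> 1, so the exponent n already forces a degree
        above n - 1.\<close>
      have "u ((R ^^ m) s) = Fin (int (k + m * d))" for m
      proof (induction m)
        case (Suc m)
        then show ?case
          using R(3)[OF linear_op_closed[OF linear_op_funpow[OF R(1)] s]] d by (simp add: algebra_simps)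
      qed (use k in simp)
      then have "int (k + n * d) \<le> int n - 1" using in_filt by (simp add: filt_def)
      moreover have "n \<le> n * d" using d by simp
      ultimately show ?thesis by linarith
    qed
  qed
qed

end

context tensor_pair
begin

text \<open>
  In Class 2, \<open>z\<^sub>1 a \<otimes> z\<^sub>2 b - a z\<^sub>1 \<otimes> b z\<^sub>2 = {z\<^sub>1, a} \<otimes> z\<^sub>2 b + a z\<^sub>1 \<otimes> {z\<^sub>2, b}\<close>, which is the formula of Class 1.
\<close>

lemma ad_pure_tensor:
  assumes N1: "nc_poisson_algebra P1" and N2: "nc_poisson_algebra P2"
    and classes: "(class_1 P1 \<and> class_1 P2) \<or> (class_2 P1 \<and> class_2 P2)"
    and z1: "z1 \<in> carrier P1" and z2: "z2 \<in> carrier P2" and l: "set l \<subseteq> pairs"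
  shows "ad T (pure_tensor P1 P2 z1 z2) (tens l) =
    tens (map (map_prod (ad P1 z1) (\<lambda>y. z2 \<otimes>\<^bsub>P2\<^esub> y)) l @ map (map_prod (\<lambda>x. x \<otimes>\<^bsub>P1\<^esub> z1) (ad P2 z2)) l)"
proof -
  interpret N1: nc_poisson_algebra P1 by fact
  interpret N2: nc_poisson_algebra P2 by fact
  \<comment> \<open>The bracket on generators in both classes, in the form that
    \<open>bilinear_ext_cg\<close> needs.\<close>
  define f :: "'a \<times> 'b \<Rightarrow> 'a \<times> 'b \<Rightarrow> ('a \<times> 'b \<Rightarrow>\<^sub>0 'k)" where
    "f = (if class_1 P1 \<and> class_1 P2
       then (\<lambda>(a1, a2) (b1, b2). gen \<lbrace>a1, b1\<rbrace>\<^bsub>P1\<^esub> (a2 \<otimes>\<^bsub>P2\<^esub> b2) + gen (b1 \<otimes>\<^bsub>P1\<^esub> a1) \<lbrace>a2, b2\<rbrace>\<^bsub>P2\<^esub>)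
       else (\<lambda>(a1, a2) (b1, b2). gen (a1 \<otimes>\<^bsub>P1\<^esub> b1) (a2 \<otimes>\<^bsub>P2\<^esub> b2) - gen (b1 \<otimes>\<^bsub>P1\<^esub> a1) (b2 \<otimes>\<^bsub>P2\<^esub> a2)))"
  have fb: "free_bracket P1 P2 = bilinear_ext f"
  proof (cases "class_1 P1 \<and> class_1 P2")
    case True
    then show ?thesis by (simp add: free_bracket_def f_def)
  next
    case False
    let ?g = "\<lambda>(a1, a2) (b1, b2). gen (a1 \<otimes>\<^bsub>P1\<^esub> b1) (a2 \<otimes>\<^bsub>P2\<^esub> b2) :: 'a \<times> 'b \<Rightarrow>\<^sub>0 'k"
    have f: "f = (\<lambda>p q. ?g p q - ?g q p)" using False by (auto simp: f_def fun_eq_iff)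
    have "free_mult P1 P2 x y - free_mult P1 P2 y x = bilinear_ext f x y" for x y
      unfolding free_mult_def bilinear_ext_flip[of ?g y] f
      by (simp add: bilinear_ext_def free_vs.scale_right_diff_distrib sum_subtractf)
    then show ?thesis using False by (auto simp: free_bracket_def fun_eq_iff)
  qed
  \<comment> \<open>The sum of balanced maps covers Class 1, the difference Class 2.\<close>
  have bal1: "balanced (f p)" if "p \<in> pairs" for p
  proof -
    obtain a b where p: "p = (a, b)" "a \<in> carrier P1" "b \<in> carrier P2" using \<open>p \<in> pairs\<close> by auto
    show ?thesis
      using balanced_add[OF balanced_gen[OF N1.linear_op_ad[OF p(2)] N2.linear_op_mult_left[OF p(3)]]
          balanced_gen[OF N1.linear_op_mult_right[OF p(2)] N2.linear_op_ad[OF p(3)]]]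
        balanced_diff[OF balanced_gen[OF N1.linear_op_mult_left[OF p(2)] N2.linear_op_mult_left[OF p(3)]]
          balanced_gen[OF N1.linear_op_mult_right[OF p(2)] N2.linear_op_mult_right[OF p(3)]]]
      by (simp add: f_def p(1) case_prod_unfold ad_def)
  qed
  have bal2: "balanced (\<lambda>q. f q p)" if "p \<in> pairs" for p
  proof -
    obtain a b where p: "p = (a, b)" "a \<in> carrier P1" "b \<in> carrier P2" using \<open>p \<in> pairs\<close> by auto
    show ?thesis
      using balanced_add[OF balanced_gen[OF N1.linear_op_ad'[OF p(2)] N2.linear_op_mult_right[OF p(3)]]
          balanced_gen[OF N1.linear_op_mult_left[OF p(2)] N2.linear_op_ad'[OF p(3)]]]
        balanced_diff[OF balanced_gen[OF N1.linear_op_mult_right[OF p(2)] N2.linear_op_mult_right[OF p(3)]]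
          balanced_gen[OF N1.linear_op_mult_left[OF p(2)] N2.linear_op_mult_left[OF p(3)]]]
      by (simp add: f_def p(1) case_prod_unfold)
  qed
  have "ad T (pure_tensor P1 P2 z1 z2) (tens l) = tensor_class P1 P2 (bilinear_ext f (gen z1 z2) (rep l))"
    unfolding ad_def poisson_tensor_def nc_poisson.simps fb pure_tensor_def tens_def
    by (intro UN_tensor_class)
      (simp add: tensor_class_eq bilinear_ext_cg[OF bal1 bal2 keys_rep[OF l]] z1 z2)
  moreover have "cg (bilinear_ext f (gen z1 z2) (rep l))
      (rep (map (map_prod (ad P1 z1) (\<lambda>y. z2 \<otimes>\<^bsub>P2\<^esub> y)) l @ map (map_prod (\<lambda>x. x \<otimes>\<^bsub>P1\<^esub> z1) (ad P2 z2)) l))"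
    using l
  proof (induction l)
    case Nil
    then show ?case by (simp add: bilinear_ext_eq)
  next
    case (Cons p l)
    obtain a b where p: "p = (a, b)" by (cases p)
    with Cons.prems have ab: "a \<in> carrier P1" "b \<in> carrier P2" by auto
    let ?D1 = "\<lbrace>z1, a\<rbrace>\<^bsub>P1\<^esub>" and ?D2 = "\<lbrace>z2, b\<rbrace>\<^bsub>P2\<^esub>"
    have entry: "cg (f (z1, z2) (a, b)) (gen ?D1 (z2 \<otimes>\<^bsub>P2\<^esub> b) + gen (a \<otimes>\<^bsub>P1\<^esub> z1) ?D2)"
    proof (cases "class_1 P1 \<and> class_1 P2")
      case True
      then show ?thesis by (simp add: f_def)
    next
      case False
      with classes have c2: "class_2 P1" "class_2 P2" by auto
      have e1: "z1 \<otimes>\<^bsub>P1\<^esub> a = ?D1 \<oplus>\<^bsub>P1\<^esub> (a \<otimes>\<^bsub>P1\<^esub> z1)"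
        using c2(1) z1 ab by (simp add: class_2_def a_minus_def P1.a_assoc P1.l_neg)
      have e2: "z2 \<otimes>\<^bsub>P2\<^esub> b = ?D2 \<oplus>\<^bsub>P2\<^esub> (b \<otimes>\<^bsub>P2\<^esub> z2)"
        using c2(2) z2 ab by (simp add: class_2_def a_minus_def P2.a_assoc P2.l_neg)
      have D: "?D1 \<in> carrier P1" "?D2 \<in> carrier P2" using z1 z2 ab by (auto intro: N1.bracket_closed N2.bracket_closed)
      have "cg (gen (z1 \<otimes>\<^bsub>P1\<^esub> a) (z2 \<otimes>\<^bsub>P2\<^esub> b)) (gen ?D1 (z2 \<otimes>\<^bsub>P2\<^esub> b) + gen (a \<otimes>\<^bsub>P1\<^esub> z1) (z2 \<otimes>\<^bsub>P2\<^esub> b))"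
        unfolding e1 using z1 z2 ab D by (intro cg_gen_add_left) auto
      moreover have "cg (gen (a \<otimes>\<^bsub>P1\<^esub> z1) (z2 \<otimes>\<^bsub>P2\<^esub> b)) (gen (a \<otimes>\<^bsub>P1\<^esub> z1) ?D2 + gen (a \<otimes>\<^bsub>P1\<^esub> z1) (b \<otimes>\<^bsub>P2\<^esub> z2))"
        by (subst e2) (use z1 z2 ab D in \<open>intro cg_gen_add_right; auto\<close>)
      ultimately have "cg (gen (z1 \<otimes>\<^bsub>P1\<^esub> a) (z2 \<otimes>\<^bsub>P2\<^esub> b))
          (gen ?D1 (z2 \<otimes>\<^bsub>P2\<^esub> b) + (gen (a \<otimes>\<^bsub>P1\<^esub> z1) ?D2 + gen (a \<otimes>\<^bsub>P1\<^esub> z1) (b \<otimes>\<^bsub>P2\<^esub> z2)))"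
        by (rule cg_trans[OF _ cg_add[OF cg_refl]])
      from cg_diff[OF this cg_refl[of "gen (a \<otimes>\<^bsub>P1\<^esub> z1) (b \<otimes>\<^bsub>P2\<^esub> z2)"]]
      show ?thesis using False by (simp add: f_def)
    qed
    have split: "bilinear_ext f (gen z1 z2) (rep (p # l)) = f (z1, z2) (a, b) + bilinear_ext f (gen z1 z2) (rep l)"
      by (simp add: bilinear_ext_eq p free_vs.linear_extension_add)
    have "set l \<subseteq> pairs" using Cons.prems by simp
    from cg_add[OF entry Cons.IH[OF this]] show ?case
      unfolding split by (simp add: p ad_def add_ac)
  qed
  ultimately show ?thesis by (simp add: tens_def tensor_class_eq)
qed

end

theorem corollary5p7:
  fixes P1 :: "('k::{alg_closed_field, field_char_0}, 'a) nc_poisson"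
    and P2 :: "('k, 'b) nc_poisson"
    and u1 :: "'a \<Rightarrow> int extended" and u2 :: "'b \<Rightarrow> int extended"
    and z1 :: 'a and z2 :: 'b
    and T :: "('k, ('a \<times> 'b \<Rightarrow>\<^sub>0 'k) set) nc_poisson"
    and \<Theta> :: "('a \<times> 'b \<Rightarrow>\<^sub>0 'k) set"
  assumes "nc_poisson_algebra P1" and "nc_poisson_algebra P2"
    and "(class_1 P1 \<and> class_1 P2) \<or> (class_2 P1 \<and> class_2 P2)"
    and "degree_map P1 u1" and "\<forall>x\<in>carrier P1. u1 x = Minf \<or> 0 \<le> u1 x"
    and "degree_map P2 u2" and "\<forall>x\<in>carrier P2. u2 x = Minf \<or> 0 \<le> u2 x"
    and "finite_filtration P1 u1" and "discrete_filtration P1 u1"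
    and "finite_filtration P2 u2" and "discrete_filtration P2 u2"
    and "commutative_bracket (gr P1 u1)" and "commutative_bracket (gr P2 u2)"
    and "z1 \<in> carrier P1 - poisson_center P1" and "z2 \<in> carrier P2 - poisson_center P2"
    and "T = poisson_tensor P1 P2" and "\<Theta> = pure_tensor P1 P2 z1 z2"
  shows "(C_set P1 z1 \<subset> N_set P1 z1 \<or> C_set P2 z2 \<subset> N_set P2 z2 \<longrightarrow>
            \<Theta> \<in> nilpotent_elements T \<and>
            (\<Theta> \<in> strictly_nilpotent T \<longleftrightarrow>
               z1 \<in> strictly_nilpotent P1 \<and> z2 \<in> strictly_nilpotent P2)) \<and>
         (N_set P1 z1 = C_set P1 z1 \<and> N_set P2 z2 = C_set P2 z2 \<longrightarrow> \<Theta> \<in> Omega0' T) \<and>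
         (N_set P1 z1 = C_set P1 z1 \<or> N_set P2 z2 = C_set P2 z2 \<longrightarrow>
            C_set T \<Theta> = tensor_subspace P1 P2 (C_set P1 z1) (C_set P2 z2))"
proof -
  interpret F1: filtered_poisson P1 u1
    using assms by (intro filtered_poisson.intro filtered_poisson_axioms.intro)
  interpret F2: filtered_poisson P2 u2
    using assms by (intro filtered_poisson.intro filtered_poisson_axioms.intro)
  have z: "z1 \<in> carrier P1" "z2 \<in> carrier P2" using assms by auto
  obtain w1 where w1: "w1 \<in> carrier P1" "\<lbrace>z1, w1\<rbrace>\<^bsub>P1\<^esub> \<noteq> \<zero>\<^bsub>P1\<^esub>"
    using F1.noncentral_bracket[of z1] assms by blast
  obtain w2 where w2: "w2 \<in> carrier P2" "\<lbrace>z2, w2\<rbrace>\<^bsub>P2\<^esub> \<noteq> \<zero>\<^bsub>P2\<^esub>"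
    using F2.noncentral_bracket[of z2] assms by blast
  have one: "\<one>\<^bsub>P1\<^esub> \<noteq> \<zero>\<^bsub>P1\<^esub>" "\<one>\<^bsub>P2\<^esub> \<noteq> \<zero>\<^bsub>P2\<^esub>"
    using w1 w2 z by (metis F1.bracket_zero_right F1.l_null F1.l_one, metis F2.bracket_zero_right F2.l_null F2.l_one)
  \<comment> \<open>Multiplication by z on either side commutes with ad z by the Leibniz rule and
    {z, z} = 0. The sides are those in the formula for \<open>ad \<Theta>\<close>: right for
    \<open>z1\<close>, left for \<open>z2\<close>.\<close>
  have pair: "shift_pair P1 (\<lambda>n. filt P1 u1 (int n - 1)) (ad P1 z1) (\<lambda>x. x \<otimes>\<^bsub>P1\<^esub> z1)
      P2 (\<lambda>n. filt P2 u2 (int n - 1)) (ad P2 z2) (\<lambda>y. z2 \<otimes>\<^bsub>P2\<^esub> y)"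
    unfolding shift_pair_def
  proof
    show "shift_operators P1 (\<lambda>n. filt P1 u1 (int n - 1)) (ad P1 z1) (\<lambda>x. x \<otimes>\<^bsub>P1\<^esub> z1)"
      using assms z by (intro F1.shift_operators F1.linear_op_mult_right)
        (auto simp: F1.leibniz F1.bracket_alternating F1.bracket_closed F1.u_mult)
    show "shift_operators P2 (\<lambda>n. filt P2 u2 (int n - 1)) (ad P2 z2) (\<lambda>y. z2 \<otimes>\<^bsub>P2\<^esub> y)"
      using assms z by (intro F2.shift_operators F2.linear_op_mult_left)
        (auto simp: F2.leibniz F2.bracket_alternating F2.bracket_closed F2.u_mult add.commute)
  qed
  have tensor: "tensor_pair P1 P2"
    by (simp add: tensor_pair_def F1.scalar_module_P F2.scalar_module_P)
  interpret S: shift_pair P1 "\<lambda>n. filt P1 u1 (int n - 1)" "ad P1 z1" "\<lambda>x. x \<otimes>\<^bsub>P1\<^esub> z1"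
    P2 "\<lambda>n. filt P2 u2 (int n - 1)" "ad P2 z2" "\<lambda>y. z2 \<otimes>\<^bsub>P2\<^esub> y" by (rule pair)
  interpret Q: tensor_pair P1 P2 by (rule tensor)
  interpret X: poisson_shift_pair P1 "\<lambda>n. filt P1 u1 (int n - 1)" "ad P1 z1" "\<lambda>x. x \<otimes>\<^bsub>P1\<^esub> z1"
    P2 "\<lambda>n. filt P2 u2 (int n - 1)" "ad P2 z2" "\<lambda>y. z2 \<otimes>\<^bsub>P2\<^esub> y" \<Theta> "\<one>\<^bsub>P1\<^esub>" "\<one>\<^bsub>P2\<^esub>"
  proof
    show "\<Theta> \<in> carrier (poisson_tensor P1 P2)"
      using Q.tens_in[of "[(z1, z2)]"] z assms by (simp add: Q.tens_single)
    show "ad (poisson_tensor P1 P2) \<Theta> (Q.tens l) = Q.tens (S.step l)" if "set l \<subseteq> carrier P1 \<times> carrier P2" for l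
      using Q.ad_pure_tensor[OF assms(1-3) z that] assms by (simp add: S.step_def)
    show "\<exists>a\<in>carrier P1. ad P1 z1 a \<noteq> \<zero>\<^bsub>P1\<^esub>" using w1 by (auto simp: ad_def)
  qed (use one z in \<open>auto simp: ad_def F1.bracket_one_right F2.bracket_one_right\<close>)
  have N: "N_set P1 z1 = S.M1.nil" "N_set P2 z2 = S.M2.nil"
    by (simp_all add: N_set_def S.M1.nil_def S.M2.nil_def)
  have C: "C_set P1 z1 = X.ker1" "C_set P2 z2 = X.ker2"
    by (simp_all add: C_set_def)
  have sub: "X.ker1 \<subseteq> S.M1.nil" "X.ker2 \<subseteq> S.M2.nil"
    by (auto simp: S.M1.nil_def S.M2.nil_def intro: exI[of _ 1])
  \<comment> \<open>For noncentral elements strict nilpotency reduces to N(z) = P, the form in which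
    it is decided for \<Theta>.\<close>
  have strict: "z1 \<in> strictly_nilpotent P1 \<longleftrightarrow> S.M1.nil = carrier P1"
    "z2 \<in> strictly_nilpotent P2 \<longleftrightarrow> S.M2.nil = carrier P2"
    using F1.strictly_nilpotent_iff[OF z(1) w1] F2.strictly_nilpotent_iff[OF z(2) w2] by (simp_all add: N)
  show ?thesis
    unfolding assms(16) N C strict
  proof (intro conjI impI)
    assume "X.ker1 \<subset> S.M1.nil \<or> X.ker2 \<subset> S.M2.nil"
    then have *: "X.ker1 \<noteq> S.M1.nil \<or> X.ker2 \<noteq> S.M2.nil" by auto
    show "\<Theta> \<in> nilpotent_elements (poisson_tensor P1 P2)" by (rule X.nilpotent_T[OF *])
    show "\<Theta> \<in> strictly_nilpotent (poisson_tensor P1 P2) \<longleftrightarrow> S.M1.nil = carrier P1 \<and> S.M2.nil = carrier P2"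
      by (rule X.strictly_nilpotent_T[OF *])
  next
    assume "S.M1.nil = X.ker1 \<and> S.M2.nil = X.ker2"
    then show "\<Theta> \<in> Omega0' (poisson_tensor P1 P2)" by (intro X.Omega0'_T) auto
  next
    assume "S.M1.nil = X.ker1 \<or> S.M2.nil = X.ker2"
    then show "C_set (poisson_tensor P1 P2) \<Theta> = tensor_subspace P1 P2 X.ker1 X.ker2" by (rule X.C_set_eq)
  qed
qed

end
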